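(* Let $r_+>0$, $S<0$, $R,\widetilde R\in\mathbb R$, $X=S(\widetilde r-\widetilde R)$. Let $\psi_1,\psi_2$ be complex-valued functions of $(u,r)\in\mathbb R\times[r_+,\infty)$ which are sufficiently regular and decaying (e.g. smooth with compact support in $\mathbb R\times[r_+,\infty)$), and let $$\widetilde\psi_i(\widetilde v,\widetilde r)=\int_{r_+}^\infty\psi_i\big(\widetilde v+X(r-R),r\big)\,dr .$$ Let $I\subset\mathbb R$ be any interval in the $X$-line. Let $\widetilde\tau=\widetilde v+f(\widetilde r)$ be a regular time function on $\{X\in I\}$, and regard $\widetilde\psi_i$ as functions of $(\widetilde\tau,\widetilde r)$. Then $$|S|\int_{\{X\in I\}}\int_{\mathbb R}\partial_{\widetilde\tau}\widetilde\psi_1\,\overline{\widetilde\psi_2}\,d\widetilde\tau\,d\widetilde r=\frac1{2\pi}\int_{\mathbb R}\int_{r_+}^\infty\int_{r_+}^\infty\widehat{\psi_1}(\xi,r)\overline{\widehat{\psi_2}(\xi,s)}\Big(\int_Ii\xi e^{i\xi X(r-s)}\,dX\Big)ds\,dr\,d\xi ,$$ where for infinite $I$ the inner integral is understood in the sense of distributions. In particular: (i) If $I=(\alpha,\beta)$ is finite, then $$|S|\int_{\{X\in I\}}\int_{\mathbb R}\partial_{\widetilde\tau}\widetilde\psi_1\,\overline{\widetilde\psi_2}\,d\widetilde\tau\,d\widetilde r=\mathrm{p.v.}\int_{\mathbb R}\int_{r_+}^\infty\int_{r_+}^\infty\frac{\psi_1(u+\beta r,r)\overline{\psi_2(u+\beta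 s,s)}}{r-s}\,ds\,dr\,du-\mathrm{p.v.}\int_{\mathbb R}\int_{r_+}^\infty\int_{r_+}^\infty\frac{\psi_1(u+\alpha r,r)\overline{\psi_2(u+\alpha s,s)}}{r-s}\,ds\,dr\,du .$$ (ii) If $I=(-\infty,-2)$, then $$|S|\int_{\{X<-2\}}\int_{\mathbb R}\partial_{\widetilde\tau}\widetilde\psi_1\,\overline{\widetilde\psi_2}\,d\widetilde\tau\,d\widetilde r=\pi\int_{\mathbb R}\int_{r_+}^\infty\psi_1\,\overline{H_u\psi_2}\,dr\,du+\mathrm{p.v.}\int_{\mathbb R}\int_{r_+}^\infty\int_{r_+}^\infty\psi_1\big(u-2(r-R),r\big)\overline{\psi_2\big(u-2(s-R),s\big)}\,\frac{ds\,dr\,du}{r-s}.$$ (iii) If $I=\mathbb R$, then $$|S|\int_{\{X\in\mathbb R\}}\int_{\mathbb R}\partial_{\widetilde\tau}\widetilde\psi_1\,\overline{\widetilde\psi_2}\,d\widetilde\tau\,d\widetilde r=2\pi\int_{\mathbb R}\int_{r_+}^\infty\psi_1(u,r)\,\overline{H_u\psi_2(u,r)}\,dr\,du .$$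
   Context: Fourier transform in $u$: $\widehat f(\xi)=\int_{\mathbb R}e^{-iu\xi}f(u)\,du$. $H_u$ is the Hilbert transform in $u$, with $\widehat{H_uf}(\xi)=-i\,\mathrm{sgn}(\xi)\widehat f(\xi)$. Principal values are taken at $r=s$. The functions may depend on further angular parameters, which are suppressed. *)

theory Defs
  imports "HOL-Analysis.Analysis"
begin

section \<open>Functions on the half-plane\<close>

text \<open>
  Functions of \<open>(u, r)\<close> on \<open>\<real> \<times> [rp, \<infinity>)\<close> are curried functions on all of \<open>\<real> \<times> \<real>\<close> whose values
  at \<open>r < rp\<close> are never used. \<open>D j k\<close> is the mixed partial derivative of order \<open>j\<close> in \<open>u\<close> and
  \<open>k\<close> in \<open>r\<close>; on the boundary line \<open>r = rp\<close> the \<open>r\<close>-derivatives are one-sided.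
\<close>

definition half_plane_derivs ::
  "real \<Rightarrow> (real \<Rightarrow> real \<Rightarrow> complex) \<Rightarrow> (nat \<Rightarrow> nat \<Rightarrow> real \<Rightarrow> real \<Rightarrow> complex) \<Rightarrow> bool" where
  "half_plane_derivs rp \<psi> D \<longleftrightarrow>
     (\<forall>u. \<forall>r\<ge>rp. D 0 0 u r = \<psi> u r) \<and>
     (\<forall>j k. continuous_on (UNIV \<times> {rp..}) (\<lambda>(u, r). D j k u r)) \<and>
     (\<forall>j k u. \<forall>r\<ge>rp.
        ((\<lambda>v. D j k v r) has_vector_derivative D (Suc j) k u r) (at u) \<and>
        ((\<lambda>s. D j k u s) has_vector_derivative D j (Suc k) u r) (at r within {rp..}))"

text \<open>
  Sufficiently regular and decaying: smooth up to the boundary, and all derivatives decay faster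
  than any power of \<open>\<bar>u\<bar> + \<bar>r\<bar>\<close>.
\<close>

definition schwartz_half_plane :: "real \<Rightarrow> (real \<Rightarrow> real \<Rightarrow> complex) \<Rightarrow> bool" where
  "schwartz_half_plane rp \<psi> \<longleftrightarrow>
     (\<exists>D. half_plane_derivs rp \<psi> D \<and>
       (\<forall>j k N. \<exists>C. \<forall>u. \<forall>r\<ge>rp. (1 + \<bar>u\<bar> + \<bar>r\<bar>) ^ N * norm (D j k u r) \<le> C))"

lemma half_plane_derivs_vanish:
  assumes D: "half_plane_derivs rp \<psi> D"
    and supp: "\<And>u r. rp \<le> r \<Longrightarrow> M < \<bar>u\<bar> + \<bar>r\<bar> \<Longrightarrow> \<psi> u r = 0"
    and "rp \<le> r" "M < \<bar>u\<bar> + \<bar>r\<bar>"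
  shows "D j k u r = 0"
proof -
  define Z where
    "Z = (\<lambda>j k. \<forall>u r. rp \<le> r \<longrightarrow> M < \<bar>u\<bar> + \<bar>r\<bar> \<longrightarrow> D j k u r = 0)"
  have Z00: "Z 0 0"
    using D supp by (simp add: half_plane_derivs_def Z_def)
  have Zj: "Z (Suc j) k" if Z: "Z j k" for j k
    unfolding Z_def
  proof (intro allI impI)
    fix u r assume r: "rp \<le> r" and M: "M < \<bar>u\<bar> + \<bar>r\<bar>"
    have 1: "((\<lambda>v. D j k v r) has_vector_derivative D (Suc j) k u r) (at u)"
      using D r by (simp add: half_plane_derivs_def)
    have "((\<lambda>v. D j k v r) has_vector_derivative 0) (at u)"
    proof (rule has_vector_derivative_transform_within_open)
      show "((\<lambda>_. 0) has_vector_derivative 0) (at u)"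
        by simp
      show "open {v::real. M < \<bar>v\<bar> + \<bar>r\<bar>}"
        by (intro open_Collect_less continuous_intros)
      show "u \<in> {v. M < \<bar>v\<bar> + \<bar>r\<bar>}"
        using M by simp
      show "0 = D j k v r" if "v \<in> {v. M < \<bar>v\<bar> + \<bar>r\<bar>}" for v
        using Z r that by (simp add: Z_def)
    qed
    with 1 show "D (Suc j) k u r = 0"
      by (rule vector_derivative_unique_at)
  qed
  have Zk: "Z j (Suc k)" if Z: "Z j k" for j k
    unfolding Z_def
  proof (intro allI impI)
    fix u r assume r: "rp \<le> r" and M: "M < \<bar>u\<bar> + \<bar>r\<bar>"
    have 1: "((\<lambda>s. D j k u s) has_vector_derivative D j (Suc k) u r) (at r within {rp..})"
      using D r by (simp add: half_plane_derivs_def)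
    define d where "d = \<bar>u\<bar> + \<bar>r\<bar> - M"
    have "((\<lambda>s. D j k u s) has_vector_derivative 0) (at r within {rp..})"
    proof (rule has_vector_derivative_transform_within)
      show "((\<lambda>_. 0) has_vector_derivative 0) (at r within {rp..})"
        by simp
      show "0 < d" using M by (simp add: d_def)
      show "r \<in> {rp..}" using r by simp
      show "0 = D j k u s" if s: "s \<in> {rp..}" "dist s r < d" for s
      proof -
        have "M < \<bar>u\<bar> + \<bar>s\<bar>"
          using s(2) unfolding d_def dist_real_def by arith
        then show ?thesis using Z s(1) by (simp add: Z_def)
      qed
    qed
    moreover have "at r within {rp..} \<noteq> bot"
    proof -
      have "r islimpt {r..r + 1}" by (rule connected_imp_perfect) auto
      then have "r islimpt {rp..}" by (rule islimpt_subset) (use r in auto)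
      then show ?thesis by (simp add: trivial_limit_within)
    qed
    ultimately show "D j (Suc k) u r = 0"
      using 1 by (metis vector_derivative_unique_within)
  qed
  have "Z j 0" for j by (induction j) (auto intro: Z00 Zj)
  then have "Z j k" for j k by (induction k) (auto intro: Zk)
  with assms(3,4) show ?thesis by (auto simp: Z_def)
qed

lemma smooth_compact_support_imp_schwartz_half_plane:
  assumes D: "half_plane_derivs rp \<psi> D"
    and supp: "\<And>u r. rp \<le> r \<Longrightarrow> M < \<bar>u\<bar> + \<bar>r\<bar> \<Longrightarrow> \<psi> u r = 0"
  shows "schwartz_half_plane rp \<psi>"
  unfolding schwartz_half_plane_def
proof (intro exI[of _ D] conjI allI D)
  fix j k N
  define K where "K = {- M..M} \<times> {rp..max rp M}"
  define g where "g = (\<lambda>(u, r). (1 + \<bar>u\<bar> + \<bar>r\<bar>) ^ N * norm (D j k u r))"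
  have "continuous_on K (\<lambda>(u, r). D j k u r)"
  proof (rule continuous_on_subset)
    show "continuous_on (UNIV \<times> {rp..}) (\<lambda>(u, r). D j k u r)"
      using D by (simp add: half_plane_derivs_def)
  qed (auto simp: K_def)
  then have "continuous_on K g"
    unfolding g_def case_prod_beta by (intro continuous_intros)
  moreover have "compact K" unfolding K_def by (intro compact_Times) auto
  ultimately have "bounded (g ` K)"
    by (intro compact_imp_bounded compact_continuous_image)
  then obtain B where B: "\<And>x. x \<in> K \<Longrightarrow> \<bar>g x\<bar> \<le> B"
    by (auto simp: bounded_iff)
  show "\<exists>C. \<forall>u. \<forall>r\<ge>rp. (1 + \<bar>u\<bar> + \<bar>r\<bar>) ^ N * norm (D j k u r) \<le> C"
  proof (intro exI[of _ "max 0 B"] allI impI)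
    fix u r assume r: "rp \<le> r"
    show "(1 + \<bar>u\<bar> + \<bar>r\<bar>) ^ N * norm (D j k u r) \<le> max 0 B"
    proof (cases "M < \<bar>u\<bar> + \<bar>r\<bar>")
      case True
      then show ?thesis using half_plane_derivs_vanish[OF D supp r True] by simp
    next
      case False
      then have "(u, r) \<in> K" using r by (auto simp: K_def)
      then show ?thesis using B[of "(u, r)"] by (auto simp: g_def)
    qed
  qed
qed


section \<open>Fourier and Hilbert transform, principal values\<close>

definition fourier :: "(real \<Rightarrow> complex) \<Rightarrow> real \<Rightarrow> complex" where
  "fourier f \<xi> = (LBINT u. exp (- (\<i> * of_real u * of_real \<xi>)) * f u)"

text \<open>
  The multiplier operator with symbol \<open>- \<i> sgn \<xi>\<close>, i.e.\ the inverse Fourier transform of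
  \<open>- \<i> sgn \<xi>\<close> times the Fourier transform of \<open>f\<close>; meaningful when \<open>fourier f\<close> is integrable.
\<close>

definition hilbert :: "(real \<Rightarrow> complex) \<Rightarrow> real \<Rightarrow> complex" where
  "hilbert f u =
     1 / (2 * of_real pi) *
       (LBINT \<xi>. exp (\<i> * of_real u * of_real \<xi>) * (- \<i> * of_real (sgn \<xi>) * fourier f \<xi>))"

text \<open>
  The principal value at \<open>r = s\<close> of the triple integral of \<open>g u r s\<close> over
  \<open>\<real> \<times> [rp, \<infinity>) \<times> [rp, \<infinity>)\<close> exists and equals \<open>z\<close>. Bochner integrals of non-integrable functions
  are \<open>0\<close>, so absolute convergence of the truncated integrals is part of the definition.
\<close>

definition has_pv :: "real \<Rightarrow> (real \<Rightarrow> real \<Rightarrow> real \<Rightarrow> complex) \<Rightarrow> complex \<Rightarrow> bool" where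
  "has_pv rp g z \<longleftrightarrow>
     (\<forall>\<epsilon>>0. set_integrable lborel {(u, r, s). rp \<le> r \<and> rp \<le> s \<and> \<epsilon> < \<bar>r - s\<bar>} (\<lambda>(u, r, s). g u r s)) \<and>
     ((\<lambda>\<epsilon>. LBINT u. LBINT r:{rp..}. LBINT s:{s. rp \<le> s \<and> \<epsilon> < \<bar>r - s\<bar>}. g u r s)
        \<longlongrightarrow> z) (at_right 0)"


section \<open>The transformed functions and the flux\<close>

definition tilde ::
  "real \<Rightarrow> real \<Rightarrow> real \<Rightarrow> real \<Rightarrow> (real \<Rightarrow> real \<Rightarrow> complex) \<Rightarrow> real \<Rightarrow> real \<Rightarrow> complex" where
  "tilde rp S R Rt \<psi> vt rt = (LBINT r:{rp..}. \<psi> (vt + S * (rt - Rt) * (r - R)) r)"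

definition X_region :: "real \<Rightarrow> real \<Rightarrow> real set \<Rightarrow> real set" where
  "X_region S Rt I = {rt. S * (rt - Rt) \<in> I}"

text \<open>
  \<open>\<tau> = vt + f rt\<close> is a regular time function over \<open>A\<close>: \<open>f\<close> is continuously differentiable on \<open>A\<close>,
  with one-sided derivatives at those end points of the interval that belong to it.
\<close>

definition regular_time_function :: "real set \<Rightarrow> (real \<Rightarrow> real) \<Rightarrow> bool" where
  "regular_time_function A f \<longleftrightarrow>
     (\<exists>f'. continuous_on A f' \<and> (\<forall>x\<in>A. (f has_real_derivative f' x) (at x within A)))"

text \<open>A function of \<open>(vt, rt)\<close> expressed in the coordinates \<open>(\<tau>, rt)\<close> with \<open>\<tau> = vt + f rt\<close>.\<close>

definition in_time_coords ::
  "(real \<Rightarrow> real) \<Rightarrow> (real \<Rightarrow> real \<Rightarrow> complex) \<Rightarrow> real \<Rightarrow> real \<Rightarrow> complex" where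
  "in_time_coords f \<Psi> \<tau> rt = \<Psi> (\<tau> - f rt) rt"

definition flux_density ::
  "(real \<Rightarrow> real) \<Rightarrow> (real \<Rightarrow> real \<Rightarrow> complex) \<Rightarrow> (real \<Rightarrow> real \<Rightarrow> complex) \<Rightarrow> real \<Rightarrow> real \<Rightarrow> complex" where
  "flux_density f \<Psi>1 \<Psi>2 \<tau> rt =
     vector_derivative (\<lambda>t. in_time_coords f \<Psi>1 t rt) (at \<tau>) * cnj (in_time_coords f \<Psi>2 \<tau> rt)"

definition flux ::
  "real \<Rightarrow> real \<Rightarrow> real set \<Rightarrow> (real \<Rightarrow> real) \<Rightarrow>
   (real \<Rightarrow> real \<Rightarrow> complex) \<Rightarrow> (real \<Rightarrow> real \<Rightarrow> complex) \<Rightarrow> complex" where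
  "flux S Rt I f \<Psi>1 \<Psi>2 =
     of_real \<bar>S\<bar> * (LBINT rt:X_region S Rt I. LBINT \<tau>. flux_density f \<Psi>1 \<Psi>2 \<tau> rt)"

definition X_kernel :: "real set \<Rightarrow> real \<Rightarrow> real \<Rightarrow> real \<Rightarrow> complex" where
  "X_kernel I \<xi> r s =
     (LBINT X:I. \<i> * of_real \<xi> * exp (\<i> * of_real \<xi> * of_real X * of_real (r - s)))"

definition kernel_pairing ::
  "real \<Rightarrow> real set \<Rightarrow> (real \<Rightarrow> real \<Rightarrow> real \<Rightarrow> complex) \<Rightarrow> complex" where
  "kernel_pairing rp I \<phi> =
     (LBINT \<xi>. LBINT r:{rp..}. LBINT s:{rp..}. \<phi> \<xi> r s * X_kernel I \<xi> r s)"

text \<open>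
  For infinite \<open>I\<close> the integral defining \<open>X_kernel I\<close> diverges. As a distribution it is the limit
  of the kernels of the truncations \<open>I \<inter> [a, b]\<close> as \<open>a \<rightarrow> -\<infinity>\<close> and \<open>b \<rightarrow> \<infinity>\<close> independently, the
  limit being taken after pairing with \<open>\<phi>\<close>.
\<close>

definition has_distributional_pairing ::
  "real \<Rightarrow> real set \<Rightarrow> (real \<Rightarrow> real \<Rightarrow> real \<Rightarrow> complex) \<Rightarrow> complex \<Rightarrow> bool" where
  "has_distributional_pairing rp I \<phi> z \<longleftrightarrow>
     (\<forall>a b. set_integrable lborel (UNIV \<times> {rp..} \<times> {rp..})
              (\<lambda>(\<xi>, r, s). \<phi> \<xi> r s * X_kernel (I \<inter> {a..b}) \<xi> r s)) \<and>
     ((\<lambda>(a, b). kernel_pairing rp (I \<inter> {a..b}) \<phi>) \<longlongrightarrow> z) (at_bot \<times>\<^sub>F at_top)"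

end

theory Submission
  imports Defs "HOL-Probability.Sinc_Integral" "HOL-Probability.Characteristic_Functions"
begin

text \<open>
  Extend \<open>\<psi>1, \<psi>2\<close> by \<open>0\<close> to \<open>r < rp\<close> and put \<open>G\<^sub>i(v, X) = \<integral> \<psi>\<^sub>i(v + X r, r) dr\<close>. Translations in
  \<open>v\<close> remove both \<open>f\<close> and \<open>R\<close>, so that the flux over \<open>I\<close> is \<open>\<integral>\<^sub>I h\<close> with
  \<open>h(X) = \<integral> \<partial>\<^sub>v G\<^sub>1 cnj G\<^sub>2 dv\<close>. Since \<open>X (\<partial>\<^sub>u \<psi>)(v + X r, r)\<close> is an \<open>r\<close>-derivative up to
  \<open>\<partial>\<^sub>r \<psi>\<close>, both \<open>\<partial>\<^sub>v G\<^sub>1\<close> in \<open>L\<^sup>1\<close> and \<open>G\<^sub>2\<close> in \<open>L\<^sup>\<infinity>\<close> are \<open>O(1/X)\<close>, whence \<open>h = O(1/X\<^sup>2)\<close>.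

  The Fourier transform of \<open>G\<^sub>i\<close> in \<open>v\<close> is \<open>F\<^sub>i(\<xi>, \<xi> X)\<close>, with \<open>F\<^sub>i\<close> the Fourier transform of \<open>\<psi>\<^sub>i\<close> in
  both variables. Parseval gives \<open>2\<pi> h(X) = \<integral> i \<xi> F\<^sub>1(\<xi>, \<xi> X) cnj F\<^sub>2(\<xi>, \<xi> X) d\<xi>\<close>, and Fubini the
  kernel formula for bounded \<open>I\<close>; unbounded \<open>I\<close> follow because \<open>h\<close> is integrable. For \<open>I = \<real>\<close>, integrate
  in \<open>X\<close> first, substitute \<open>\<eta> = \<xi> X\<close>, which turns \<open>i \<xi>\<close> into \<open>i sgn \<xi>\<close>, and apply Plancherel in \<open>\<eta>\<close>.

  Let \<open>P\<^sub>\<epsilon>(b)\<close> be the truncated principal value integral. The kernel formula shows that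
  \<open>P\<^sub>\<epsilon>(b) - P\<^sub>\<epsilon>(a)\<close> tends to the integral of \<open>h\<close> over \<open>(a, b)\<close>, while \<open>P\<^sub>\<epsilon>(X) + P\<^sub>\<epsilon>(-X)\<close> converges
  to an absolutely convergent integral \<open>E(X)\<close>, which vanishes as \<open>X \<rightarrow> \<infinity>\<close>. At \<open>X = 0\<close> this gives
  the existence of the principal value \<open>P(0)\<close>, hence of every \<open>P(b)\<close>, and in the limit
  \<open>P(-\<infinity>) = - \<integral> h / 2\<close>, which is (ii).
\<close>

section \<open>Integration\<close>

text \<open>For non-integrable \<open>f\<close> the Bochner integral is 0, while \<open>g\<close>,
  dominating a norm, has a nonnegative integral.\<close>

lemma norm_integral_le:
  fixes f :: "'a \<Rightarrow> 'b::{banach, second_countable_topology}"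
  assumes g: "integrable M g" and le: "\<And>x. norm (f x) \<le> g x"
  shows "norm (integral\<^sup>L M f) \<le> integral\<^sup>L M g"
proof (cases "integrable M f")
  case True
  have "norm (integral\<^sup>L M f) \<le> (\<integral>x. norm (f x) \<partial>M)"
    by (rule integral_norm_bound)
  also have "\<dots> \<le> integral\<^sup>L M g"
    using True g le by (intro integral_mono) auto
  finally show ?thesis .
next
  case False
  have "0 \<le> g x" for x using le[of x] norm_ge_zero order_trans by blast
  then show ?thesis using False by (simp add: not_integrable_integral_eq)
qed

lemma integrable_le:
  fixes f :: "'a \<Rightarrow> 'b::{banach, second_countable_topology}" and g :: "'a \<Rightarrow> real"
  assumes "integrable M g" "f \<in> borel_measurable M" "\<And>x. norm (f x) \<le> g x"
  shows "integrable M f"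
  using assms(1,2)
proof (rule Bochner_Integration.integrable_bound)
  show "AE x in M. norm (f x) \<le> norm (g x)"
    using assms(3) by (intro AE_I2) (metis abs_ge_self order_trans real_norm_def)
qed

text \<open>Limits in a metric space can be tested on sequences, so dominated convergence applies
  along each sequence in \<open>S - {a}\<close>. The majorant is required only at points other than
  \<open>a\<close>, as suits difference quotients.\<close>

lemma tendsto_integral_at_within:
  fixes f :: "'a::metric_space \<Rightarrow> 'b \<Rightarrow> 'c::{banach, second_countable_topology}" and w :: "'b \<Rightarrow> real"
  assumes w: "integrable M w" and m: "\<And>t. t \<in> S \<Longrightarrow> f t \<in> borel_measurable M"
    and ml: "l \<in> borel_measurable M"
    and lim: "AE x in M. ((\<lambda>t. f t x) \<longlongrightarrow> l x) (at a within S)"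
    and le: "\<And>t x. t \<in> S \<Longrightarrow> t \<noteq> a \<Longrightarrow> norm (f t x) \<le> w x"
  shows "((\<lambda>t. integral\<^sup>L M (f t)) \<longlongrightarrow> integral\<^sup>L M l) (at a within S)"
  unfolding tendsto_at_iff_sequentially
proof (intro allI impI)
  fix X :: "nat \<Rightarrow> 'a" assume X: "\<forall>i. X i \<in> S - {a}" and Xa: "X \<longlonglongrightarrow> a"
  have "(\<lambda>i. integral\<^sup>L M (f (X i))) \<longlonglongrightarrow> integral\<^sup>L M l"
  proof (rule integral_dominated_convergence)
    show "integrable M w" "l \<in> borel_measurable M" by fact+
    show "f (X i) \<in> borel_measurable M" for i using X m by auto
    show "AE x in M. (\<lambda>i. f (X i) x) \<longlonglongrightarrow> l x"
      using lim
    proof eventually_elim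
      case (elim x)
      show ?case using elim[unfolded tendsto_at_iff_sequentially] X Xa
        by (auto simp: comp_def)
    qed
    show "AE x in M. norm (f (X i) x) \<le> w x" for i using X le by auto
  qed
  then show "((\<lambda>t. integral\<^sup>L M (f t)) \<circ> X) \<longlonglongrightarrow> integral\<^sup>L M l"
    by (simp add: comp_def)
qed

text \<open>The Tonelli criterion, for sheared integrands such as
  \<open>c j k (v + X * r) r\<close>, whose inner integral is easy to bound although no product
  majorant is at hand.\<close>

lemma integrable_pair_of_integral_bound:
  fixes f :: "'a::euclidean_space \<Rightarrow> 'b::euclidean_space \<Rightarrow> 'c::{banach, second_countable_topology}"
    and g :: "'a \<Rightarrow> real"
  assumes m: "(\<lambda>x. f (fst x) (snd x)) \<in> borel_measurable borel"
    and g: "integrable lborel g" and f: "\<And>x. integrable lborel (f x)"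
    and le: "\<And>x. (\<integral>y. norm (f x y) \<partial>lborel) \<le> g x"
  shows "integrable (lborel \<Otimes>\<^sub>M lborel) (\<lambda>(x, y). f x y)"
proof (rule lborel_pair.Fubini_integrable)
  show m': "(\<lambda>(x, y). f x y) \<in> borel_measurable (lborel \<Otimes>\<^sub>M lborel)"
    using m by (simp add: lborel_prod case_prod_beta')
  have m2: "(\<lambda>(x, y). norm (f x y)) \<in> borel_measurable (lborel \<Otimes>\<^sub>M lborel)"
    using measurable_compose[OF m' borel_measurable_norm] by (simp add: case_prod_beta')
  show "integrable lborel (\<lambda>x. \<integral>y. norm (case (x, y) of (x, y) \<Rightarrow> f x y) \<partial>lborel)"
    using g
  proof (rule integrable_le)
    have "(\<lambda>x. \<integral>y. norm (f x y) \<partial>lborel) \<in> borel_measurable lborel"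
      using m2 by (rule lborel.borel_measurable_lebesgue_integral)
    then show "(\<lambda>x. \<integral>y. norm (case (x, y) of (x, y) \<Rightarrow> f x y) \<partial>lborel) \<in> borel_measurable lborel"
      by simp
    fix x
    show "norm (\<integral>y. norm (case (x, y) of (x, y) \<Rightarrow> f x y) \<partial>lborel) \<le> g x"
      using le[of x] by (simp add: integral_nonneg_AE)
  qed
  show "AE x in lborel. integrable lborel (\<lambda>y. case (x, y) of (x, y) \<Rightarrow> f x y)"
    using f by simp
qed

lemma integrable_pair_of_product_bound:
  fixes f :: "'a::euclidean_space \<Rightarrow> 'b::euclidean_space \<Rightarrow> 'c::{banach, second_countable_topology}"
    and g :: "'a \<Rightarrow> real" and k :: "'b \<Rightarrow> real"
  assumes m: "(\<lambda>x. f (fst x) (snd x)) \<in> borel_measurable borel"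
    and g: "integrable lborel g" and k: "integrable lborel k"
    and le: "\<And>x y. norm (f x y) \<le> g x * k y"
  shows "integrable (lborel \<Otimes>\<^sub>M lborel) (\<lambda>(x, y). f x y)"
proof (rule integrable_pair_of_integral_bound[OF m])
  show "integrable lborel (\<lambda>x. g x * integral\<^sup>L lborel k)" using g by simp
  show f: "integrable lborel (f x)" for x
  proof (rule integrable_le)
    show "integrable lborel (\<lambda>y. g x * k y)" using k by simp
    show "f x \<in> borel_measurable lborel"
      using measurable_compose[OF _ m, of "Pair x"] by simp
  qed (rule le)
  show "(\<integral>y. norm (f x y) \<partial>lborel) \<le> g x * integral\<^sup>L lborel k" for x
  proof -
    have "(\<integral>y. norm (f x y) \<partial>lborel) \<le> (\<integral>y. g x * k y \<partial>lborel)"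
      using f k le by (intro integral_mono) auto
    then show ?thesis by simp
  qed
qed

lemma integral_pair_swap:
  fixes f :: "'a::euclidean_space \<Rightarrow> 'b::euclidean_space \<Rightarrow> 'c::{banach, second_countable_topology}"
  assumes "integrable (lborel \<Otimes>\<^sub>M lborel) (\<lambda>(x, y). f x y)"
  shows "(\<integral>x. (\<integral>y. f x y \<partial>lborel) \<partial>lborel) = (\<integral>y. (\<integral>x. f x y \<partial>lborel) \<partial>lborel)"
  using lborel_pair.Fubini_integral[OF assms] by simp

lemma integral_swap_of_product_bound:
  fixes f :: "'a::euclidean_space \<Rightarrow> 'b::euclidean_space \<Rightarrow> 'c::{banach, second_countable_topology}"
    and g :: "'a \<Rightarrow> real" and k :: "'b \<Rightarrow> real"
  assumes "(\<lambda>x. f (fst x) (snd x)) \<in> borel_measurable borel"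
    and "integrable lborel g" and "integrable lborel k"
    and "\<And>x y. norm (f x y) \<le> g x * k y"
  shows "(\<integral>x. (\<integral>y. f x y \<partial>lborel) \<partial>lborel) = (\<integral>y. (\<integral>x. f x y \<partial>lborel) \<partial>lborel)"
  by (rule integral_pair_swap[OF integrable_pair_of_product_bound]) (use assms in auto)

lemma integrable_translate:
  fixes f :: "real \<Rightarrow> 'a::{banach, second_countable_topology}"
  shows "integrable lborel f \<Longrightarrow> integrable lborel (\<lambda>x. f (x + t))"
    and "integrable lborel f \<Longrightarrow> integrable lborel (\<lambda>x. f (x - t))"
    and "integrable lborel f \<Longrightarrow> integrable lborel (\<lambda>x. f (t - x))"
  using lborel_integrable_real_affine[of f 1 t] lborel_integrable_real_affine[of f 1 "-t"]
    lborel_integrable_real_affine[of f "-1" t]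
  by (simp_all add: add.commute)

lemma integral_translate:
  fixes f :: "real \<Rightarrow> 'a::{banach, second_countable_topology}"
  shows "(\<integral>x. f (x + t) \<partial>lborel) = integral\<^sup>L lborel f"
    and "(\<integral>x. f (x - t) \<partial>lborel) = integral\<^sup>L lborel f"
    and "(\<integral>x. f (t - x) \<partial>lborel) = integral\<^sup>L lborel f"
  using lborel_integral_real_affine[of 1 f t] lborel_integral_real_affine[of 1 f "-t"]
    lborel_integral_real_affine[of "-1" f t]
  by (simp_all add: add.commute)

section \<open>Integrals of derivatives over the line and over a half-line\<close>

lemma integral_whole_line_derivative:
  fixes F f :: "real \<Rightarrow> 'a::euclidean_space"
  assumes d: "\<And>x. (F has_vector_derivative f x) (at x)"
    and c: "continuous_on UNIV f" and i: "integrable lborel f"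
    and lim: "(F \<longlongrightarrow> 0) at_top" "(F \<longlongrightarrow> 0) at_bot"
  shows "integral\<^sup>L lborel f = 0"
proof -
  have "(LBINT x=-\<infinity>..\<infinity>. f x) = 0 - 0"
  proof (rule interval_integral_FTC_integrable)
    show "(F has_vector_derivative f x) (at x)" for x by (rule d)
    show "isCont f x" for x
      using c continuous_on_eq_continuous_at open_UNIV by blast
    show "set_integrable lborel (einterval (-\<infinity>) \<infinity>) f"
      using i by (simp add: set_integrable_def)
    show "((F \<circ> real_of_ereal) \<longlongrightarrow> 0) (at_right (-\<infinity>))"
      using lim(2) by (simp add: ereal_tendsto_simps)
    show "((F \<circ> real_of_ereal) \<longlongrightarrow> 0) (at_left \<infinity>)"
      using lim(1) by (simp add: ereal_tendsto_simps)
  qed auto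
  then show ?thesis by (simp add: interval_lebesgue_integral_def set_lebesgue_integral_def)
qed

text \<open>At \<open>a\<close> only a one-sided derivative exists, so the fundamental theorem is
  applied on the open half-line; one-sided continuity at \<open>a\<close> supplies the boundary
  value, and the end point is a null set.\<close>

lemma integral_half_line_derivative:
  fixes F f :: "real \<Rightarrow> 'a::euclidean_space"
  assumes d: "\<And>x. a \<le> x \<Longrightarrow> (F has_vector_derivative f x) (at x within {a..})"
    and c: "continuous_on {a..} f" and i: "set_integrable lborel {a..} f"
    and lim: "(F \<longlongrightarrow> 0) at_top"
  shows "(LBINT x:{a..}. f x) = - F a"
proof -
  have "(LBINT x=a..\<infinity>. f x) = 0 - F a"
  proof (rule interval_integral_FTC_integrable)
    fix x assume "ereal a < ereal x" "ereal x < \<infinity>"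
    then have x: "a < x" by simp
    then have *: "at x within {a..} = at x"
      by (intro at_within_interior) (simp add: interior_Ici[of "a - 1"])
    show "(F has_vector_derivative f x) (at x)" using d[of x] x * by simp
    show "isCont f x"
      using c x * by (metis atLeast_iff continuous_on_eq_continuous_within less_imp_le)
  next
    show "set_integrable lborel (einterval a \<infinity>) f"
      by (rule set_integrable_subset[OF i]) (auto simp: einterval_def)
    have "(F \<longlongrightarrow> F a) (at a within {a..})"
      using has_vector_derivative_continuous[OF d[of a]] by (simp add: continuous_within)
    then have "(F \<longlongrightarrow> F a) (at_right a)"
      by (rule tendsto_within_subset) auto
    then show "((F \<circ> real_of_ereal) \<longlongrightarrow> F a) (at_right (ereal a))"
      by (simp add: ereal_tendsto_simps)
    show "((F \<circ> real_of_ereal) \<longlongrightarrow> 0) (at_left \<infinity>)"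
      using lim(1) by (simp add: ereal_tendsto_simps)
  qed auto
  also have "(LBINT x=a..\<infinity>. f x) = (LBINT x:{a<..}. f x)"
    by (simp add: interval_lebesgue_integral_def einterval_eq_Ici)
  also have "\<dots> = (LBINT x:{a..}. f x)"
    unfolding set_lebesgue_integral_def
  proof (rule integral_cong_AE)
    have m: "(\<lambda>x. indicator {a..} x *\<^sub>R f x) \<in> borel_measurable lborel"
      using i by (simp add: set_integrable_def)
    then show "(\<lambda>x. indicator {a..} x *\<^sub>R f x) \<in> borel_measurable lborel" .
    \<comment> \<open>Nothing is known of \<open>f\<close> to the left of \<open>a\<close>, so
      measurability is inherited from its cut-off to \<open>{a..}\<close>.\<close>
    have "(\<lambda>x. indicator {a<..} x *\<^sub>R (indicator {a..} x *\<^sub>R f x)) \<in> borel_measurable lborel"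
      by (rule borel_measurable_scaleR[OF borel_measurable_indicator m]) simp
    also have "(\<lambda>x. indicator {a<..} x *\<^sub>R (indicator {a..} x *\<^sub>R f x)) = (\<lambda>x. indicator {a<..} x *\<^sub>R f x)"
      by (auto simp: indicator_def)
    finally show "(\<lambda>x. indicator {a<..} x *\<^sub>R f x) \<in> borel_measurable lborel" .
    show "AE x in lborel. indicator {a<..} x *\<^sub>R f x = indicator {a..} x *\<^sub>R f x"
      using AE_lborel_singleton[of a] by eventually_elim (auto simp: indicator_def)
  qed
  finally show ?thesis by simp
qed

section \<open>The weight \<open>1 / (1 + x\<^sup>2)\<close>\<close>

text \<open>One integrable weight measures all decay: two derivatives in \<open>u\<close> buy a
  factor \<open>wt \<xi>\<close> on the Fourier side, and by \<open>abs_wt_le_1\<close> one such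
  factor absorbs a factor \<open>\<bar>\<xi>\<bar>\<close>.\<close>

definition wt :: "real \<Rightarrow> real" where
  "wt x = inverse (1 + x\<^sup>2)"

lemma wt_pos [simp]: "0 < wt x" and wt_nonneg [simp]: "0 \<le> wt x"
  by (simp_all add: wt_def add_pos_nonneg)

lemma wt_le_1 [simp]: "wt x \<le> 1"
  by (simp add: wt_def inverse_le_1_iff)

lemma wt_measurable [measurable]: "wt \<in> borel_measurable borel"
  unfolding wt_def by measurable

lemma wt_integrable [simp]: "integrable lborel wt"
  using integrable_inverse_1_plus_square
  by (simp add: set_integrable_def wt_def[abs_def])

lemma wt_minus [simp]: "wt (- x) = wt x"
  by (simp add: wt_def)

lemma abs_wt_le_1: "\<bar>x\<bar> * wt x \<le> 1"
proof -
  have "\<bar>x\<bar> \<le> 1 + x\<^sup>2"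
    using sum_squares_bound[of "1" "\<bar>x\<bar>"] by (simp add: power2_eq_square)
  then show ?thesis by (simp add: wt_def field_simps add_pos_nonneg)
qed

lemma wt_tendsto_0: "(wt \<longlongrightarrow> 0) at_top" "(wt \<longlongrightarrow> 0) at_bot"
proof -
  have *: "filterlim (\<lambda>x::real. 1 + x\<^sup>2) at_top at_top"
    by (rule filterlim_tendsto_add_at_top[OF tendsto_const])
      (intro filterlim_pow_at_top filterlim_ident, simp_all)
  show 1: "(wt \<longlongrightarrow> 0) at_top"
    unfolding wt_def[abs_def]
    by (rule tendsto_inverse_0_at_top[OF *])
  show "(wt \<longlongrightarrow> 0) at_bot"
    using filterlim_compose[OF 1 filterlim_uminus_at_top_at_bot] by simp
qed

text \<open>A Peetre-type inequality: undoing the shift by \<open>b * r\<close> costs at most a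
  multiple of \<open>inverse (wt r)\<close>. A spare factor \<open>wt r\<close> pays for it in
  \<open>pv_triple_integrable\<close>.\<close>

lemma wt_shear: "wt (u + b * r) \<le> 2 * (1 + b\<^sup>2) * wt u * inverse (wt r)"
proof -
  have "1 + u\<^sup>2 \<le> 2 * (1 + b\<^sup>2) * ((1 + r\<^sup>2) * (1 + (u + b * r)\<^sup>2))"
  proof -
    have "u\<^sup>2 \<le> 2 * (u + b * r)\<^sup>2 + 2 * (b * r)\<^sup>2"
      using sum_squares_ge_zero[of "u + 2 * (b * r)" 0] by (simp add: power2_eq_square algebra_simps)
    then have "1 + u\<^sup>2 \<le> 2 * (1 + b\<^sup>2 * r\<^sup>2 + (u + b * r)\<^sup>2)"
      by (simp add: power_mult_distrib)
    \<comment> \<open>The added nonnegative terms complete the product of the three factors on the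
      right.\<close>
    also have "\<dots> \<le> 2 * (1 + b\<^sup>2 * r\<^sup>2 + (u + b * r)\<^sup>2 + (b\<^sup>2 + r\<^sup>2 + (b\<^sup>2 + r\<^sup>2 + b\<^sup>2 * r\<^sup>2) * (u + b * r)\<^sup>2))"
      by simp
    also have "\<dots> = 2 * (1 + b\<^sup>2) * ((1 + r\<^sup>2) * (1 + (u + b * r)\<^sup>2))"
      by (simp add: algebra_simps)
    finally show ?thesis .
  qed
  then show ?thesis by (simp add: wt_def field_simps add_pos_nonneg)
qed

section \<open>The Fourier transform\<close>

lemma norm_exp_ii [simp]:
  "norm (exp (\<i> * complex_of_real a)) = 1"
  "norm (exp (\<i> * complex_of_real a * complex_of_real b)) = 1"
  "norm (exp (- (\<i> * complex_of_real a * complex_of_real b))) = 1"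
  by (simp_all add: norm_exp_eq_Re)

lemma borel_measurable_cnj [measurable (raw)]:
  "f \<in> borel_measurable M \<Longrightarrow> (\<lambda>x. cnj (f x)) \<in> borel_measurable M"
  by (rule borel_measurable_continuous_on) (intro continuous_intros)

lemma fourier_measurable [measurable]:
  assumes [measurable]: "f \<in> borel_measurable borel"
  shows "fourier f \<in> borel_measurable borel"
  unfolding fourier_def by measurable

lemma norm_fourier_le:
  assumes "integrable lborel g" "\<And>u. norm (f u) \<le> g u"
  shows "norm (fourier f \<xi>) \<le> integral\<^sup>L lborel g"
  unfolding fourier_def by (rule norm_integral_le) (use assms in \<open>simp_all add: norm_mult\<close>)

text \<open>The conjugate of the inverse kernel is the forward kernel, so Fubini moves the transform
  to the other factor. Both Parseval's formula and the pairing with the Hilbert transform rest on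
  this.\<close>

lemma fourier_multiplication:
  assumes f: "integrable lborel f" and g: "integrable lborel g"
  shows "(\<integral>u. f u * cnj (\<integral>\<xi>. exp (\<i> * of_real u * of_real \<xi>) * g \<xi> \<partial>lborel) \<partial>lborel)
       = (\<integral>\<xi>. fourier f \<xi> * cnj (g \<xi>) \<partial>lborel)"
proof -
  have [measurable]: "f \<in> borel_measurable borel" "g \<in> borel_measurable borel"
    using f g by auto
  define k where "k = (\<lambda>u \<xi>. f u * (exp (- (\<i> * of_real u * of_real \<xi>)) * cnj (g \<xi>)))"
  have "(\<integral>u. f u * cnj (\<integral>\<xi>. exp (\<i> * of_real u * of_real \<xi>) * g \<xi> \<partial>lborel) \<partial>lborel)
      = (\<integral>u. \<integral>\<xi>. k u \<xi> \<partial>lborel \<partial>lborel)"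
  proof -
    have "cnj (\<integral>\<xi>. exp (\<i> * of_real u * of_real \<xi>) * g \<xi> \<partial>lborel) =
        (\<integral>\<xi>. cnj (exp (\<i> * of_real u * of_real \<xi>) * g \<xi>) \<partial>lborel)" for u
      by (rule Bochner_Integration.integral_cnj[symmetric])
    then show ?thesis unfolding k_def by (simp add: exp_cnj)
  qed
  also have "\<dots> = (\<integral>\<xi>. \<integral>u. k u \<xi> \<partial>lborel \<partial>lborel)"
  proof (rule integral_swap_of_product_bound)
    show "(\<lambda>x. k (fst x) (snd x)) \<in> borel_measurable borel"
      unfolding k_def borel_prod[symmetric] by measurable
    show "integrable lborel (\<lambda>x. norm (f x))" "integrable lborel (\<lambda>x. norm (g x))"
      using f g by auto
  qed (simp add: k_def norm_mult)
  also have "\<dots> = (\<integral>\<xi>. (\<integral>u. exp (- (\<i> * of_real u * of_real \<xi>)) * f u \<partial>lborel) * cnj (g \<xi>) \<partial>lborel)"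
    unfolding k_def by (subst integral_mult_left_zero[symmetric]) (simp add: ac_simps)
  finally show ?thesis by (simp add: fourier_def)
qed

text \<open>The characteristic function of the standard normal law, unfolded into an integral
  against its density; it evaluates the Gaussian regularisation of the inversion integral.\<close>

lemma gaussian_char: 
  "(\<integral>x. of_real (std_normal_density x) * exp (\<i> * of_real t * of_real x) \<partial>lborel)
     = complex_of_real (exp (- t\<^sup>2 / 2))"
proof -
  have "char std_normal_distribution t = complex_of_real (exp (- t\<^sup>2 / 2))"
    using char_std_normal_distribution by metis
  moreover have "char std_normal_distribution t =
      (\<integral>x. std_normal_density x *\<^sub>R exp (\<i> * of_real (t * x)) \<partial>lborel)"
    unfolding char_def by (rule integral_density) (auto simp: normal_density_nonneg)
  ultimately show ?thesis by (simp add: scaleR_conv_of_real mult.assoc)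
qed

text \<open>
  Only continuity of \<open>f\<close> at the single point \<open>u\<close> is used: the Plancherel formula below needs it for
  a correlation function known to be continuous only at \<open>0\<close>.
\<close>

lemma fourier_inversion:
  assumes f: "integrable lborel f" and K: "\<And>x. norm (f x) \<le> K"
    and cont: "isCont f u" and fh: "integrable lborel (fourier f)"
  shows "(\<integral>\<xi>. exp (\<i> * of_real u * of_real \<xi>) * fourier f \<xi> \<partial>lborel) = 2 * of_real pi * f u"
proof -
  have [measurable]: "f \<in> borel_measurable borel" using f by auto
  define N where "N = std_normal_density"
  define c where "c = sqrt (2 * pi)"
  have c: "0 < c" "c * c = 2 * pi" by (auto simp: c_def)
  have [measurable]: "N \<in> borel_measurable borel" by (simp add: N_def)
  have N: "N x = exp (- x\<^sup>2 / 2) / c" for x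
    by (simp add: N_def std_normal_density_def c_def)
  have Ni: "integrable lborel N" unfolding N_def by simp
  have N0: "0 \<le> N x" "N x \<le> 1 / c" for x using c by (auto simp: N divide_right_mono)
  have Nc: "isCont N x" for x using c unfolding N[abs_def] by (intro continuous_intros) auto
  \<comment> \<open>The inversion integral damped by a Gaussian. Its limit as \<open>e\<close> tends
    to 0 is computed twice: from this form in \<open>J1\<close>, and in \<open>J3\<close> from the
    form found in \<open>J2\<close>.\<close>
  define J where "J = (\<lambda>e. \<integral>\<xi>. of_real (N (e * \<xi>)) * (exp (\<i> * of_real u * of_real \<xi>) * fourier f \<xi>) \<partial>lborel)"
  have J1: "(J \<longlongrightarrow> (\<integral>\<xi>. of_real (1 / c) * (exp (\<i> * of_real u * of_real \<xi>) * fourier f \<xi>) \<partial>lborel)) (at 0 within {0<..})"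
    unfolding J_def
  proof (rule tendsto_integral_at_within)
    show "integrable lborel (\<lambda>\<xi>. 1 / c * norm (fourier f \<xi>))" using fh by simp
    have "((\<lambda>t. N (t * \<xi>)) \<longlongrightarrow> N (0 * \<xi>)) (at 0 within {0<..})" for \<xi>
      by (rule isCont_tendsto_compose[OF Nc]) (intro tendsto_intros)
    then have N0': "((\<lambda>t. N (t * \<xi>)) \<longlongrightarrow> 1 / c) (at 0 within {0<..})" for \<xi>
      by (simp add: N)
    show "AE \<xi> in lborel. ((\<lambda>t. of_real (N (t * \<xi>)) * (exp (\<i> * of_real u * of_real \<xi>) * fourier f \<xi>)) \<longlongrightarrow>
      of_real (1 / c) * (exp (\<i> * of_real u * of_real \<xi>) * fourier f \<xi>)) (at 0 within {0<..})"
      by (intro AE_I2 tendsto_mult tendsto_const tendsto_of_real N0')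
    show "norm (of_real (N (t * \<xi>)) * (exp (\<i> * of_real u * of_real \<xi>) * fourier f \<xi>)) \<le> 1 / c * norm (fourier f \<xi>)"
      for t \<xi>
    proof -
      have "norm (of_real (N (t * \<xi>)) * (exp (\<i> * of_real u * of_real \<xi>) * fourier f \<xi>)) = N (t * \<xi>) * norm (fourier f \<xi>)"
        using N0(1)[of "t * \<xi>"] by (simp add: norm_mult)
      then show ?thesis using mult_right_mono[OF N0(2)[of "t * \<xi>"], of "norm (fourier f \<xi>)"] by simp
    qed
  qed measurable
  \<comment> \<open>By Fubini the damping in frequency becomes a Gaussian average of
    \<open>f\<close> about \<open>u\<close> at scale \<open>e\<close>.\<close>
  have J2: "J e = (\<integral>z. of_real (c * N z) * f (u + e * z) \<partial>lborel)" if e: "0 < e" for e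
  proof -
    define k where "k = (\<lambda>\<xi> y. of_real (N (e * \<xi>)) * (exp (\<i> * of_real (u - y) * of_real \<xi>) * f y))"
    have "J e = (\<integral>\<xi>. \<integral>y. k \<xi> y \<partial>lborel \<partial>lborel)"
    proof -
      have "k \<xi> y = of_real (N (e * \<xi>)) * exp (\<i> * of_real u * of_real \<xi>) * (exp (- (\<i> * of_real y * of_real \<xi>)) * f y)" for \<xi> y
      proof -
        have "exp (\<i> * of_real (u - y) * of_real \<xi>) = exp (\<i> * of_real u * of_real \<xi>) * exp (- (\<i> * of_real y * of_real \<xi>))"
          by (simp add: algebra_simps flip: exp_add)
        then show ?thesis by (simp add: k_def mult.assoc)
      qed
      then show ?thesis
        unfolding J_def fourier_def by (simp add: mult.assoc)
    qed
    also have "\<dots> = (\<integral>y. \<integral>\<xi>. k \<xi> y \<partial>lborel \<partial>lborel)"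
    proof (rule integral_swap_of_product_bound)
      show "(\<lambda>x. k (fst x) (snd x)) \<in> borel_measurable borel"
        unfolding k_def borel_prod[symmetric] by measurable
      show "integrable lborel (\<lambda>\<xi>. N (e * \<xi>))"
        using lborel_integrable_real_affine[OF Ni, of e 0] e by simp
      show "integrable lborel (\<lambda>x. norm (f x))" using f by auto
    qed (use N0 in \<open>simp add: k_def norm_mult del: of_real_diff\<close>)
    also have "\<dots> = (\<integral>y. of_real (1 / e * (c * N ((u - y) / e))) * f y \<partial>lborel)"
    proof (rule Bochner_Integration.integral_cong[OF refl])
      fix y
      have "(\<integral>\<xi>. k \<xi> y \<partial>lborel) = (\<integral>\<xi>. of_real (N (e * \<xi>)) * exp (\<i> * of_real (u - y) * of_real \<xi>) \<partial>lborel) * f y"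
        unfolding k_def by (subst integral_mult_left_zero[symmetric]) (simp add: mult.assoc)
      also have "(\<integral>\<xi>. of_real (N (e * \<xi>)) * exp (\<i> * of_real (u - y) * of_real \<xi>) \<partial>lborel) =
         \<bar>1 / e\<bar> *\<^sub>R (\<integral>x. of_real (N (e * (0 + 1 / e * x))) * exp (\<i> * of_real (u - y) * of_real (0 + 1 / e * x)) \<partial>lborel)"
        using e by (intro lborel_integral_real_affine) simp
      also have "\<dots> = of_real (1 / e) * (\<integral>x. of_real (N x) * exp (\<i> * of_real ((u - y) / e) * of_real x) \<partial>lborel)"
        using e by (simp add: scaleR_conv_of_real)
      also have "\<dots> = of_real (1 / e * (c * N ((u - y) / e)))"
        unfolding N_def gaussian_char using c by (simp add: N[unfolded N_def])
      finally show "(\<integral>\<xi>. k \<xi> y \<partial>lborel) = of_real (1 / e * (c * N ((u - y) / e))) * f y" .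
    qed
    also have "\<dots> = \<bar>e\<bar> *\<^sub>R (\<integral>z. of_real (1 / e * (c * N ((u - (u + e * z)) / e))) * f (u + e * z) \<partial>lborel)"
      using e by (intro lborel_integral_real_affine) simp
    also have "\<dots> = (\<integral>z. of_real (c * N z) * f (u + e * z) \<partial>lborel)"
    proof -
      have "N (- z) = N z" for z by (simp add: N)
      then show ?thesis using e
        by (subst integral_scaleR_right[symmetric]) (auto simp: scaleR_conv_of_real intro!: Bochner_Integration.integral_cong)
    qed
    finally show ?thesis .
  qed
  have J3: "((\<lambda>e. \<integral>z. of_real (c * N z) * f (u + e * z) \<partial>lborel) \<longlongrightarrow> (\<integral>z. of_real (c * N z) * f u \<partial>lborel)) (at 0 within {0<..})"
  proof (rule tendsto_integral_at_within)
    show "integrable lborel (\<lambda>z. c * N z * K)" using Ni by simp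
    have "((\<lambda>t. f (u + t * z)) \<longlongrightarrow> f u) (at 0 within {0<..})" for z
    proof (rule isCont_tendsto_compose[OF cont])
      have "((\<lambda>t. u + t * z) \<longlongrightarrow> u + 0 * z) (at 0 within {0<..})"
        by (intro tendsto_intros)
      then show "((\<lambda>t. u + t * z) \<longlongrightarrow> u) (at 0 within {0<..})" by simp
    qed
    then show "AE z in lborel. ((\<lambda>e. of_real (c * N z) * f (u + e * z)) \<longlongrightarrow> of_real (c * N z) * f u) (at 0 within {0<..})"
      by (intro AE_I2 tendsto_mult tendsto_const)
    show "norm (of_real (c * N z) * f (u + e * z)) \<le> c * N z * K" for e z
    proof -
      have "norm (of_real (c * N z) * f (u + e * z)) = c * N z * norm (f (u + e * z))"
        using N0(1)[of z] c by (simp add: norm_mult)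
      then show ?thesis using N0(1)[of z] c K[of "u + e * z"] by (simp add: mult_left_mono)
    qed
  qed measurable
  have "(J \<longlongrightarrow> (\<integral>z. of_real (c * N z) * f u \<partial>lborel)) (at 0 within {0<..})"
    using J3 by (rule Lim_transform_within[where d = 1]) (auto simp: J2)
  then have "(\<integral>\<xi>. of_real (1 / c) * (exp (\<i> * of_real u * of_real \<xi>) * fourier f \<xi>) \<partial>lborel) = (\<integral>z. of_real (c * N z) * f u \<partial>lborel)"
    using J1 tendsto_unique trivial_limit_at_right_real by blast
  also have "\<dots> = of_real (\<integral>z. c * N z \<partial>lborel) * f u"
    by (simp only: integral_mult_left_zero integral_complex_of_real)
  also have "(\<integral>z. c * N z \<partial>lborel) = c"
    using c unfolding N_def by simp
  finally have "of_real (1 / c) * (\<integral>\<xi>. exp (\<i> * of_real u * of_real \<xi>) * fourier f \<xi> \<partial>lborel) = of_real c * f u"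
    by (simp only: integral_mult_right_zero)
  then have "of_real c * (of_real (1 / c) * (\<integral>\<xi>. exp (\<i> * of_real u * of_real \<xi>) * fourier f \<xi> \<partial>lborel)) = of_real c * (of_real c * f u)"
    by simp
  then have "(of_real (c * (1 / c)) :: complex) * (\<integral>\<xi>. exp (\<i> * of_real u * of_real \<xi>) * fourier f \<xi> \<partial>lborel) = of_real (c * c) * f u"
    by (simp only: of_real_mult mult.assoc)
  then show ?thesis using c by simp
qed

text \<open>Replacing \<open>g\<close> by its inversion integral brings the left side into the form
  treated by \<open>fourier_multiplication\<close>.\<close>

lemma fourier_parseval:
  assumes f: "integrable lborel f" and g: "integrable lborel g" and K: "\<And>x. norm (g x) \<le> K"
    and cont: "continuous_on UNIV g" and gh: "integrable lborel (fourier g)"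
  shows "(\<integral>u. f u * cnj (g u) \<partial>lborel)
    = 1 / (2 * of_real pi) * (\<integral>\<xi>. fourier f \<xi> * cnj (fourier g \<xi>) \<partial>lborel)"
proof -
  have "isCont g u" for u
    using cont continuous_on_eq_continuous_at open_UNIV by blast
  then have inv: "(\<integral>\<xi>. exp (\<i> * of_real u * of_real \<xi>) * fourier g \<xi> \<partial>lborel) = 2 * of_real pi * g u" for u
    using fourier_inversion[OF g K _ gh] by blast
  have "(\<integral>\<xi>. fourier f \<xi> * cnj (fourier g \<xi>) \<partial>lborel) = (\<integral>u. f u * cnj (2 * of_real pi * g u) \<partial>lborel)"
    unfolding inv[symmetric] by (rule fourier_multiplication[OF f gh, symmetric])
  also have "\<dots> = (\<integral>u. 2 * of_real pi * (f u * cnj (g u)) \<partial>lborel)"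
    by (rule Bochner_Integration.integral_cong) auto
  finally show ?thesis by simp
qed

lemma fourier_translate: "fourier (\<lambda>u. f (u + t)) \<xi> = exp (\<i> * of_real t * of_real \<xi>) * fourier f \<xi>"
proof -
  have "fourier f \<xi> = (\<integral>u. exp (- (\<i> * of_real (u + t) * of_real \<xi>)) * f (u + t) \<partial>lborel)"
    unfolding fourier_def by (rule integral_translate[symmetric])
  also have "\<dots> = exp (- (\<i> * of_real t * of_real \<xi>)) * fourier (\<lambda>u. f (u + t)) \<xi>"
  proof -
    have "exp (- (\<i> * of_real (u + t) * of_real \<xi>)) * f (u + t) =
        exp (- (\<i> * of_real t * of_real \<xi>)) * (exp (- (\<i> * of_real u * of_real \<xi>)) * f (u + t))" for u
    proof -
      have "exp (- (\<i> * of_real (u + t) * of_real \<xi>)) =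
          exp (- (\<i> * of_real t * of_real \<xi>)) * exp (- (\<i> * of_real u * of_real \<xi>))"
        by (simp add: algebra_simps flip: exp_add)
      then show ?thesis by (simp add: mult.assoc)
    qed
    then show ?thesis unfolding fourier_def by (simp only: integral_mult_right_zero)
  qed
  finally have *: "fourier f \<xi> = exp (- (\<i> * of_real t * of_real \<xi>)) * fourier (\<lambda>u. f (u + t)) \<xi>" .
  show ?thesis unfolding * mult.assoc[symmetric] mult_exp_exp by simp
qed

text \<open>The product of \<open>f\<close> with the exponential vanishes at both infinities, so its
  derivative integrates to 0; the product rule then gives the formula.\<close>

lemma fourier_derivative:
  assumes f: "integrable lborel f" and f': "integrable lborel f'"
    and d: "\<And>u. (f has_vector_derivative f' u) (at u)" and c: "continuous_on UNIV f'"
    and lim: "(f \<longlongrightarrow> 0) at_top" "(f \<longlongrightarrow> 0) at_bot"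
  shows "fourier f' \<xi> = \<i> * of_real \<xi> * fourier f \<xi>"
proof -
  define e where "e = (\<lambda>u. exp (- (\<i> * of_real u * of_real \<xi>)))"
  have e: "(e has_vector_derivative (- (\<i> * of_real \<xi>) * e u)) (at u)" for u
    unfolding e_def
    by (rule has_vector_derivative_real_field[where f = "\<lambda>z. exp (- (\<i> * z * of_real \<xi>))"])
      (auto intro!: derivative_eq_intros)
  have n: "norm (e u) = 1" for u by (simp add: e_def)
  have [measurable]: "e \<in> borel_measurable borel" "f \<in> borel_measurable borel" "f' \<in> borel_measurable borel"
    using f f' unfolding e_def by auto
  have i1: "integrable lborel (\<lambda>u. e u * f u)"
    using integrable_norm[OF f] by (rule integrable_le) (simp_all add: norm_mult n)
  have i2: "integrable lborel (\<lambda>u. e u * f' u)"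
    using integrable_norm[OF f'] by (rule integrable_le) (simp_all add: norm_mult n)
  have cf: "continuous_on UNIV f"
    using d by (meson continuous_at_imp_continuous_on has_vector_derivative_continuous)
  have "(\<integral>u. e u * f' u + - (\<i> * of_real \<xi>) * e u * f u \<partial>lborel) = 0"
  proof (rule integral_whole_line_derivative)
    show "((\<lambda>u. e u * f u) has_vector_derivative e u * f' u + - (\<i> * of_real \<xi>) * e u * f u) (at u)" for u
      by (rule has_vector_derivative_mult[OF e d])
    show "continuous_on UNIV (\<lambda>u. e u * f' u + - (\<i> * of_real \<xi>) * e u * f u)"
      unfolding e_def by (intro continuous_intros c cf)
    show "integrable lborel (\<lambda>u. e u * f' u + - (\<i> * of_real \<xi>) * e u * f u)"
      using i1 i2 by (simp add: mult.assoc)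
    show "((\<lambda>u. e u * f u) \<longlongrightarrow> 0) at_top" "((\<lambda>u. e u * f u) \<longlongrightarrow> 0) at_bot"
      by (rule tendsto_norm_zero_cancel, unfold norm_mult n mult_1, rule tendsto_norm_zero, rule lim)+
  qed
  then have "(\<integral>u. e u * f' u \<partial>lborel) = \<i> * of_real \<xi> * (\<integral>u. e u * f u \<partial>lborel)"
    using i1 i2 by (simp add: mult.assoc)
  then show ?thesis by (simp add: fourier_def e_def)
qed

section \<open>Difference quotients, differentiation under the integral sign, chain rule along
  lines\<close>

lemma has_vector_derivative_iff_quotient:
  "(f has_vector_derivative D) (at x within S) \<longleftrightarrow>
    ((\<lambda>y. (1 / (y - x)) *\<^sub>R (f y - f x)) \<longlongrightarrow> D) (at x within S)"
proof -
  have "norm ((f y - f x) - (y - x) *\<^sub>R D) / norm (y - x) = norm ((1 / (y - x)) *\<^sub>R (f y - f x) - D)"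
    if "y \<noteq> x" for y
  proof -
    have "(1 / (y - x)) *\<^sub>R (f y - f x) - D = (1 / (y - x)) *\<^sub>R ((f y - f x) - (y - x) *\<^sub>R D)"
      using that by (simp add: scaleR_right_diff_distrib)
    then show ?thesis by simp
  qed
  then have "((\<lambda>y. norm ((f y - f x) - (y - x) *\<^sub>R D) / norm (y - x)) \<longlongrightarrow> 0) (at x within S) \<longleftrightarrow>
      ((\<lambda>y. norm ((1 / (y - x)) *\<^sub>R (f y - f x) - D)) \<longlongrightarrow> 0) (at x within S)"
    by (intro filterlim_cong refl) (auto simp: eventually_at_filter)
  then show ?thesis
    unfolding has_vector_derivative_def has_derivative_iff_norm tendsto_norm_zero_iff
    by (simp add: bounded_linear_scaleR_left LIM_zero_iff)
qed

text \<open>The mean value inequality. It dominates the difference quotients in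
  \<open>has_vector_derivative_integral\<close> and yields the Lipschitz bound
  \<open>c_lipschitz\<close> up to the boundary.\<close>

lemma has_vector_derivative_bound:
  assumes S: "convex S" and d: "\<And>x. x \<in> S \<Longrightarrow> (f has_vector_derivative f' x) (at x within S)"
    and le: "\<And>x. x \<in> S \<Longrightarrow> norm (f' x) \<le> B" and xy: "x \<in> S" "y \<in> S"
  shows "norm (f x - f y) \<le> B * \<bar>x - y\<bar>"
proof -
  have "norm (f x - f y) \<le> B * norm (x - y)"
  proof (rule differentiable_bound[OF S _ _ xy])
    show "(f has_derivative (\<lambda>h. h *\<^sub>R f' x)) (at x within S)" if "x \<in> S" for x
      using d[OF that] by (simp add: has_vector_derivative_def)
    show "onorm (\<lambda>h. h *\<^sub>R f' x) \<le> B" if "x \<in> S" for x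
    proof (rule onorm_bound)
      show "0 \<le> B" using le[OF that] norm_ge_zero order_trans by blast
      show "norm (h *\<^sub>R f' x) \<le> B * norm h" for h
        using mult_left_mono[OF le[OF that], of "\<bar>h\<bar>"] by (simp add: mult.commute)
    qed
  qed
  then show ?thesis by simp
qed

text \<open>Dominated convergence of the difference quotients; by the mean value inequality
  \<open>w\<close> is a majorant for them.\<close>

lemma has_vector_derivative_integral:
  fixes f :: "real \<Rightarrow> 'a \<Rightarrow> 'b::{banach, second_countable_topology}" and w :: "'a \<Rightarrow> real"
  assumes w: "integrable M w" and f: "\<And>t. integrable M (f t)"
    and f': "\<And>t. f' t \<in> borel_measurable M"
    and d: "\<And>x t. ((\<lambda>t. f t x) has_vector_derivative f' t x) (at t)"
    and le: "\<And>x t. norm (f' t x) \<le> w x"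
  shows "((\<lambda>t. \<integral>x. f t x \<partial>M) has_vector_derivative (\<integral>x. f' t x \<partial>M)) (at t)"
  unfolding has_vector_derivative_iff_quotient
proof -
  have "(\<integral>x. (1 / (y - t)) *\<^sub>R (f y x - f t x) \<partial>M) = (1 / (y - t)) *\<^sub>R ((\<integral>x. f y x \<partial>M) - (\<integral>x. f t x \<partial>M))" for y
    using f by simp
  moreover have "((\<lambda>y. \<integral>x. (1 / (y - t)) *\<^sub>R (f y x - f t x) \<partial>M) \<longlongrightarrow> (\<integral>x. f' t x \<partial>M)) (at t)"
  proof (rule tendsto_integral_at_within[OF w])
    show "(\<lambda>x. (1 / (y - t)) *\<^sub>R (f y x - f t x)) \<in> borel_measurable M" for y
      using f by (intro borel_measurable_scaleR borel_measurable_diff) auto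
    show "AE x in M. ((\<lambda>y. (1 / (y - t)) *\<^sub>R (f y x - f t x)) \<longlongrightarrow> f' t x) (at t)"
      using d by (simp add: has_vector_derivative_iff_quotient)
    show "norm ((1 / (y - t)) *\<^sub>R (f y x - f t x)) \<le> w x" if "y \<noteq> t" for y x
    proof -
      have "norm (f y x - f t x) \<le> w x * \<bar>y - t\<bar>"
        by (rule has_vector_derivative_bound[of UNIV _ "\<lambda>t. f' t x"]) (use d le in auto)
      then show ?thesis using that by (simp add: pos_divide_le_eq del: scaleR_right_diff_distrib)
    qed
  qed (rule f')
  ultimately show "((\<lambda>y. (1 / (y - t)) *\<^sub>R ((\<integral>x. f y x \<partial>M) - (\<integral>x. f t x \<partial>M))) \<longlongrightarrow> (\<integral>x. f' t x \<partial>M)) (at t)"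
    by (simp only:)
qed

text \<open>Total differentiability relative to the closed half-plane follows from the two partial
  derivatives and the continuity of \<open>fy\<close>; it is then composed with
  \<open>y \<mapsto> (v + b * y, y)\<close>. At \<open>y = a\<close> all derivatives in
  \<open>y\<close> are one-sided.\<close>

lemma has_vector_derivative_along_line:
  fixes f fx fy :: "real \<Rightarrow> real \<Rightarrow> 'a::real_normed_vector"
  assumes dx: "\<And>x y. a \<le> y \<Longrightarrow> ((\<lambda>x. f x y) has_vector_derivative fx x y) (at x)"
    and dy: "\<And>x y. a \<le> y \<Longrightarrow> ((\<lambda>y. f x y) has_vector_derivative fy x y) (at y within {a..})"
    and c: "continuous_on (UNIV \<times> {a..}) (\<lambda>(x, y). fy x y)" and y: "a \<le> y"
  shows "((\<lambda>y. f (v + b * y) y) has_vector_derivative b *\<^sub>R fx (v + b * y) y + fy (v + b * y) y) (at y within {a..})"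
proof -
  let ?x = "v + b * y"
  have "((\<lambda>(x, y). f x y) has_derivative (\<lambda>(tx, ty). tx *\<^sub>R fx ?x y + blinfun_apply (blinfun_scaleR_left (fy ?x y)) ty))
      (at (?x, y) within UNIV \<times> {a..})"
  proof (rule has_derivative_partialsI)
    show "((\<lambda>x. f x y) has_derivative (\<lambda>tx. tx *\<^sub>R fx ?x y)) (at ?x within UNIV)"
      using dx[OF y] by (simp add: has_vector_derivative_def)
    show "((\<lambda>y. f x y) has_derivative blinfun_apply (blinfun_scaleR_left (fy x y))) (at y within {a..})" if "y \<in> {a..}" for x y
      using dy[of y x] that by (simp add: has_vector_derivative_def)
    have "((\<lambda>(x, y). fy x y) \<longlongrightarrow> fy ?x y) (at (?x, y) within UNIV \<times> {a..})"
      using c y by (auto simp: continuous_on_def)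
    then have "((\<lambda>z. blinfun_scaleR_left (case z of (x, y) \<Rightarrow> fy x y)) \<longlongrightarrow> blinfun_scaleR_left (fy ?x y)) (at (?x, y) within UNIV \<times> {a..})"
      by (rule bounded_linear.tendsto[OF bounded_linear_blinfun_scaleR_left])
    then show "continuous (at (?x, y) within UNIV \<times> {a..}) (\<lambda>(x, y). blinfun_scaleR_left (fy x y))"
      by (simp add: case_prod_beta' continuous_within)
  qed (use y in auto)
  then have *: "((\<lambda>z. f (fst z) (snd z)) has_derivative (\<lambda>h. fst h *\<^sub>R fx ?x y + snd h *\<^sub>R fy ?x y))
      (at (?x, y) within UNIV \<times> {a..})"
    by (simp add: case_prod_beta')
  have "((\<lambda>y. f (fst (v + b * y, y)) (snd (v + b * y, y))) has_derivative
      (\<lambda>h. fst (b * h, h) *\<^sub>R fx ?x y + snd (b * h, h) *\<^sub>R fy ?x y)) (at y within {a..})"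
  proof (rule has_derivative_in_compose[where g = "\<lambda>z. f (fst z) (snd z)" and f = "\<lambda>y. (v + b * y, y)"])
    show "((\<lambda>y. (v + b * y, y)) has_derivative (\<lambda>h. (b * h, h))) (at y within {a..})"
      by (auto intro!: derivative_eq_intros)
    show "((\<lambda>z. f (fst z) (snd z)) has_derivative (\<lambda>h. fst h *\<^sub>R fx ?x y + snd h *\<^sub>R fy ?x y))
        (at (?x, y) within (\<lambda>y. (v + b * y, y)) ` {a..})"
      by (rule has_derivative_subset[OF *]) auto
  qed
  then show ?thesis
    by (simp add: has_vector_derivative_def scaleR_add_right mult.commute)
qed

section \<open>Rapidly decreasing functions on the half-plane\<close>

text \<open>The form in which regularity and decay are used. The square on \<open>wt r\<close>
  leaves one integrable factor after the loss in \<open>wt_shear\<close>.\<close>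

locale half_plane_decay =
  fixes rp :: real and D :: "nat \<Rightarrow> nat \<Rightarrow> real \<Rightarrow> real \<Rightarrow> complex"
  assumes cont: "continuous_on (UNIV \<times> {rp..}) (\<lambda>(u, r). D j k u r)"
    and du: "rp \<le> r \<Longrightarrow> ((\<lambda>v. D j k v r) has_vector_derivative D (Suc j) k u r) (at u)"
    and dr: "rp \<le> r \<Longrightarrow> ((\<lambda>s. D j k u s) has_vector_derivative D j (Suc k) u r) (at r within {rp..})"
    and decay: "\<exists>C. \<forall>u. \<forall>r\<ge>rp. norm (D j k u r) \<le> C * (wt u * (wt r)\<^sup>2)"
begin

text \<open>
  \<open>c j k\<close> extends \<open>D j k\<close> by \<open>0\<close> to \<open>r < rp\<close>; it jumps at \<open>r = rp\<close> but stays smooth in \<open>u\<close>.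
\<close>

definition c :: "nat \<Rightarrow> nat \<Rightarrow> real \<Rightarrow> real \<Rightarrow> complex" where
  "c j k u r = indicator {rp..} r *\<^sub>R D j k u r"

text \<open>A chosen nonnegative decay constant for each derivative, so that all later majorants can
  be written explicitly.\<close>

definition K :: "nat \<Rightarrow> nat \<Rightarrow> real" where
  "K j k = (SOME C. 0 \<le> C \<and> (\<forall>u r. norm (c j k u r) \<le> C * (wt u * (wt r)\<^sup>2)))"

lemma c_eq: "rp \<le> r \<Longrightarrow> c j k u r = D j k u r"
  and c_eq_0: "r < rp \<Longrightarrow> c j k u r = 0"
  by (simp_all add: c_def)

lemma K_nonneg: "0 \<le> K j k" and norm_c_le: "norm (c j k u r) \<le> K j k * (wt u * (wt r)\<^sup>2)"
proof -
  obtain C where C: "\<And>u r. rp \<le> r \<Longrightarrow> norm (D j k u r) \<le> C * (wt u * (wt r)\<^sup>2)"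
    using decay[of j k] by blast
  have "norm (c j k u r) \<le> max 0 C * (wt u * (wt r)\<^sup>2)" for u r
  proof (cases "rp \<le> r")
    case True
    have "C * (wt u * (wt r)\<^sup>2) \<le> max 0 C * (wt u * (wt r)\<^sup>2)"
      by (intro mult_right_mono) auto
    then show ?thesis unfolding c_eq[OF True] using C[OF True, of u] by linarith
  qed (simp add: c_eq_0)
  then have "\<exists>C. 0 \<le> C \<and> (\<forall>u r. norm (c j k u r) \<le> C * (wt u * (wt r)\<^sup>2))"
    by (intro exI[of _ "max 0 C"]) simp
  from someI_ex[OF this]
  show "0 \<le> K j k" "norm (c j k u r) \<le> K j k * (wt u * (wt r)\<^sup>2)"
    by (auto simp: K_def)
qed

lemma norm_c_le': "norm (c j k u r) \<le> K j k * (wt u * wt r)"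
  and norm_c_le_r: "norm (c j k u r) \<le> K j k * wt r"
  and norm_c_le_u: "norm (c j k u r) \<le> K j k * wt u"
proof -
  have "wt u * (wt r)\<^sup>2 \<le> wt u * wt r" "wt u * wt r \<le> wt r" "wt u * wt r \<le> wt u"
    by (auto simp: power2_eq_square mult_left_le mult_left_le_one_le intro!: mult_left_mono)
  then show "norm (c j k u r) \<le> K j k * (wt u * wt r)" "norm (c j k u r) \<le> K j k * wt r"
    "norm (c j k u r) \<le> K j k * wt u"
    using norm_c_le[of j k u r] K_nonneg[of j k] by (meson mult_left_mono order_trans)+
qed

lemma c_measurable_pair: "(\<lambda>x. c j k (fst x) (snd x)) \<in> borel_measurable borel"
proof -
  have "(\<lambda>x. indicator (UNIV \<times> {rp..}) x *\<^sub>R (case x of (u, r) \<Rightarrow> D j k u r)) \<in> borel_measurable borel"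
    using cont by (intro borel_measurable_continuous_on_indicator) (auto intro!: borel_closed closed_Times)
  then show ?thesis
    by (simp add: c_def indicator_def case_prod_beta' mem_Times_iff)
qed

lemma c_measurable [measurable (raw)]:
  assumes "f \<in> borel_measurable M" "g \<in> borel_measurable M"
  shows "(\<lambda>x. c j k (f x) (g x)) \<in> borel_measurable M"
proof -
  have "(\<lambda>x. (f x, g x)) \<in> borel_measurable M"
    using assms by (rule borel_measurable_Pair)
  from measurable_compose[OF this c_measurable_pair] show ?thesis by simp
qed

lemma c_has_vector_derivative: "((\<lambda>v. c j k v r) has_vector_derivative c (Suc j) k u r) (at u)"
proof (cases "rp \<le> r")
  case True
  then show ?thesis using du[OF True] by (simp add: c_eq)
qed (simp add: c_def)

lemma c_continuous_u: "continuous_on UNIV (\<lambda>u. c j k u r)"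
  using c_has_vector_derivative
  by (meson continuous_at_imp_continuous_on has_vector_derivative_continuous)

lemma c_integrable_u: "integrable lborel (\<lambda>u. c j k u r)"
  by (rule integrable_le[where g = "\<lambda>u. K j k * wt u"]) (use norm_c_le_u in auto)

lemma c_integrable_shear: "integrable lborel (\<lambda>r. c j k (v + X * r) r)"
  by (rule integrable_le[where g = "\<lambda>r. K j k * wt r"]) (use norm_c_le_r in auto)

lemma c_tendsto_0: "((\<lambda>u. c j k u r) \<longlongrightarrow> 0) at_top" "((\<lambda>u. c j k u r) \<longlongrightarrow> 0) at_bot"
proof -
  have "((\<lambda>u. K j k * wt u) \<longlongrightarrow> 0) at_top" "((\<lambda>u. K j k * wt u) \<longlongrightarrow> 0) at_bot"
    using wt_tendsto_0[THEN tendsto_mult_right_zero] by auto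
  then show "((\<lambda>u. c j k u r) \<longlongrightarrow> 0) at_top" "((\<lambda>u. c j k u r) \<longlongrightarrow> 0) at_bot"
    using norm_c_le_u by (auto intro!: Lim_null_comparison[of "\<lambda>u. c j k u r" "\<lambda>u. K j k * wt u"])
qed

lemma integral_norm_c_u_le: "(\<integral>u. norm (c j k u r) \<partial>lborel) \<le> K j k * integral\<^sup>L lborel wt * (wt r)\<^sup>2"
proof -
  have "(\<integral>u. norm (c j k u r) \<partial>lborel) \<le> (\<integral>u. K j k * (wt u * (wt r)\<^sup>2) \<partial>lborel)"
    using c_integrable_u norm_c_le by (intro integral_mono) auto
  then show ?thesis by (simp add: ac_simps)
qed

section \<open>Integrals along the lines of slope \<open>X\<close>\<close>

definition G :: "nat \<Rightarrow> nat \<Rightarrow> real \<Rightarrow> real \<Rightarrow> complex" where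
  "G j k v X = (\<integral>r. c j k (v + X * r) r \<partial>lborel)"

lemma G_measurable [measurable (raw)]:
  assumes [measurable]: "f \<in> borel_measurable M" "g \<in> borel_measurable M"
  shows "(\<lambda>x. G j k (f x) (g x)) \<in> borel_measurable M"
  unfolding G_def by measurable

lemma norm_G_le: "norm (G j k v X) \<le> K j k * integral\<^sup>L lborel wt"
proof -
  have "norm (G j k v X) \<le> (\<integral>r. K j k * wt r \<partial>lborel)"
    unfolding G_def using norm_c_le_r by (intro norm_integral_le) auto
  then show ?thesis by simp
qed

text \<open>The weight in the first argument is now the one that is integrated: the substitution
  \<open>v + X * r\<close> has Jacobian \<open>\<bar>X\<bar>\<close>, whence decay of order
  1/\<open>\<bar>X\<bar>\<close> in the supremum norm.\<close>

lemma abs_norm_G_le: "\<bar>X\<bar> * norm (G j k v X) \<le> K j k * integral\<^sup>L lborel wt"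
proof (cases "X = 0")
  case False
  have i: "integrable lborel (\<lambda>r. wt (v + X * r))"
    using lborel_integrable_real_affine[OF wt_integrable False] by simp
  have "norm (G j k v X) \<le> (\<integral>r. K j k * wt (v + X * r) \<partial>lborel)"
    unfolding G_def using norm_c_le_u i by (intro norm_integral_le) auto
  then have "\<bar>X\<bar> * norm (G j k v X) \<le> \<bar>X\<bar> * (K j k * (\<integral>r. wt (v + X * r) \<partial>lborel))"
    by (intro mult_left_mono) auto
  also have "\<dots> = K j k * integral\<^sup>L lborel wt"
    using lborel_integral_real_affine[OF False, of wt v] by simp
  finally show ?thesis .
qed (use K_nonneg in \<open>simp add: integral_nonneg_AE\<close>)

lemma c_pair_integrable: "integrable (lborel \<Otimes>\<^sub>M lborel) (\<lambda>(r, v). c j k (v + X * r) r)"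
proof (rule integrable_pair_of_integral_bound)
  show "(\<lambda>x. c j k (snd x + X * fst x) (fst x)) \<in> borel_measurable borel"
    unfolding borel_prod[symmetric] by measurable
  show "integrable lborel (\<lambda>r. K j k * integral\<^sup>L lborel wt * wt r)" by simp
  show "integrable lborel (\<lambda>v. c j k (v + X * r) r)" for r
    using integrable_translate(1)[OF c_integrable_u] .
  show "(\<integral>v. norm (c j k (v + X * r) r) \<partial>lborel) \<le> K j k * integral\<^sup>L lborel wt * wt r" for r
  proof -
    have "(\<integral>v. norm (c j k (v + X * r) r) \<partial>lborel) = (\<integral>u. norm (c j k u r) \<partial>lborel)"
      using integral_translate(1)[of "\<lambda>u. norm (c j k u r)"] .
    also have "\<dots> \<le> K j k * integral\<^sup>L lborel wt * (wt r)\<^sup>2" by (rule integral_norm_c_u_le)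
    also have "\<dots> \<le> K j k * integral\<^sup>L lborel wt * wt r"
      using K_nonneg by (intro mult_left_mono) (auto simp: power2_eq_square mult_left_le integral_nonneg_AE)
    finally show ?thesis .
  qed
qed

lemma G_integrable: "integrable lborel (\<lambda>v. G j k v X)"
  using lborel_pair.integrable_snd[OF c_pair_integrable] by (simp add: G_def)

text \<open>After an exchange of integrals, a translation in \<open>v\<close> removes the shear for
  each \<open>r\<close>, so the bound is uniform in \<open>X\<close>.\<close>

lemma integral_norm_G_le: "(\<integral>v. norm (G j k v X) \<partial>lborel) \<le> K j k * (integral\<^sup>L lborel wt)\<^sup>2"
proof -
  have p: "integrable (lborel \<Otimes>\<^sub>M lborel) (\<lambda>(r, v). norm (c j k (v + X * r) r))"
    using integrable_norm[OF c_pair_integrable] by (simp add: case_prod_beta')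
  have "(\<integral>v. norm (G j k v X) \<partial>lborel) \<le> (\<integral>v. \<integral>r. norm (c j k (v + X * r) r) \<partial>lborel \<partial>lborel)"
    using G_integrable lborel_pair.integrable_snd[OF p] unfolding G_def
    by (intro integral_mono integral_norm_bound) auto
  also have "\<dots> = (\<integral>r. \<integral>v. norm (c j k (v + X * r) r) \<partial>lborel \<partial>lborel)"
    by (rule integral_pair_swap[OF p, symmetric])
  also have "\<dots> = (\<integral>r. \<integral>u. norm (c j k u r) \<partial>lborel \<partial>lborel)"
    using integral_translate(1)[of "\<lambda>u. norm (c j k u r)" for r] by simp
  also have "\<dots> \<le> (\<integral>r. K j k * integral\<^sup>L lborel wt * wt r \<partial>lborel)"
  proof (rule integral_mono)
    show "integrable lborel (\<lambda>r. \<integral>u. norm (c j k u r) \<partial>lborel)"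
      using lborel_pair.integrable_fst[OF p] integral_translate(1)[of "\<lambda>u. norm (c j k u r)" for r] by simp
    fix r :: real
    have "K j k * integral\<^sup>L lborel wt * (wt r)\<^sup>2 \<le> K j k * integral\<^sup>L lborel wt * wt r"
      using K_nonneg by (intro mult_left_mono) (auto simp: power2_eq_square mult_left_le integral_nonneg_AE)
    then show "(\<integral>u. norm (c j k u r) \<partial>lborel) \<le> K j k * integral\<^sup>L lborel wt * wt r"
      using integral_norm_c_u_le[of j k r] by linarith
  qed simp
  finally show ?thesis by (simp add: power2_eq_square)
qed

lemma G_has_vector_derivative: "((\<lambda>v. G j k v X) has_vector_derivative G (Suc j) k v X) (at v)"
  unfolding G_def
proof (rule has_vector_derivative_integral)
  show "integrable lborel (\<lambda>r. K (Suc j) k * wt r)" by simp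
  show "((\<lambda>v. c j k (v + X * r) r) has_vector_derivative c (Suc j) k (v + X * r) r) (at v)" for v r
  proof -
    have "((\<lambda>v. v + X * r) has_vector_derivative 1) (at v)"
      by (auto intro!: derivative_eq_intros)
    from vector_diff_chain_at[OF this c_has_vector_derivative] show ?thesis by (simp add: o_def)
  qed
qed (use c_integrable_shear norm_c_le_r in auto)

lemma G_continuous: "continuous_on UNIV (\<lambda>v. G j k v X)"
  using G_has_vector_derivative
  by (meson continuous_at_imp_continuous_on has_vector_derivative_continuous)

text \<open>The derivative of \<open>D j k (v + X * r) r\<close> in \<open>r\<close> is
  \<open>X\<close> times the \<open>u\<close>-derivative plus the \<open>r\<close>-derivative. Its
  integral over the half-line is minus the value at \<open>rp\<close>, which produces the boundary
  term.\<close>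

lemma G_integration_by_parts: "of_real X * G (Suc j) k v X = - c j k (v + X * rp) rp - G j (Suc k) v X"
proof -
  let ?f = "\<lambda>r. X *\<^sub>R D (Suc j) k (v + X * r) r + D j (Suc k) (v + X * r) r"
  have cD: "continuous_on {rp..} (\<lambda>r. D j k (v + X * r) r)" for j k
  proof -
    have "continuous_on {rp..} (\<lambda>r. (v + X * r, r))" by (intro continuous_intros)
    from continuous_on_compose2[OF cont this, of j k] show ?thesis by auto
  qed
  have D: "indicator {rp..} r *\<^sub>R D j k (v + X * r) r = c j k (v + X * r) r" for j k r
    by (simp add: c_def)
  have ind: "indicator {rp..} r *\<^sub>R ?f r = X *\<^sub>R c (Suc j) k (v + X * r) r + c j (Suc k) (v + X * r) r" for r
    by (simp add: c_def indicator_def)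
  have "(LBINT r:{rp..}. ?f r) = - D j k (v + X * rp) rp"
  proof (rule integral_half_line_derivative)
    show "((\<lambda>r. D j k (v + X * r) r) has_vector_derivative ?f r) (at r within {rp..})" if "rp \<le> r" for r
      using that by (intro has_vector_derivative_along_line du dr cont)
    show "continuous_on {rp..} ?f" by (intro continuous_intros cD)
    show "set_integrable lborel {rp..} ?f"
      unfolding set_integrable_def ind
      by (intro Bochner_Integration.integrable_add integrable_scaleR_right c_integrable_shear)
    have "((\<lambda>r. c j k (v + X * r) r) \<longlongrightarrow> 0) at_top"
    proof (rule Lim_null_comparison)
      show "((\<lambda>r. K j k * wt r) \<longlongrightarrow> 0) at_top"
        using wt_tendsto_0(1)[THEN tendsto_mult_right_zero] by auto
    qed (use norm_c_le_r in auto)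
    then show "((\<lambda>r. D j k (v + X * r) r) \<longlongrightarrow> 0) at_top"
      by (rule Lim_transform_eventually)
        (use eventually_ge_at_top[of rp] in eventually_elim, simp add: c_eq)
  qed
  moreover have "(LBINT r:{rp..}. ?f r) = of_real X * G (Suc j) k v X + G j (Suc k) v X"
    unfolding set_lebesgue_integral_def ind G_def
    by (subst Bochner_Integration.integral_add)
      (auto intro!: c_integrable_shear simp: scaleR_conv_of_real)
  ultimately show ?thesis by (simp add: c_eq eq_neg_iff_add_eq_0 add.commute algebra_simps)
qed

text \<open>The first summand bounds the boundary term of \<open>G_integration_by_parts\<close> in
  the \<open>L\<close>^1 norm in \<open>v\<close>, the second the term with one more
  \<open>r\<close>-derivative.\<close>

definition L :: "nat \<Rightarrow> nat \<Rightarrow> real" where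
  "L j k = K j k * integral\<^sup>L lborel wt + K j (Suc k) * (integral\<^sup>L lborel wt)\<^sup>2"

lemma L_nonneg: "0 \<le> L j k"
  unfolding L_def using K_nonneg by (auto intro!: add_nonneg_nonneg mult_nonneg_nonneg integral_nonneg_AE)

text \<open>In \<open>G_integration_by_parts\<close> the boundary term is a translate in
  \<open>v\<close> of a fixed integrable function, and the remaining term is bounded uniformly in
  \<open>X\<close> by \<open>integral_norm_G_le\<close>. A \<open>u\<close>-derivative thus gains
  decay of order 1/\<open>\<bar>X\<bar>\<close> in \<open>L\<close>^1.\<close>

lemma abs_integral_norm_G_le: "\<bar>X\<bar> * (\<integral>v. norm (G (Suc j) k v X) \<partial>lborel) \<le> L j k"
proof -
  have ic: "integrable lborel (\<lambda>v. c j k (v + X * rp) rp)"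
    using integrable_translate(1)[OF c_integrable_u] .
  have "\<bar>X\<bar> * (\<integral>v. norm (G (Suc j) k v X) \<partial>lborel) = (\<integral>v. norm (of_real X * G (Suc j) k v X) \<partial>lborel)"
    by (simp add: norm_mult)
  also have "\<dots> \<le> (\<integral>v. norm (c j k (v + X * rp) rp) + norm (G j (Suc k) v X) \<partial>lborel)"
  proof (rule integral_mono)
    show "integrable lborel (\<lambda>v. norm (of_real X * G (Suc j) k v X))"
      using G_integrable by auto
    show "integrable lborel (\<lambda>v. norm (c j k (v + X * rp) rp) + norm (G j (Suc k) v X))"
      using G_integrable ic by auto
    show "norm (of_real X * G (Suc j) k v X) \<le> norm (c j k (v + X * rp) rp) + norm (G j (Suc k) v X)" for v
      unfolding G_integration_by_parts using norm_triangle_ineq4[of "- c j k (v + X * rp) rp"] by simp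
  qed
  also have "\<dots> = (\<integral>v. norm (c j k (v + X * rp) rp) \<partial>lborel) + (\<integral>v. norm (G j (Suc k) v X) \<partial>lborel)"
    using G_integrable ic by simp
  also have "(\<integral>v. norm (c j k (v + X * rp) rp) \<partial>lborel) = (\<integral>u. norm (c j k u rp) \<partial>lborel)"
    using integral_translate(1)[of "\<lambda>u. norm (c j k u rp)"] .
  also have "\<dots> \<le> K j k * integral\<^sup>L lborel wt * (wt rp)\<^sup>2" by (rule integral_norm_c_u_le)
  also have "\<dots> \<le> K j k * integral\<^sup>L lborel wt * 1"
    using K_nonneg by (intro mult_left_mono) (auto simp: power_le_one integral_nonneg_AE)
  finally show ?thesis
    using integral_norm_G_le[of j "Suc k" X] by (simp add: L_def)
qed

section \<open>Fourier transforms in \<open>u\<close> and in both variables\<close>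

definition ch :: "nat \<Rightarrow> nat \<Rightarrow> real \<Rightarrow> real \<Rightarrow> complex" where
  "ch j k \<xi> r = fourier (\<lambda>u. c j k u r) \<xi>"

lemma ch_measurable [measurable (raw)]:
  assumes [measurable]: "f \<in> borel_measurable M" "g \<in> borel_measurable M"
  shows "(\<lambda>x. ch j k (f x) (g x)) \<in> borel_measurable M"
  unfolding ch_def fourier_def by measurable

lemma norm_ch_le: "norm (ch j k \<xi> r) \<le> K j k * integral\<^sup>L lborel wt * (wt r)\<^sup>2"
proof -
  have "norm (ch j k \<xi> r) \<le> (\<integral>u. norm (c j k u r) \<partial>lborel)"
    unfolding ch_def using c_integrable_u by (intro norm_fourier_le) auto
  then show ?thesis using integral_norm_c_u_le[of j k r] by linarith
qed

lemma ch_Suc: "ch (Suc j) k \<xi> r = \<i> * of_real \<xi> * ch j k \<xi> r"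
  unfolding ch_def
  by (intro fourier_derivative c_integrable_u c_has_vector_derivative c_continuous_u c_tendsto_0)

text \<open>
  Two derivatives in \<open>u\<close> are traded for the weight \<open>wt \<xi>\<close>.
\<close>

lemma ch_second: "of_real (1 + \<xi>\<^sup>2) * ch j k \<xi> r = ch j k \<xi> r - ch (Suc (Suc j)) k \<xi> r"
  by (simp add: ch_Suc algebra_simps power2_eq_square)

text \<open>The constants of orders 0 and 2 in \<open>u\<close>, which are the two terms of
  \<open>ch_second\<close>.\<close>

definition A :: real where
  "A = (K 0 0 + K 2 0) * integral\<^sup>L lborel wt"

lemma A_nonneg: "0 \<le> A"
  unfolding A_def using K_nonneg by (auto intro!: add_nonneg_nonneg mult_nonneg_nonneg integral_nonneg_AE)

lemma norm_ch_le_wt: "norm (ch 0 0 \<xi> r) \<le> A * wt \<xi> * (wt r)\<^sup>2"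
proof -
  have "(1 + \<xi>\<^sup>2) * norm (ch 0 0 \<xi> r) = norm (of_real (1 + \<xi>\<^sup>2) * ch 0 0 \<xi> r)"
    unfolding norm_mult norm_of_real by simp
  also have "\<dots> \<le> norm (ch 0 0 \<xi> r) + norm (ch 2 0 \<xi> r)"
    unfolding ch_second by (simp add: numeral_2_eq_2 norm_triangle_ineq4)
  also have "\<dots> \<le> A * (wt r)\<^sup>2"
    using norm_ch_le[of 0 0 \<xi> r] norm_ch_le[of 2 0 \<xi> r] by (simp add: A_def algebra_simps)
  finally show ?thesis
    by (simp add: wt_def[of \<xi>] field_simps add_pos_nonneg)
qed

lemma norm_ch_le_wt': "norm (ch 0 0 \<xi> r) \<le> A * (wt \<xi> * wt r)"
proof -
  have "A * wt \<xi> * (wt r)\<^sup>2 \<le> A * wt \<xi> * wt r"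
    using A_nonneg by (intro mult_left_mono) (auto simp: power2_eq_square mult_left_le)
  then show ?thesis using norm_ch_le_wt[of \<xi> r] by (simp add: mult.assoc)
qed

lemma ch_integrable: "integrable lborel (\<lambda>\<xi>. ch 0 0 \<xi> r)"
proof (rule integrable_le)
  show "integrable lborel (\<lambda>\<xi>. A * wt \<xi> * (wt r)\<^sup>2)" by simp
qed (use norm_ch_le_wt in auto)

lemma ch_integrable_r: "integrable lborel (\<lambda>r. ch 0 0 \<xi> r)"
proof (rule integrable_le)
  show "integrable lborel (\<lambda>r. A * (wt \<xi> * wt r))" by simp
qed (use norm_ch_le_wt' in auto)

text \<open>The Fourier transform in both variables with the sign of the second frequency reversed;
  with this sign the slice of slope \<open>X\<close> sits at
  \<open>\<eta> = \<xi> * X\<close>.\<close>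

definition F :: "nat \<Rightarrow> real \<Rightarrow> real \<Rightarrow> complex" where
  "F j \<xi> \<eta> = (\<integral>r. exp (\<i> * of_real \<eta> * of_real r) * ch j 0 \<xi> r \<partial>lborel)"

lemma F_measurable [measurable (raw)]:
  assumes [measurable]: "f \<in> borel_measurable M" "g \<in> borel_measurable M"
  shows "(\<lambda>x. F j (f x) (g x)) \<in> borel_measurable M"
  unfolding F_def by measurable

lemma F_Suc: "F (Suc j) \<xi> \<eta> = \<i> * of_real \<xi> * F j \<xi> \<eta>"
  unfolding F_def ch_Suc by (simp add: mult.left_commute mult.assoc)

text \<open>A projection-slice theorem: for each \<open>r\<close> the shear multiplies the transform
  in \<open>u\<close> by a phase linear in \<open>r\<close>, and Fubini turns the integral of these
  phases into \<open>F\<close>.\<close>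

lemma fourier_G: "fourier (\<lambda>v. G j 0 v X) \<xi> = F j \<xi> (\<xi> * X)"
proof -
  have *: "(\<integral>v. exp (- (\<i> * of_real v * of_real \<xi>)) * c j 0 (v + X * r) r \<partial>lborel)
      = exp (\<i> * of_real (\<xi> * X) * of_real r) * ch j 0 \<xi> r" for r
    using fourier_translate[of "\<lambda>u. c j 0 u r" "X * r" \<xi>]
    by (simp add: fourier_def ch_def ac_simps)
  have m: "integrable (lborel \<Otimes>\<^sub>M lborel) (\<lambda>(r, v). exp (- (\<i> * of_real v * of_real \<xi>)) * c j 0 (v + X * r) r)"
    using integrable_norm[OF c_pair_integrable[of j 0 X]]
    by (rule integrable_le) (auto simp: norm_mult)
  have "fourier (\<lambda>v. G j 0 v X) \<xi> = (\<integral>v. \<integral>r. exp (- (\<i> * of_real v * of_real \<xi>)) * c j 0 (v + X * r) r \<partial>lborel \<partial>lborel)"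
    unfolding fourier_def G_def by simp
  also have "\<dots> = (\<integral>r. \<integral>v. exp (- (\<i> * of_real v * of_real \<xi>)) * c j 0 (v + X * r) r \<partial>lborel \<partial>lborel)"
    by (rule integral_pair_swap[OF m, symmetric])
  finally show ?thesis unfolding * F_def .
qed

lemma norm_F_le: "norm (F j \<xi> \<eta>) \<le> K j 0 * (integral\<^sup>L lborel wt)\<^sup>2"
proof -
  have "norm (ch j 0 \<xi> r) \<le> K j 0 * integral\<^sup>L lborel wt * wt r" for r
  proof -
    have "K j 0 * integral\<^sup>L lborel wt * (wt r)\<^sup>2 \<le> K j 0 * integral\<^sup>L lborel wt * wt r"
      using K_nonneg by (intro mult_left_mono) (auto simp: power2_eq_square mult_left_le integral_nonneg_AE)
    then show ?thesis using norm_ch_le[of j 0 \<xi> r] by linarith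
  qed
  then have "norm (F j \<xi> \<eta>) \<le> (\<integral>r. K j 0 * integral\<^sup>L lborel wt * wt r \<partial>lborel)"
    unfolding F_def by (intro norm_integral_le) (auto simp: norm_mult)
  then show ?thesis by (simp add: power2_eq_square)
qed

text \<open>Decay in \<eta> is read off on the slice through (\<xi>, \<eta>), whose slope is
  \<eta>/\<xi>: there \<eta> is the slope times \<xi>, the factor \<xi> is one more
  \<open>u\<close>-derivative, and the slope is absorbed by
  \<open>abs_integral_norm_G_le\<close>.\<close>

lemma abs_norm_F_le:
  assumes "\<xi> \<noteq> 0"
  shows "\<bar>\<eta>\<bar> * norm (F j \<xi> \<eta>) \<le> L j 0"
proof -
  define X where "X = \<eta> / \<xi>"
  have X: "\<xi> * X = \<eta>" using assms by (simp add: X_def)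
  have "\<bar>\<eta>\<bar> * norm (F j \<xi> \<eta>) = \<bar>X\<bar> * norm (F (Suc j) \<xi> \<eta>)"
    unfolding F_Suc X[symmetric] by (simp add: norm_mult abs_mult)
  also have "\<dots> = \<bar>X\<bar> * norm (fourier (\<lambda>v. G (Suc j) 0 v X) \<xi>)"
    by (simp add: fourier_G X)
  also have "\<dots> \<le> \<bar>X\<bar> * (\<integral>v. norm (G (Suc j) 0 v X) \<partial>lborel)"
    using G_integrable by (intro mult_left_mono norm_fourier_le) auto
  also have "\<dots> \<le> L j 0" by (rule abs_integral_norm_G_le)
  finally show ?thesis .
qed

text \<open>Large enough for \<open>F\<close> and for \<eta> times \<open>F\<close>, each with two
  \<open>u\<close>-derivatives spent on decay in \<xi>; this explains the orders 0 and 2.\<close>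

definition B :: real where
  "B = (K 0 0 + K 2 0) * (integral\<^sup>L lborel wt)\<^sup>2 + L 0 0 + L 2 0"

lemma B_nonneg: "0 \<le> B"
  unfolding B_def using K_nonneg L_nonneg
  by (auto intro!: add_nonneg_nonneg mult_nonneg_nonneg)

lemma F_second: "(1 + \<xi>\<^sup>2) * norm (F 0 \<xi> \<eta>) \<le> norm (F 0 \<xi> \<eta>) + norm (F 2 \<xi> \<eta>)"
proof -
  have "of_real (1 + \<xi>\<^sup>2) * F 0 \<xi> \<eta> = F 0 \<xi> \<eta> - F 2 \<xi> \<eta>"
    by (simp add: F_Suc numeral_2_eq_2 algebra_simps)
  moreover have "(1 + \<xi>\<^sup>2) * norm (F 0 \<xi> \<eta>) = norm (of_real (1 + \<xi>\<^sup>2) * F 0 \<xi> \<eta>)"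
    unfolding norm_mult norm_of_real by simp
  ultimately show ?thesis by (metis norm_triangle_ineq4)
qed

lemma norm_F_le_wt: "norm (F 0 \<xi> \<eta>) \<le> B * wt \<xi>"
proof -
  have "(1 + \<xi>\<^sup>2) * norm (F 0 \<xi> \<eta>) \<le> B"
    using F_second[of \<xi> \<eta>] norm_F_le[of 0 \<xi> \<eta>] norm_F_le[of 2 \<xi> \<eta>] L_nonneg[of 0 0] L_nonneg[of 2 0]
    unfolding B_def distrib_right by linarith
  then show ?thesis by (simp add: wt_def field_simps add_pos_nonneg)
qed

lemma abs_norm_F_le_wt:
  assumes "\<xi> \<noteq> 0"
  shows "\<bar>\<eta>\<bar> * norm (F 0 \<xi> \<eta>) \<le> B * wt \<xi>"
proof -
  have "(1 + \<xi>\<^sup>2) * (\<bar>\<eta>\<bar> * norm (F 0 \<xi> \<eta>)) \<le> \<bar>\<eta>\<bar> * (norm (F 0 \<xi> \<eta>) + norm (F 2 \<xi> \<eta>))"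
    using mult_left_mono[OF F_second[of \<xi> \<eta>], of "\<bar>\<eta>\<bar>"] by (simp add: ac_simps)
  also have "\<dots> \<le> L 0 0 + L 2 0"
    using abs_norm_F_le[OF assms, of \<eta> 0] abs_norm_F_le[OF assms, of \<eta> 2] by (simp add: distrib_left)
  also have "\<dots> \<le> B"
    using K_nonneg unfolding B_def by (simp add: add_nonneg_nonneg)
  finally show ?thesis by (simp add: wt_def field_simps add_pos_nonneg)
qed

end

locale half_plane_pair =
  p: half_plane_decay rp P + q: half_plane_decay rp Q
  for rp :: real and P Q :: "nat \<Rightarrow> nat \<Rightarrow> real \<Rightarrow> real \<Rightarrow> complex"
begin

section \<open>The flux through the level sets of X\<close>

definition g :: "real \<Rightarrow> real \<Rightarrow> complex" where
  "g v X = p.G 1 0 v X * cnj (q.G 0 0 v X)"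

definition h :: "real \<Rightarrow> complex" where
  "h X = (\<integral>v. g v X \<partial>lborel)"

text \<open>The first summand bounds the integral of \<open>norm (g v X)\<close>, the second the
  same integral times \<open>X\<^sup>2\<close>.\<close>

definition H :: real where
  "H = p.K 1 0 * (integral\<^sup>L lborel wt)\<^sup>2 * (q.K 0 0 * integral\<^sup>L lborel wt)
     + p.L 0 0 * (q.K 0 0 * integral\<^sup>L lborel wt)"

lemma g_measurable [measurable (raw)]:
  assumes [measurable]: "a \<in> borel_measurable M" "b \<in> borel_measurable M"
  shows "(\<lambda>x. g (a x) (b x)) \<in> borel_measurable M"
  unfolding g_def by measurable

lemma h_measurable [measurable]: "h \<in> borel_measurable borel"
  unfolding h_def[abs_def] by measurable

lemma g_integrable: "integrable lborel (\<lambda>v. g v X)"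
proof (rule integrable_le)
  show "integrable lborel (\<lambda>v. norm (p.G 1 0 v X) * (q.K 0 0 * integral\<^sup>L lborel wt))"
    using p.G_integrable by auto
  show "norm (g v X) \<le> norm (p.G 1 0 v X) * (q.K 0 0 * integral\<^sup>L lborel wt)" for v
    unfolding g_def norm_mult complex_mod_cnj by (intro mult_left_mono q.norm_G_le) auto
qed measurable

text \<open>The density is estimated by the \<open>L\<close>^1 norm of its first factor times the
  supremum of its second. Each of them is bounded and of order 1/\<open>\<bar>X\<bar>\<close>, so
  their product has the decay of \<open>wt X\<close>.\<close>

lemma integral_norm_g_le: "(\<integral>v. norm (g v X) \<partial>lborel) \<le> H * wt X"
proof -
  define k where "k = q.K 0 0 * integral\<^sup>L lborel wt"
  define n where "n = (\<integral>v. norm (p.G (Suc 0) 0 v X) \<partial>lborel)"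
  have k0: "0 \<le> k" using q.K_nonneg by (simp add: k_def integral_nonneg_AE)
  have n0: "0 \<le> n" by (simp add: n_def integral_nonneg_AE)
  have "(\<integral>v. norm (g v X) \<partial>lborel) \<le> (\<integral>v. norm (p.G (Suc 0) 0 v X) * k \<partial>lborel)"
  proof (rule integral_mono)
    show "norm (g v X) \<le> norm (p.G (Suc 0) 0 v X) * k" for v
      unfolding g_def norm_mult complex_mod_cnj k_def One_nat_def by (intro mult_left_mono q.norm_G_le) auto
  qed (use g_integrable p.G_integrable in auto)
  then have 1: "(\<integral>v. norm (g v X) \<partial>lborel) \<le> n * k" by (simp add: n_def)
  \<comment> \<open>One factor \<open>\<bar>X\<bar>\<close> is given to each of the two factors of
    the density.\<close>
  have "\<bar>X\<bar> * (\<bar>X\<bar> * (\<integral>v. norm (g v X) \<partial>lborel)) = \<bar>X\<bar> * (\<integral>v. norm (p.G (Suc 0) 0 v X) * (\<bar>X\<bar> * norm (q.G 0 0 v X)) \<partial>lborel)"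
  proof -
    have "norm (p.G (Suc 0) 0 v X) * (\<bar>X\<bar> * norm (q.G 0 0 v X)) = \<bar>X\<bar> * norm (g v X)" for v
      by (simp add: g_def norm_mult)
    then show ?thesis by (simp only: integral_mult_right_zero)
  qed
  also have "\<dots> \<le> \<bar>X\<bar> * (\<integral>v. norm (p.G (Suc 0) 0 v X) * k \<partial>lborel)"
  proof (intro mult_left_mono integral_mono)
    have "integrable lborel (\<lambda>v. \<bar>X\<bar> * norm (g v X))" using g_integrable by auto
    then show "integrable lborel (\<lambda>v. norm (p.G (Suc 0) 0 v X) * (\<bar>X\<bar> * norm (q.G 0 0 v X)))"
      by (simp add: g_def norm_mult ac_simps)
    show "\<bar>X\<bar> * norm (q.G 0 0 v X) \<le> k" for v unfolding k_def by (rule q.abs_norm_G_le)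
  qed (use p.G_integrable in auto)
  also have "\<dots> = \<bar>X\<bar> * n * k" by (simp add: n_def)
  finally have 2: "X\<^sup>2 * (\<integral>v. norm (g v X) \<partial>lborel) \<le> \<bar>X\<bar> * n * k"
    by (simp add: power2_eq_square flip: mult.assoc)
  have "n * k \<le> p.K 1 0 * (integral\<^sup>L lborel wt)\<^sup>2 * k" "\<bar>X\<bar> * n * k \<le> p.L 0 0 * k"
    using p.integral_norm_G_le[of "Suc 0" 0 X] p.abs_integral_norm_G_le[of X 0 0] k0
    by (auto simp: n_def intro!: mult_right_mono)
  with 1 2 have "(1 + X\<^sup>2) * (\<integral>v. norm (g v X) \<partial>lborel) \<le> H"
    unfolding H_def k_def[symmetric] distrib_right by linarith
  then show ?thesis by (simp add: wt_def field_simps add_pos_nonneg)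
qed

lemma norm_h_le: "norm (h X) \<le> H * wt X"
  unfolding h_def using integral_norm_bound[of lborel "\<lambda>v. g v X"] integral_norm_g_le[of X] by linarith

lemma h_integrable: "integrable lborel h"
  by (rule integrable_le[where g = "\<lambda>X. H * wt X"]) (use norm_h_le in auto)

definition \<Phi> :: "real \<Rightarrow> real \<Rightarrow> complex" where
  "\<Phi> \<xi> \<eta> = p.F 0 \<xi> \<eta> * cnj (q.F 0 \<xi> \<eta>)"

lemma \<Phi>_measurable [measurable (raw)]:
  assumes [measurable]: "a \<in> borel_measurable M" "b \<in> borel_measurable M"
  shows "(\<lambda>x. \<Phi> (a x) (b x)) \<in> borel_measurable M"
  unfolding \<Phi>_def by measurable

lemma norm_\<Phi>_le: "norm (\<Phi> \<xi> \<eta>) \<le> p.B * q.B * (wt \<xi>)\<^sup>2"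
proof -
  have "norm (\<Phi> \<xi> \<eta>) \<le> (p.B * wt \<xi>) * (q.B * wt \<xi>)"
    unfolding \<Phi>_def norm_mult complex_mod_cnj
    by (intro mult_mono p.norm_F_le_wt q.norm_F_le_wt mult_nonneg_nonneg p.B_nonneg) auto
  then show ?thesis by (simp add: power2_eq_square ac_simps)
qed

text \<open>Each of the two transforms absorbs one power of \<eta>; together with the bound without
  \<eta> this gives an integrable weight in \<eta>. The slope \<eta>/\<xi> behind these estimates
  exists for nonzero \<xi>.\<close>

lemma norm_\<Phi>_le':
  assumes "\<xi> \<noteq> 0"
  shows "norm (\<Phi> \<xi> \<eta>) \<le> 2 * (p.B * q.B) * ((wt \<xi>)\<^sup>2 * wt \<eta>)"
proof -
  have "(\<bar>\<eta>\<bar> * norm (p.F 0 \<xi> \<eta>)) * (\<bar>\<eta>\<bar> * norm (q.F 0 \<xi> \<eta>)) \<le> (p.B * wt \<xi>) * (q.B * wt \<xi>)"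
    by (intro mult_mono p.abs_norm_F_le_wt q.abs_norm_F_le_wt mult_nonneg_nonneg p.B_nonneg assms) auto
  then have "\<eta>\<^sup>2 * norm (\<Phi> \<xi> \<eta>) \<le> p.B * q.B * (wt \<xi>)\<^sup>2"
  proof -
    have "(\<bar>\<eta>\<bar> * norm (p.F 0 \<xi> \<eta>)) * (\<bar>\<eta>\<bar> * norm (q.F 0 \<xi> \<eta>)) = \<bar>\<eta>\<bar> * \<bar>\<eta>\<bar> * norm (\<Phi> \<xi> \<eta>)"
      by (simp only: \<Phi>_def norm_mult complex_mod_cnj mult.assoc mult.left_commute)
    moreover assume "(\<bar>\<eta>\<bar> * norm (p.F 0 \<xi> \<eta>)) * (\<bar>\<eta>\<bar> * norm (q.F 0 \<xi> \<eta>)) \<le> (p.B * wt \<xi>) * (q.B * wt \<xi>)"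
    ultimately show ?thesis
      by (simp add: power2_eq_square mult.assoc mult.left_commute)
  qed
  then have "(1 + \<eta>\<^sup>2) * norm (\<Phi> \<xi> \<eta>) \<le> 2 * (p.B * q.B) * (wt \<xi>)\<^sup>2"
    using norm_\<Phi>_le[of \<xi> \<eta>] by (simp add: distrib_right)
  then show ?thesis by (simp add: wt_def[of \<eta>] field_simps add_pos_nonneg)
qed

text \<open>One of the two factors \<open>wt \<xi>\<close> absorbs \<xi>; the other keeps the bound
  integrable, uniformly in \<eta>.\<close>

lemma norm_ii_\<Phi>_le: "norm (\<i> * of_real \<xi> * \<Phi> \<xi> \<eta>) \<le> p.B * q.B * wt \<xi>"
proof -
  have "\<bar>\<xi>\<bar> * norm (\<Phi> \<xi> \<eta>) \<le> \<bar>\<xi>\<bar> * (p.B * q.B * (wt \<xi>)\<^sup>2)"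
    by (intro mult_left_mono norm_\<Phi>_le) auto
  also have "\<dots> = (p.B * q.B * wt \<xi>) * (\<bar>\<xi>\<bar> * wt \<xi>)"
    by (simp add: power2_eq_square)
  also have "\<dots> \<le> (p.B * q.B * wt \<xi>) * 1"
    by (intro mult_left_mono abs_wt_le_1 mult_nonneg_nonneg p.B_nonneg q.B_nonneg) auto
  finally show ?thesis by (simp add: norm_mult)
qed

text \<open>Parseval in \<open>v\<close> combined with the projection-slice formula; the derivative
  on the first factor supplies \<open>\<i> * of_real \<xi>\<close>.\<close>

lemma h_eq_\<Phi>: "h X = 1 / (2 * of_real pi) * (\<integral>\<xi>. \<i> * of_real \<xi> * \<Phi> \<xi> (\<xi> * X) \<partial>lborel)"
proof -
  have "integrable lborel (\<lambda>\<xi>. q.F 0 \<xi> (\<xi> * X))"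
    by (rule integrable_le[where g = "\<lambda>\<xi>. q.B * wt \<xi>"]) (use q.norm_F_le_wt in auto)
  then have "integrable lborel (fourier (\<lambda>v. q.G 0 0 v X))"
    by (simp add: q.fourier_G[abs_def])
  then have "h X = 1 / (2 * of_real pi) *
      (\<integral>\<xi>. fourier (\<lambda>v. p.G 1 0 v X) \<xi> * cnj (fourier (\<lambda>v. q.G 0 0 v X) \<xi>) \<partial>lborel)"
    unfolding h_def g_def
    by (rule fourier_parseval[OF p.G_integrable q.G_integrable q.norm_G_le q.G_continuous])
  then show ?thesis
    unfolding p.fourier_G q.fourier_G One_nat_def p.F_Suc \<Phi>_def by (simp only: mult.assoc)
qed

lemma tilde_eq_G:
  assumes "\<And>u r. rp \<le> r \<Longrightarrow> D 0 0 u r = \<psi> u r" and "half_plane_decay rp D"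
  shows "tilde rp S R Rt \<psi> vt rt = half_plane_decay.G rp D 0 0 (vt - S * (rt - Rt) * R) (S * (rt - Rt))"
proof -
  interpret half_plane_decay rp D by fact
  show ?thesis
    unfolding tilde_def G_def set_lebesgue_integral_def c_def
    using assms(1) by (intro Bochner_Integration.integral_cong) (auto simp: indicator_def algebra_simps)
qed

context
  fixes \<psi>1 \<psi>2 :: "real \<Rightarrow> real \<Rightarrow> complex"
  assumes \<psi>1: "\<And>u r. rp \<le> r \<Longrightarrow> P 0 0 u r = \<psi>1 u r"
    and \<psi>2: "\<And>u r. rp \<le> r \<Longrightarrow> Q 0 0 u r = \<psi>2 u r"
begin

lemma tilde_eq:
  "tilde rp S R Rt \<psi>1 vt rt = p.G 0 0 (vt - S * (rt - Rt) * R) (S * (rt - Rt))"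
  "tilde rp S R Rt \<psi>2 vt rt = q.G 0 0 (vt - S * (rt - Rt) * R) (S * (rt - Rt))"
  by (intro tilde_eq_G p.half_plane_decay_axioms q.half_plane_decay_axioms \<psi>1 \<psi>2; assumption)+

lemma in_time_coords_has_vector_derivative:
  "((\<lambda>t. in_time_coords f (tilde rp S R Rt \<psi>1) t rt) has_vector_derivative
     p.G 1 0 (\<tau> - f rt - S * (rt - Rt) * R) (S * (rt - Rt))) (at \<tau>)"
proof -
  define e where "e = f rt + S * (rt - Rt) * R"
  have "((\<lambda>t. t - e) has_vector_derivative 1) (at \<tau>)"
    by (auto intro!: derivative_eq_intros)
  from vector_diff_chain_at[OF this p.G_has_vector_derivative, of 0 0 "S * (rt - Rt)"]
  show ?thesis
    unfolding in_time_coords_def tilde_eq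
    by (simp add: o_def e_def diff_diff_eq)
qed

lemma flux_density_eq:
  "flux_density f (tilde rp S R Rt \<psi>1) (tilde rp S R Rt \<psi>2) \<tau> rt =
    g (\<tau> - f rt - S * (rt - Rt) * R) (S * (rt - Rt))"
  unfolding flux_density_def g_def vector_derivative_at[OF in_time_coords_has_vector_derivative]
  by (simp add: in_time_coords_def tilde_eq)

text \<open>For fixed \<open>rt\<close> both \<open>f rt\<close> and the term with \<open>R\<close>
  only translate \<tau>, which does not change the inner integral. The substitution
  \<open>X = S * (rt - Rt)\<close> then uses up the prefactor \<open>\<bar>S\<bar>\<close>.\<close>

lemma flux_eq:
  assumes "S \<noteq> 0"
  shows "flux S Rt I f (tilde rp S R Rt \<psi>1) (tilde rp S R Rt \<psi>2) = (LBINT X:I. h X)"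
proof -
  have *: "(\<integral>\<tau>. flux_density f (tilde rp S R Rt \<psi>1) (tilde rp S R Rt \<psi>2) \<tau> rt \<partial>lborel) = h (S * (rt - Rt))" for rt
    unfolding flux_density_eq h_def
    using integral_translate(2)[of "\<lambda>v. g v (S * (rt - Rt))" "f rt + S * (rt - Rt) * R"]
    by (simp add: diff_diff_eq)
  have "(LBINT X:I. h X) = \<bar>S\<bar> *\<^sub>R (\<integral>x. indicator I (- S * Rt + S * x) *\<^sub>R h (- S * Rt + S * x) \<partial>lborel)"
    unfolding set_lebesgue_integral_def using assms by (rule lborel_integral_real_affine)
  also have "\<dots> = flux S Rt I f (tilde rp S R Rt \<psi>1) (tilde rp S R Rt \<psi>2)"
    unfolding flux_def * set_lebesgue_integral_def
    by (simp add: X_region_def indicator_def scaleR_conv_of_real algebra_simps)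
  finally show ?thesis by simp
qed

lemma flux_density_integrable:
  assumes S: "S \<noteq> 0" and I: "is_interval I" and f: "regular_time_function (X_region S Rt I) f"
  shows "set_integrable lborel (X_region S Rt I \<times> UNIV)
    (\<lambda>(rt, \<tau>). flux_density f (tilde rp S R Rt \<psi>1) (tilde rp S R Rt \<psi>2) \<tau> rt)"
proof -
  define Y where "Y = X_region S Rt I"
  have "Y = (\<lambda>rt. S * (rt - Rt)) -` I" by (auto simp: Y_def X_region_def)
  moreover have "(\<lambda>rt. S * (rt - Rt)) \<in> borel_measurable borel" by simp
  moreover have "I \<in> sets borel" using I by (rule real_interval_borel_measurable)
  ultimately have Y[measurable]: "Y \<in> sets borel" using measurable_sets_borel by blast
  \<comment> \<open>The cut-off of \<open>f\<close> to \<open>Y\<close>, not a derivative: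
    \<open>f\<close> is continuous only on \<open>Y\<close>, whereas Fubini asks for a function
    measurable on the whole line.\<close>
  define f' where "f' x = indicator Y x *\<^sub>R f x" for x
  have "continuous_on Y f"
    using f unfolding regular_time_function_def Y_def
    by (meson DERIV_continuous continuous_on_eq_continuous_within)
  then have [measurable]: "f' \<in> borel_measurable borel"
    unfolding f'_def using Y by (rule borel_measurable_continuous_on_indicator[rotated])
  define k where "k = (\<lambda>rt \<tau>. indicator Y rt *\<^sub>R g (\<tau> - (f' rt + S * (rt - Rt) * R)) (S * (rt - Rt)))"
  have "integrable (lborel \<Otimes>\<^sub>M lborel) (\<lambda>(rt, \<tau>). k rt \<tau>)"
  proof (rule integrable_pair_of_integral_bound)
    show "(\<lambda>x. k (fst x) (snd x)) \<in> borel_measurable borel"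
      unfolding k_def borel_prod[symmetric] by measurable
    show "integrable lborel (\<lambda>rt. H * wt (- S * Rt + S * rt))"
      by (intro integrable_mult_right lborel_integrable_real_affine wt_integrable S)
    show "integrable lborel (k rt)" for rt
      unfolding k_def using integrable_translate(2)[OF g_integrable] by auto
    show "(\<integral>\<tau>. norm (k rt \<tau>) \<partial>lborel) \<le> H * wt (- S * Rt + S * rt)" for rt
    proof -
      have "(\<integral>\<tau>. norm (k rt \<tau>) \<partial>lborel) = indicator Y rt * (\<integral>v. norm (g v (S * (rt - Rt))) \<partial>lborel)"
        unfolding k_def
        using integral_translate(2)[of "\<lambda>v. norm (g v (S * (rt - Rt)))" "f' rt + S * (rt - Rt) * R"] by simp
      also have "\<dots> \<le> (\<integral>v. norm (g v (S * (rt - Rt))) \<partial>lborel)"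
        by (simp add: indicator_def)
      also have "\<dots> \<le> H * wt (- S * Rt + S * rt)"
        using integral_norm_g_le[of "S * (rt - Rt)"] by (simp add: algebra_simps)
      finally show ?thesis .
    qed
  qed
  also have "(\<lambda>(rt, \<tau>). k rt \<tau>) = (\<lambda>x. indicator (Y \<times> UNIV) x *\<^sub>R
      (case x of (rt, \<tau>) \<Rightarrow> flux_density f (tilde rp S R Rt \<psi>1) (tilde rp S R Rt \<psi>2) \<tau> rt))"
    unfolding flux_density_eq by (auto simp: k_def f'_def indicator_def diff_diff_eq)
  finally show ?thesis by (simp add: set_integrable_def lborel_prod Y_def)
qed

end

section \<open>Pairing with the kernel\<close>

definition \<phi> :: "real \<Rightarrow> real \<Rightarrow> real \<Rightarrow> complex" where
  "\<phi> \<xi> r s = p.ch 0 0 \<xi> r * cnj (q.ch 0 0 \<xi> s)"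

lemma \<phi>_measurable [measurable (raw)]:
  assumes [measurable]: "a \<in> borel_measurable M" "b \<in> borel_measurable M" "d \<in> borel_measurable M"
  shows "(\<lambda>x. \<phi> (a x) (b x) (d x)) \<in> borel_measurable M"
  unfolding \<phi>_def by measurable

lemma norm_\<phi>_le: "norm (\<phi> \<xi> r s) \<le> p.A * q.A * (wt \<xi>)\<^sup>2 * (wt r * wt s)"
proof -
  have "norm (\<phi> \<xi> r s) \<le> (p.A * (wt \<xi> * wt r)) * (q.A * (wt \<xi> * wt s))"
    unfolding \<phi>_def norm_mult complex_mod_cnj
    by (intro mult_mono p.norm_ch_le_wt' q.norm_ch_le_wt' mult_nonneg_nonneg p.A_nonneg) auto
  then show ?thesis by (simp add: power2_eq_square ac_simps)
qed

lemma abs_norm_\<phi>_le: "\<bar>\<xi>\<bar> * norm (\<phi> \<xi> r s) \<le> p.A * q.A * (wt \<xi> * (wt r * wt s))"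
proof -
  have "\<bar>\<xi>\<bar> * norm (\<phi> \<xi> r s) \<le> \<bar>\<xi>\<bar> * (p.A * q.A * (wt \<xi>)\<^sup>2 * (wt r * wt s))"
    by (intro mult_left_mono norm_\<phi>_le) auto
  also have "\<dots> = (\<bar>\<xi>\<bar> * wt \<xi>) * (p.A * q.A * (wt \<xi> * (wt r * wt s)))"
    by (simp add: power2_eq_square)
  also have "\<dots> \<le> 1 * (p.A * q.A * (wt \<xi> * (wt r * wt s)))"
    by (intro mult_right_mono abs_wt_le_1 mult_nonneg_nonneg p.A_nonneg q.A_nonneg) auto
  finally show ?thesis by simp
qed

lemma wt_integrable_triple: "integrable lborel (\<lambda>(\<xi>, r, s). C * (wt \<xi> * (wt r * wt s)))"
proof -
  have 2: "integrable lborel (\<lambda>(r, s). wt r * wt s)"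
    unfolding lborel_prod[symmetric]
  proof (rule integrable_pair_of_product_bound[where g = wt and k = wt])
    show "(\<lambda>x. wt (fst x) * wt (snd x)) \<in> borel_measurable borel"
      unfolding borel_prod[symmetric] by measurable
  qed simp_all
  have "integrable (lborel \<Otimes>\<^sub>M lborel) (\<lambda>(\<xi>, y). wt \<xi> * (case y of (r, s) \<Rightarrow> wt r * wt s))"
  proof (rule integrable_pair_of_product_bound[where g = wt, OF _ _ 2])
    show "(\<lambda>x. wt (fst x) * (case snd x of (r, s) \<Rightarrow> wt r * wt s)) \<in> borel_measurable borel"
      unfolding borel_prod[symmetric] case_prod_beta' by measurable
  qed (auto split: prod.split)
  then show ?thesis
    unfolding lborel_prod by (simp add: case_prod_beta')
qed

context
  fixes I :: "real set" and M :: real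
  assumes I[measurable]: "I \<in> sets borel" and M: "I \<subseteq> {- M..M}"
begin

lemma indicator_integrable: "integrable lborel (indicator I :: real \<Rightarrow> real)"
proof -
  have "emeasure lborel I \<le> emeasure lborel {- M..M}"
    using M by (intro emeasure_mono) auto
  also have "\<dots> < \<infinity>" by (cases "- M \<le> M") auto
  finally show ?thesis by simp
qed

lemma X_kernel_measurable [measurable (raw)]:
  assumes [measurable]: "a \<in> borel_measurable N" "b \<in> borel_measurable N" "d \<in> borel_measurable N"
  shows "(\<lambda>x. X_kernel I (a x) (b x) (d x)) \<in> borel_measurable N"
  unfolding X_kernel_def set_lebesgue_integral_def by measurable

lemma norm_X_kernel_le: "norm (X_kernel I \<xi> r s) \<le> \<bar>\<xi>\<bar> * (\<integral>X. indicator I X \<partial>lborel)"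
proof -
  have "norm (X_kernel I \<xi> r s) \<le> (\<integral>X. \<bar>\<xi>\<bar> * indicator I X \<partial>lborel)"
    unfolding X_kernel_def set_lebesgue_integral_def
  proof (rule norm_integral_le)
    show "integrable lborel (\<lambda>X. \<bar>\<xi>\<bar> * indicator I X)" using indicator_integrable by simp
    show "norm (indicator I X *\<^sub>R (\<i> * of_real \<xi> * exp (\<i> * of_real \<xi> * of_real X * of_real (r - s))))
        \<le> \<bar>\<xi>\<bar> * indicator I X" for X
    proof -
      have "\<i> * complex_of_real \<xi> * of_real X * of_real (r - s) = \<i> * of_real (\<xi> * X * (r - s))" by simp
      then show ?thesis
        by (simp only: norm_scaleR norm_mult norm_exp_ii norm_ii norm_of_real) (simp add: indicator_def)
    qed
  qed
  then show ?thesis by simp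
qed

lemma norm_\<phi>_X_kernel_le:
  "norm (\<phi> \<xi> r s * X_kernel I \<xi> r s) \<le> p.A * q.A * (\<integral>X. indicator I X \<partial>lborel) * (wt \<xi> * (wt r * wt s))"
proof -
  have "norm (\<phi> \<xi> r s * X_kernel I \<xi> r s) \<le> norm (\<phi> \<xi> r s) * (\<bar>\<xi>\<bar> * (\<integral>X. indicator I X \<partial>lborel))"
    unfolding norm_mult by (intro mult_left_mono norm_X_kernel_le) auto
  also have "\<dots> = (\<integral>X. indicator I X \<partial>lborel) * (\<bar>\<xi>\<bar> * norm (\<phi> \<xi> r s))" by simp
  also have "\<dots> \<le> (\<integral>X. indicator I X \<partial>lborel) * (p.A * q.A * (wt \<xi> * (wt r * wt s)))"
    by (intro mult_left_mono abs_norm_\<phi>_le integral_nonneg_AE) auto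
  finally show ?thesis by (simp add: ac_simps)
qed

lemma \<phi>_X_kernel_integrable: "integrable lborel (\<lambda>(\<xi>, r, s). \<phi> \<xi> r s * X_kernel I \<xi> r s)"
proof (rule integrable_le[OF wt_integrable_triple])
  show "(\<lambda>(\<xi>, r, s). \<phi> \<xi> r s * X_kernel I \<xi> r s) \<in> borel_measurable lborel"
    unfolding lborel_prod[symmetric] case_prod_beta' by measurable
  show "norm (case x of (\<xi>, r, s) \<Rightarrow> \<phi> \<xi> r s * X_kernel I \<xi> r s) \<le>
      (case x of (\<xi>, r, s) \<Rightarrow> p.A * q.A * (\<integral>X. indicator I X \<partial>lborel) * (wt \<xi> * (wt r * wt s)))" for x
    using norm_\<phi>_X_kernel_le by (auto split: prod.split)
qed

text \<open>Under the \<open>X\<close>-integral the oscillation splits into a factor in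
  \<open>r\<close> and a conjugate factor in \<open>s\<close>. With the \<open>X\<close>-integral
  moved outside, the \<open>s\<close>-integral becomes the conjugate of \<open>q.F\<close> and the
  \<open>r\<close>-integral becomes \<open>p.F\<close>, both at \<open>\<xi> * X\<close>.\<close>

lemma integral_\<phi>_X_kernel:
  "(\<integral>r. \<integral>s. \<phi> \<xi> r s * X_kernel I \<xi> r s \<partial>lborel \<partial>lborel)
    = (\<integral>X. indicator I X *\<^sub>R (\<i> * of_real \<xi> * \<Phi> \<xi> (\<xi> * X)) \<partial>lborel)"
proof -
  define e where "e = (\<lambda>X r. exp (\<i> * of_real (\<xi> * X) * of_real r))"
  define j where "j = (\<lambda>X. indicator I X *\<^sub>R (\<i> * complex_of_real \<xi>))"
  have ne: "norm (e X r) = 1" for X r by (simp add: e_def del: of_real_mult)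
  have nj: "norm (j X) = \<bar>\<xi>\<bar> * indicator I X" for X by (simp add: j_def norm_mult)
  have [measurable]: "j \<in> borel_measurable borel" unfolding j_def by measurable
  have [measurable]: "(\<lambda>x. e (a x) (b x)) \<in> borel_measurable N"
    if [measurable]: "a \<in> borel_measurable N" "b \<in> borel_measurable N" for a b and N :: "'z measure"
    unfolding e_def by measurable
  have ker: "X_kernel I \<xi> r s = (\<integral>X. j X * e X r * cnj (e X s) \<partial>lborel)" for r s
  proof -
    have "exp (\<i> * complex_of_real \<xi> * of_real X * of_real (r - s)) = e X r * cnj (e X s)" for X
      unfolding e_def exp_cnj by (simp add: algebra_simps flip: exp_add)
    then show ?thesis
      unfolding X_kernel_def set_lebesgue_integral_def j_def
      by (intro Bochner_Integration.integral_cong) (auto simp: mult.assoc)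
  qed
  have ji: "integrable lborel (\<lambda>X. \<bar>\<xi>\<bar> * indicator I X)" using indicator_integrable by simp
  have s: "(\<integral>s. \<phi> \<xi> r s * X_kernel I \<xi> r s \<partial>lborel)
      = (\<integral>X. j X * e X r * p.ch 0 0 \<xi> r * cnj (q.F 0 \<xi> (\<xi> * X)) \<partial>lborel)" for r
  proof -
    have "(\<integral>s. \<phi> \<xi> r s * X_kernel I \<xi> r s \<partial>lborel)
        = (\<integral>s. \<integral>X. \<phi> \<xi> r s * (j X * e X r * cnj (e X s)) \<partial>lborel \<partial>lborel)"
      unfolding ker by simp
    also have "\<dots> = (\<integral>X. \<integral>s. \<phi> \<xi> r s * (j X * e X r * cnj (e X s)) \<partial>lborel \<partial>lborel)"
    proof (rule integral_swap_of_product_bound[OF _ _ ji])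
      show "(\<lambda>x. \<phi> \<xi> r (fst x) * (j (snd x) * e (snd x) r * cnj (e (snd x) (fst x)))) \<in> borel_measurable borel"
        unfolding borel_prod[symmetric] by measurable
      show "integrable lborel (\<lambda>s. p.A * q.A * (wt \<xi>)\<^sup>2 * (wt r * wt s))" by simp
      show "norm (\<phi> \<xi> r s * (j X * e X r * cnj (e X s)))
          \<le> p.A * q.A * (wt \<xi>)\<^sup>2 * (wt r * wt s) * (\<bar>\<xi>\<bar> * indicator I X)" for s X
        unfolding norm_mult nj ne complex_mod_cnj
        using mult_right_mono[OF norm_\<phi>_le[of \<xi> r s], of "\<bar>\<xi>\<bar> * indicator I X"] by simp
    qed
    also have "\<dots> = (\<integral>X. j X * e X r * p.ch 0 0 \<xi> r * cnj (q.F 0 \<xi> (\<xi> * X)) \<partial>lborel)"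
    proof (rule Bochner_Integration.integral_cong[OF refl])
      fix X
      have "cnj (q.F 0 \<xi> (\<xi> * X)) = (\<integral>s. cnj (e X s * q.ch 0 0 \<xi> s) \<partial>lborel)"
        unfolding q.F_def e_def by (rule Bochner_Integration.integral_cnj[symmetric])
      then have "j X * e X r * p.ch 0 0 \<xi> r * cnj (q.F 0 \<xi> (\<xi> * X))
          = (\<integral>s. j X * e X r * p.ch 0 0 \<xi> r * cnj (e X s * q.ch 0 0 \<xi> s) \<partial>lborel)"
        by (simp only: integral_mult_right_zero)
      also have "\<dots> = (\<integral>s. \<phi> \<xi> r s * (j X * e X r * cnj (e X s)) \<partial>lborel)"
        by (intro Bochner_Integration.integral_cong) (auto simp: \<phi>_def)
      finally show "(\<integral>s. \<phi> \<xi> r s * (j X * e X r * cnj (e X s)) \<partial>lborel) =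
          j X * e X r * p.ch 0 0 \<xi> r * cnj (q.F 0 \<xi> (\<xi> * X))" by simp
    qed
    finally show ?thesis .
  qed
  have "(\<integral>r. \<integral>s. \<phi> \<xi> r s * X_kernel I \<xi> r s \<partial>lborel \<partial>lborel)
      = (\<integral>r. \<integral>X. j X * e X r * p.ch 0 0 \<xi> r * cnj (q.F 0 \<xi> (\<xi> * X)) \<partial>lborel \<partial>lborel)"
    unfolding s ..
  also have "\<dots> = (\<integral>X. \<integral>r. j X * e X r * p.ch 0 0 \<xi> r * cnj (q.F 0 \<xi> (\<xi> * X)) \<partial>lborel \<partial>lborel)"
  proof (rule integral_swap_of_product_bound[OF _ _ ji])
    show "(\<lambda>x. j (snd x) * e (snd x) (fst x) * p.ch 0 0 \<xi> (fst x) * cnj (q.F 0 \<xi> (\<xi> * snd x))) \<in> borel_measurable borel"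
      unfolding borel_prod[symmetric] by measurable
    show "integrable lborel (\<lambda>r. (p.A * (wt \<xi> * wt r)) * (q.B * wt \<xi>))" by simp
    show "norm (j X * e X r * p.ch 0 0 \<xi> r * cnj (q.F 0 \<xi> (\<xi> * X)))
        \<le> (p.A * (wt \<xi> * wt r)) * (q.B * wt \<xi>) * (\<bar>\<xi>\<bar> * indicator I X)" for r X
    proof -
      have "norm (p.ch 0 0 \<xi> r) * norm (q.F 0 \<xi> (\<xi> * X)) \<le> (p.A * (wt \<xi> * wt r)) * (q.B * wt \<xi>)"
        by (intro mult_mono p.norm_ch_le_wt' q.norm_F_le_wt mult_nonneg_nonneg p.A_nonneg) auto
      from mult_right_mono[OF this, of "\<bar>\<xi>\<bar> * indicator I X"]
      show ?thesis by (simp add: norm_mult nj ne ac_simps)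
    qed
  qed
  also have "\<dots> = (\<integral>X. indicator I X *\<^sub>R (\<i> * of_real \<xi> * \<Phi> \<xi> (\<xi> * X)) \<partial>lborel)"
  proof (rule Bochner_Integration.integral_cong[OF refl])
    fix X
    have "(\<integral>r. j X * e X r * p.ch 0 0 \<xi> r * cnj (q.F 0 \<xi> (\<xi> * X)) \<partial>lborel)
        = (\<integral>r. j X * (e X r * p.ch 0 0 \<xi> r) * cnj (q.F 0 \<xi> (\<xi> * X)) \<partial>lborel)"
      by (simp only: mult.assoc)
    also have "\<dots> = j X * p.F 0 \<xi> (\<xi> * X) * cnj (q.F 0 \<xi> (\<xi> * X))"
      unfolding p.F_def e_def by (simp only: integral_mult_right_zero integral_mult_left_zero)
    also have "\<dots> = indicator I X *\<^sub>R (\<i> * of_real \<xi> * \<Phi> \<xi> (\<xi> * X))"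
      by (simp add: j_def \<Phi>_def)
    finally show "(\<integral>r. j X * e X r * p.ch 0 0 \<xi> r * cnj (q.F 0 \<xi> (\<xi> * X)) \<partial>lborel)
        = indicator I X *\<^sub>R (\<i> * of_real \<xi> * \<Phi> \<xi> (\<xi> * X))" .
  qed
  finally show ?thesis .
qed

text \<open>The remaining exchange of \<xi> and \<open>X\<close> is justified by
  \<open>norm_ii_\<Phi>_le\<close>, since \<open>I\<close> has finite measure;
  \<open>h_eq_\<Phi>\<close> then identifies the \<xi>-integral.\<close>

lemma triple_integral_\<phi>_X_kernel:
  "(\<integral>\<xi>. \<integral>r. \<integral>s. \<phi> \<xi> r s * X_kernel I \<xi> r s \<partial>lborel \<partial>lborel \<partial>lborel)
    = 2 * of_real pi * (LBINT X:I. h X)"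
proof -
  have "(\<integral>\<xi>. \<integral>r. \<integral>s. \<phi> \<xi> r s * X_kernel I \<xi> r s \<partial>lborel \<partial>lborel \<partial>lborel)
      = (\<integral>\<xi>. \<integral>X. indicator I X *\<^sub>R (\<i> * of_real \<xi> * \<Phi> \<xi> (\<xi> * X)) \<partial>lborel \<partial>lborel)"
    by (simp only: integral_\<phi>_X_kernel)
  also have "\<dots> = (\<integral>X. \<integral>\<xi>. indicator I X *\<^sub>R (\<i> * of_real \<xi> * \<Phi> \<xi> (\<xi> * X)) \<partial>lborel \<partial>lborel)"
  proof (rule integral_swap_of_product_bound[OF _ _ indicator_integrable])
    show "(\<lambda>x. indicator I (snd x) *\<^sub>R (\<i> * of_real (fst x) * \<Phi> (fst x) (fst x * snd x))) \<in> borel_measurable borel"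
      unfolding borel_prod[symmetric] by measurable
    show "integrable lborel (\<lambda>\<xi>. p.B * q.B * wt \<xi>)" by simp
    show "norm (indicator I X *\<^sub>R (\<i> * of_real \<xi> * \<Phi> \<xi> (\<xi> * X))) \<le> p.B * q.B * wt \<xi> * indicator I X" for \<xi> X
      using norm_ii_\<Phi>_le[of \<xi> "\<xi> * X"] by (simp add: indicator_def)
  qed
  also have "\<dots> = (\<integral>X. 2 * of_real pi * (indicator I X *\<^sub>R h X) \<partial>lborel)"
    unfolding h_eq_\<Phi> by (intro Bochner_Integration.integral_cong) auto
  finally show ?thesis
    unfolding set_lebesgue_integral_def by (simp only: integral_mult_right_zero)
qed

end

end

text \<open>The truncated integral is the part up to \<open>b\<close> minus the part below
  \<open>a\<close>. Each depends on one end point only, so independent limits in \<open>a\<close>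
  and \<open>b\<close> suffice for the product filter.\<close>

lemma tendsto_integral_truncations:
  fixes f :: "real \<Rightarrow> 'a::{banach, second_countable_topology}"
  assumes f: "integrable lborel f" and I[measurable]: "I \<in> sets borel"
  shows "((\<lambda>(a, b). LBINT X:I \<inter> {a..b}. f X) \<longlongrightarrow> (LBINT X:I. f X)) (at_bot \<times>\<^sub>F at_top)"
proof -
  have [measurable]: "f \<in> borel_measurable borel" using f by auto
  define u where "u b = (\<integral>X. indicator (I \<inter> {..b}) X *\<^sub>R f X \<partial>lborel)" for b :: real
  define l where "l a = (\<integral>X. indicator (I \<inter> {..<a}) X *\<^sub>R f X \<partial>lborel)" for a :: real
  have i: "integrable lborel (\<lambda>X. indicator A X *\<^sub>R f X)" if "A \<in> sets borel" for A
    using f that by (intro integrable_mult_indicator) auto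
  have u: "(u \<longlongrightarrow> (LBINT X:I. f X)) at_top"
    unfolding u_def[abs_def] set_lebesgue_integral_def
  proof (rule integral_dominated_convergence_at_top[where w = "\<lambda>X. norm (f X)"])
    show "AE x in lborel. ((\<lambda>b. indicator (I \<inter> {..b}) x *\<^sub>R f x) \<longlongrightarrow> indicator I x *\<^sub>R f x) at_top"
    proof (intro AE_I2 tendsto_eventually)
      show "\<forall>\<^sub>F b in at_top. indicator (I \<inter> {..b}) x *\<^sub>R f x = indicator I x *\<^sub>R f x" for x
        using eventually_ge_at_top[of x] by eventually_elim (simp add: indicator_def)
    qed
  qed (use f in \<open>auto simp: indicator_def\<close>)
  have "((\<lambda>a. l (- a)) \<longlongrightarrow> integral\<^sup>L lborel (\<lambda>_::real. 0 :: 'a)) at_top"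
    unfolding l_def
  proof (rule integral_dominated_convergence_at_top[where w = "\<lambda>X. norm (f X)"])
    show "AE x in lborel. ((\<lambda>a. indicator (I \<inter> {..<- a}) x *\<^sub>R f x) \<longlongrightarrow> 0) at_top"
    proof (intro AE_I2 tendsto_eventually)
      show "\<forall>\<^sub>F a in at_top. indicator (I \<inter> {..<- a}) x *\<^sub>R f x = 0" for x
        using eventually_ge_at_top[of "- x"] by eventually_elim (simp add: indicator_def)
    qed
  qed (use f in \<open>auto simp: indicator_def\<close>)
  then have l: "(l \<longlongrightarrow> 0) at_bot"
    by (simp add: filterlim_at_bot_mirror)
  have "((\<lambda>z. u (snd z) - l (fst z)) \<longlongrightarrow> (LBINT X:I. f X) - 0) (at_bot \<times>\<^sub>F at_top)"
    by (intro tendsto_diff filterlim_compose[OF u filterlim_snd] filterlim_compose[OF l filterlim_fst])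
  then have lim: "((\<lambda>z. u (snd z) - l (fst z)) \<longlongrightarrow> (LBINT X:I. f X)) (at_bot \<times>\<^sub>F at_top)" by simp
  \<comment> \<open>This makes the lower end point at most the upper one, without which the
    difference of the two parts is not the truncated integral.\<close>
  have "\<forall>\<^sub>F z in at_bot \<times>\<^sub>F at_top. fst z \<le> (0::real) \<and> (0::real) \<le> snd z"
    using eventually_prodI[OF eventually_le_at_bot[of "0::real"] eventually_ge_at_top[of "0::real"]] .
  then have "\<forall>\<^sub>F z in at_bot \<times>\<^sub>F at_top. u (snd z) - l (fst z) = (case z of (a, b) \<Rightarrow> LBINT X:I \<inter> {a..b}. f X)"
  proof eventually_elim
    case (elim z)
    have "indicator (I \<inter> {fst z..snd z}) X *\<^sub>R f X =
        indicator (I \<inter> {..snd z}) X *\<^sub>R f X - indicator (I \<inter> {..<fst z}) X *\<^sub>R f X" for X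
      using elim by (auto simp: indicator_def)
    then have "(LBINT X:I \<inter> {fst z..snd z}. f X) = u (snd z) - l (fst z)"
      unfolding set_lebesgue_integral_def u_def l_def by (simp add: i)
    then show ?case by (simp add: case_prod_beta')
  qed
  with lim show ?thesis by (rule Lim_transform_eventually)
qed

text \<open>
  Fourier inversion at \<open>0\<close> of the correlation \<open>\<integral>x. a x * cnj (b (x - t))\<close>, whose Fourier transform is
  \<open>fourier a * cnj (fourier b)\<close>; a jump of \<open>b\<close> is harmless, as the correlation is still continuous.
\<close>

lemma fourier_plancherel:
  fixes a b :: "real \<Rightarrow> complex"
  assumes a: "integrable lborel a" and b: "integrable lborel b" and K: "\<And>x. norm (b x) \<le> K"
    and cont: "AE x in lborel. isCont b x"
    and ab: "integrable lborel (\<lambda>\<eta>. fourier a \<eta> * cnj (fourier b \<eta>))"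
  shows "(\<integral>\<eta>. fourier a \<eta> * cnj (fourier b \<eta>) \<partial>lborel) = 2 * of_real pi * (\<integral>x. a x * cnj (b x) \<partial>lborel)"
proof -
  have [measurable]: "a \<in> borel_measurable borel" "b \<in> borel_measurable borel" using a b by auto
  define k where "k = (\<lambda>x t. a x * cnj (b (x - t)))"
  define c where "c t = (\<integral>x. k x t \<partial>lborel)" for t
  have km: "(\<lambda>x. k (fst x) (snd x)) \<in> borel_measurable borel"
    unfolding k_def borel_prod[symmetric] by measurable
  have k_le: "norm (k x t) \<le> K * norm (a x)" for x t
    unfolding k_def norm_mult complex_mod_cnj using mult_right_mono[OF K, of "norm (a x)" "x - t"]
    by (simp add: mult.commute)
  have bi: "integrable lborel (\<lambda>t. b (x - t))" for x using b by (rule integrable_translate)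
  have kp: "integrable (lborel \<Otimes>\<^sub>M lborel) (\<lambda>(x, t). k x t)"
  proof (rule integrable_pair_of_integral_bound[OF km])
    show "integrable lborel (\<lambda>x. norm (a x) * (\<integral>t. norm (b t) \<partial>lborel))" using a by auto
    show "integrable lborel (k x)" for x unfolding k_def using bi by auto
    show "(\<integral>t. norm (k x t) \<partial>lborel) \<le> norm (a x) * (\<integral>t. norm (b t) \<partial>lborel)" for x
      unfolding k_def using integral_translate(3)[of "\<lambda>t. norm (b t)" x] by (simp add: norm_mult)
  qed
  have ci: "integrable lborel c"
    unfolding c_def[abs_def] using kp by (rule lborel_pair.integrable_snd)
  have c_le: "norm (c t) \<le> (\<integral>x. K * norm (a x) \<partial>lborel)" for t
    unfolding c_def using a by (intro norm_integral_le k_le) auto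
  have c0: "isCont c 0"
    unfolding isCont_def c_def
  proof (rule tendsto_integral_at_within)
    show "integrable lborel (\<lambda>x. K * norm (a x))" using a by auto
    show "AE x in lborel. ((\<lambda>t. k x t) \<longlongrightarrow> k x 0) (at 0)"
      using cont
    proof eventually_elim
      case (elim x)
      have "((\<lambda>t. b (x - t)) \<longlongrightarrow> b x) (at 0)"
        using elim by (rule isCont_tendsto_compose) (auto intro!: tendsto_eq_intros)
      then show ?case unfolding k_def by (auto intro!: tendsto_intros)
    qed
  qed (use k_le in \<open>auto simp: k_def\<close>)
  have fc: "fourier c \<eta> = fourier a \<eta> * cnj (fourier b \<eta>)" for \<eta>
  proof -
    define e where "e x = exp (- (\<i> * of_real x * of_real \<eta>))" for x
    have ne: "norm (e x) = 1" for x by (simp add: e_def)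
    have [measurable]: "e \<in> borel_measurable borel" unfolding e_def by measurable
    \<comment> \<open>Splitting the character at \<open>x\<close> and \<open>x - t\<close> is what
      factors the transform of the correlation.\<close>
    have ee: "e t = e x * cnj (e (x - t))" for x t
      unfolding e_def exp_cnj by (simp add: algebra_simps flip: exp_add)
    have p: "integrable (lborel \<Otimes>\<^sub>M lborel) (\<lambda>(x, t). e t * k x t)"
      using integrable_norm[OF kp]
    proof (rule integrable_le)
      show "(\<lambda>(x, t). e t * k x t) \<in> borel_measurable (lborel \<Otimes>\<^sub>M lborel)"
        unfolding k_def by measurable
    qed (auto simp: norm_mult ne)
    have "fourier c \<eta> = (\<integral>t. \<integral>x. e t * k x t \<partial>lborel \<partial>lborel)"
      unfolding fourier_def c_def e_def by simp
    also have "\<dots> = (\<integral>x. \<integral>t. e t * k x t \<partial>lborel \<partial>lborel)"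
      by (rule integral_pair_swap[OF p, symmetric])
    also have "\<dots> = (\<integral>x. e x * a x * cnj (fourier b \<eta>) \<partial>lborel)"
    proof (rule Bochner_Integration.integral_cong[OF refl])
      fix x
      have "(\<integral>t. e t * k x t \<partial>lborel) = (\<integral>t. e x * a x * cnj (e (x - t) * b (x - t)) \<partial>lborel)"
      proof (rule Bochner_Integration.integral_cong[OF refl])
        show "e t * k x t = e x * a x * cnj (e (x - t) * b (x - t))" for t
          unfolding k_def by (subst ee[of t x]) simp
      qed
      also have "\<dots> = e x * a x * (\<integral>t. cnj (e (x - t) * b (x - t)) \<partial>lborel)"
        by (simp only: integral_mult_right_zero)
      also have "(\<integral>t. cnj (e (x - t) * b (x - t)) \<partial>lborel) = (\<integral>t. cnj (e t * b t) \<partial>lborel)"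
        by (rule integral_translate(3))
      also have "\<dots> = cnj (fourier b \<eta>)"
        unfolding fourier_def e_def by (rule Bochner_Integration.integral_cnj)
      finally show "(\<integral>t. e t * k x t \<partial>lborel) = e x * a x * cnj (fourier b \<eta>)" .
    qed
    finally show ?thesis by (simp add: fourier_def e_def)
  qed
  have "integrable lborel (fourier c)" using ab by (simp add: fc[abs_def])
  from fourier_inversion[OF ci c_le c0 this]
  have "(\<integral>\<eta>. fourier c \<eta> \<partial>lborel) = 2 * of_real pi * c 0" by simp
  then show ?thesis by (simp add: fc c_def k_def)
qed

section \<open>The flux through all levels and the Hilbert transform\<close>

context half_plane_decay
begin

lemma ch_eq_0: "r < rp \<Longrightarrow> ch j k \<xi> r = 0"
  by (simp add: ch_def fourier_def c_eq_0)

text \<open>Away from the edge the zero extension agrees near \<open>r\<close> either with a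
  differentiable function or with 0. Continuity almost everywhere is what
  \<open>fourier_plancherel\<close> asks for.\<close>

lemma c_isCont_r:
  assumes "r \<noteq> rp" shows "isCont (\<lambda>s. c j k u s) r"
proof (cases "rp < r")
  case True
  have "continuous (at r within {rp..}) (\<lambda>s. D j k u s)"
    using dr[of r j k u] True by (intro has_vector_derivative_continuous) auto
  moreover have "at r within {rp..} = at r"
    using True by (intro at_within_interior) (simp add: interior_Ici[of "rp - 1"])
  ultimately have "isCont (\<lambda>s. D j k u s) r" by simp
  moreover have "\<forall>\<^sub>F s in nhds r. D j k u s = c j k u s"
    using eventually_nhds_in_open[of "{rp<..}" r] True
    by (auto elim!: eventually_mono simp: c_eq)
  ultimately show ?thesis using isCont_cong by blast
next
  case False
  then have "\<forall>\<^sub>F s in nhds r. c j k u s = 0"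
    using assms eventually_nhds_in_open[of "{..<rp}" r]
    by (auto elim!: eventually_mono simp: c_eq_0)
  then show ?thesis using isCont_cong[of "\<lambda>s. c j k u s" "\<lambda>s. 0" r] by simp
qed

lemma ch_isCont_r:
  assumes "r \<noteq> rp" shows "isCont (\<lambda>s. ch j k \<xi> s) r"
  unfolding ch_def fourier_def isCont_def
proof (rule tendsto_integral_at_within)
  show "integrable lborel (\<lambda>u. K j k * wt u)" by simp
  show "AE u in lborel. ((\<lambda>s. exp (- (\<i> * of_real u * of_real \<xi>)) * c j k u s) \<longlongrightarrow>
      exp (- (\<i> * of_real u * of_real \<xi>)) * c j k u r) (at r)"
    using c_isCont_r[OF assms] by (auto simp: isCont_def intro!: tendsto_intros)
qed (use norm_c_le_u in \<open>auto simp: norm_mult\<close>)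

lemma F_eq_fourier: "F j \<xi> \<eta> = fourier (\<lambda>r. ch j 0 \<xi> r) (- \<eta>)"
  unfolding F_def fourier_def by (intro Bochner_Integration.integral_cong) (auto simp: ac_simps)

definition Hc :: "real \<Rightarrow> real \<Rightarrow> complex" where
  "Hc u r = hilbert (\<lambda>v. c 0 0 v r) u"

lemma Hc_eq: "Hc u r = 1 / (2 * of_real pi) *
    (\<integral>\<xi>. exp (\<i> * of_real u * of_real \<xi>) * (- \<i> * of_real (sgn \<xi>) * ch 0 0 \<xi> r) \<partial>lborel)"
  by (simp add: Hc_def hilbert_def ch_def)

lemma Hc_measurable [measurable (raw)]:
  assumes [measurable]: "f \<in> borel_measurable M" "g \<in> borel_measurable M"
  shows "(\<lambda>x. Hc (f x) (g x)) \<in> borel_measurable M"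
  unfolding Hc_eq by measurable

lemma norm_Hc_le: "norm (Hc u r) \<le> A * integral\<^sup>L lborel wt * wt r"
proof -
  have "norm (\<integral>\<xi>. exp (\<i> * of_real u * of_real \<xi>) * (- \<i> * of_real (sgn \<xi>) * ch 0 0 \<xi> r) \<partial>lborel)
      \<le> (\<integral>\<xi>. A * (wt \<xi> * wt r) \<partial>lborel)"
  proof (rule norm_integral_le)
    fix \<xi>
    have "norm (exp (\<i> * of_real u * of_real \<xi>) * (- \<i> * of_real (sgn \<xi>) * ch 0 0 \<xi> r)) \<le> norm (ch 0 0 \<xi> r)"
      by (auto simp: norm_mult sgn_if)
    also have "\<dots> \<le> A * (wt \<xi> * wt r)" by (rule norm_ch_le_wt')
    finally show "norm (exp (\<i> * of_real u * of_real \<xi>) * (- \<i> * of_real (sgn \<xi>) * ch 0 0 \<xi> r)) \<le> A * (wt \<xi> * wt r)" .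
  qed simp
  also have "\<dots> = A * integral\<^sup>L lborel wt * wt r" by simp
  finally have "norm (Hc u r) \<le> 1 / (2 * pi) * (A * integral\<^sup>L lborel wt * wt r)"
    unfolding Hc_eq norm_mult by (simp add: norm_divide divide_right_mono)
  also have "\<dots> \<le> 1 * (A * integral\<^sup>L lborel wt * wt r)"
    using A_nonneg pi_ge_two by (intro mult_right_mono mult_nonneg_nonneg integral_nonneg_AE) auto
  finally show ?thesis by simp
qed

end

context half_plane_pair
begin

text \<open>For fixed \<xi> the function \<open>\<Phi>\<close> is a product of transforms in
  \<open>r\<close>, taken at \<open>- \<eta>\<close>, of functions whose only possible jump is at
  \<open>rp\<close>.\<close>

lemma \<Phi>_plancherel:
  assumes "\<xi> \<noteq> 0"
  shows "(\<integral>\<eta>. \<Phi> \<xi> \<eta> \<partial>lborel) = 2 * of_real pi * (\<integral>r. \<phi> \<xi> r r \<partial>lborel)"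
proof -
  let ?f = "\<lambda>\<eta>. fourier (\<lambda>r. p.ch 0 0 \<xi> r) \<eta> * cnj (fourier (\<lambda>r. q.ch 0 0 \<xi> r) \<eta>)"
  \<comment> \<open>The reflection is written \<open>0 - \<eta>\<close> to match
    \<open>integral_translate(3)\<close>; it leaves the integral unchanged.\<close>
  have \<Phi>: "\<Phi> \<xi> \<eta> = ?f (0 - \<eta>)" for \<eta> by (simp add: \<Phi>_def p.F_eq_fourier q.F_eq_fourier)
  have "integrable lborel (\<lambda>\<eta>. \<Phi> \<xi> \<eta>)"
  proof (rule integrable_le)
    show "integrable lborel (\<lambda>\<eta>. 2 * (p.B * q.B) * ((wt \<xi>)\<^sup>2 * wt \<eta>))" by simp
  qed (use norm_\<Phi>_le'[OF assms] in auto)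
  from integrable_translate(3)[OF this, of 0] have i: "integrable lborel ?f" by (simp add: \<Phi>)
  have "(\<integral>\<eta>. \<Phi> \<xi> \<eta> \<partial>lborel) = integral\<^sup>L lborel ?f"
    unfolding \<Phi> by (rule integral_translate(3))
  also have "\<dots> = 2 * of_real pi * (\<integral>r. p.ch 0 0 \<xi> r * cnj (q.ch 0 0 \<xi> r) \<partial>lborel)"
  proof (rule fourier_plancherel[OF p.ch_integrable_r q.ch_integrable_r _ _ i])
    show "norm (q.ch 0 0 \<xi> r) \<le> q.A" for r
    proof -
      have "q.A * (wt \<xi> * wt r) \<le> q.A * 1"
        by (intro mult_left_mono q.A_nonneg mult_le_one) auto
      then show ?thesis using q.norm_ch_le_wt'[of \<xi> r] by linarith
    qed
    show "AE r in lborel. isCont (\<lambda>r. q.ch 0 0 \<xi> r) r"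
      using AE_lborel_singleton[of rp] by eventually_elim (rule q.ch_isCont_r)
  qed
  finally show ?thesis by (simp add: \<phi>_def)
qed

text \<open>For nonzero \<xi> the \<open>X\<close>-integral of
  \<open>\<bar>\<xi>\<bar> * wt (\<xi> * X)\<close> does not depend on \<xi>, while
  \<open>(wt \<xi>)\<^sup>2\<close> remains, so Fubini applies. The substitution
  \<open>\<eta> = \<xi> * X\<close> consumes \<open>\<bar>\<xi>\<bar>\<close> and leaves
  \<open>sgn \<xi>\<close>; at \<open>\<xi> = 0\<close> both sides vanish.\<close>

lemma integral_h_eq_\<phi>:
  "(\<integral>X. h X \<partial>lborel) = (\<integral>\<xi>. \<i> * of_real (sgn \<xi>) * (\<integral>r. \<phi> \<xi> r r \<partial>lborel) \<partial>lborel)"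
proof -
  have aff: "\<bar>\<xi>\<bar> * (\<integral>X. f (\<xi> * X) \<partial>lborel) = integral\<^sup>L lborel f" if "\<xi> \<noteq> 0" for \<xi> and f :: "real \<Rightarrow> real"
    using lborel_integral_real_affine[OF that, of f 0] by simp
  have wi: "integrable lborel (\<lambda>X. wt (\<xi> * X))" if "\<xi> \<noteq> 0" for \<xi>
    using lborel_integrable_real_affine[OF wt_integrable that, of 0] by simp
  have le: "norm (\<i> * of_real \<xi> * \<Phi> \<xi> (\<xi> * X)) \<le> 2 * (p.B * q.B) * (wt \<xi>)\<^sup>2 * (\<bar>\<xi>\<bar> * wt (\<xi> * X))"
    if "\<xi> \<noteq> 0" for \<xi> X
    using mult_left_mono[OF norm_\<Phi>_le'[OF that, of "\<xi> * X"], of "\<bar>\<xi>\<bar>"] by (simp add: norm_mult ac_simps)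
  have i: "integrable lborel (\<lambda>X. \<i> * of_real \<xi> * \<Phi> \<xi> (\<xi> * X))" for \<xi>
  proof (cases "\<xi> = 0")
    case False
    have "integrable lborel (\<lambda>X. 2 * (p.B * q.B) * (wt \<xi>)\<^sup>2 * (\<bar>\<xi>\<bar> * wt (\<xi> * X)))"
      using wi[OF False] by simp
    then show ?thesis by (rule integrable_le) (use le[OF False] in auto)
  qed simp
  have "integrable (lborel \<Otimes>\<^sub>M lborel) (\<lambda>(\<xi>, X). \<i> * of_real \<xi> * \<Phi> \<xi> (\<xi> * X))"
  proof (rule integrable_pair_of_integral_bound[OF _ _ i])
    show "(\<lambda>x. \<i> * of_real (fst x) * \<Phi> (fst x) (fst x * snd x)) \<in> borel_measurable borel"
      unfolding borel_prod[symmetric] by measurable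
    show "integrable lborel (\<lambda>\<xi>. 2 * (p.B * q.B) * integral\<^sup>L lborel wt * wt \<xi>)" by simp
    show "(\<integral>X. norm (\<i> * of_real \<xi> * \<Phi> \<xi> (\<xi> * X)) \<partial>lborel) \<le> 2 * (p.B * q.B) * integral\<^sup>L lborel wt * wt \<xi>" for \<xi>
    proof (cases "\<xi> = 0")
      case True
      then show ?thesis using p.B_nonneg q.B_nonneg by (simp add: integral_nonneg_AE)
    next
      case False
      have "(\<integral>X. norm (\<i> * of_real \<xi> * \<Phi> \<xi> (\<xi> * X)) \<partial>lborel)
          \<le> (\<integral>X. 2 * (p.B * q.B) * (wt \<xi>)\<^sup>2 * (\<bar>\<xi>\<bar> * wt (\<xi> * X)) \<partial>lborel)"
        using i wi[OF False] le[OF False] by (intro integral_mono) auto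
      also have "\<dots> = 2 * (p.B * q.B) * (wt \<xi>)\<^sup>2 * integral\<^sup>L lborel wt"
        using aff[OF False, of wt] by (simp add: mult.assoc)
      also have "\<dots> \<le> 2 * (p.B * q.B) * wt \<xi> * integral\<^sup>L lborel wt"
        using p.B_nonneg q.B_nonneg
        by (intro mult_right_mono mult_left_mono) (auto simp: power2_eq_square mult_left_le integral_nonneg_AE)
      finally show ?thesis by (simp add: ac_simps)
    qed
  qed
  from integral_pair_swap[OF this]
  have "(\<integral>X. h X \<partial>lborel) = 1 / (2 * of_real pi) * (\<integral>\<xi>. \<integral>X. \<i> * of_real \<xi> * \<Phi> \<xi> (\<xi> * X) \<partial>lborel \<partial>lborel)"
    unfolding h_eq_\<Phi> by (simp only: integral_mult_right_zero)
  also have "(\<integral>\<xi>. \<integral>X. \<i> * of_real \<xi> * \<Phi> \<xi> (\<xi> * X) \<partial>lborel \<partial>lborel)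
      = (\<integral>\<xi>. 2 * of_real pi * (\<i> * of_real (sgn \<xi>) * (\<integral>r. \<phi> \<xi> r r \<partial>lborel)) \<partial>lborel)"
  proof (rule Bochner_Integration.integral_cong[OF refl])
    fix \<xi> :: real
    show "(\<integral>X. \<i> * of_real \<xi> * \<Phi> \<xi> (\<xi> * X) \<partial>lborel) = 2 * of_real pi * (\<i> * of_real (sgn \<xi>) * (\<integral>r. \<phi> \<xi> r r \<partial>lborel))"
    proof (cases "\<xi> = 0")
      case False
      have "\<i> * complex_of_real \<xi> = \<i> * of_real (sgn \<xi> * \<bar>\<xi>\<bar>)" by (simp only: sgn_mult_abs)
      then have "(\<integral>X. \<i> * of_real \<xi> * \<Phi> \<xi> (\<xi> * X) \<partial>lborel) =
          \<i> * of_real (sgn \<xi> * \<bar>\<xi>\<bar>) * (\<integral>X. \<Phi> \<xi> (0 + \<xi> * X) \<partial>lborel)"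
        by (simp only: integral_mult_right_zero add_0)
      also have "\<dots> = \<i> * of_real (sgn \<xi>) * (\<bar>\<xi>\<bar> *\<^sub>R (\<integral>X. \<Phi> \<xi> (0 + \<xi> * X) \<partial>lborel))"
        by (simp only: scaleR_conv_of_real of_real_mult mult.assoc)
      also have "\<bar>\<xi>\<bar> *\<^sub>R (\<integral>X. \<Phi> \<xi> (0 + \<xi> * X) \<partial>lborel) = (\<integral>\<eta>. \<Phi> \<xi> \<eta> \<partial>lborel)"
        by (rule lborel_integral_real_affine[OF False, symmetric])
      also have "\<dots> = 2 * of_real pi * (\<integral>r. \<phi> \<xi> r r \<partial>lborel)" by (rule \<Phi>_plancherel[OF False])
      finally show ?thesis by (simp only: mult.left_commute)
    qed simp
  qed
  also have "1 / (2 * of_real pi) * \<dots> = (\<integral>\<xi>. \<i> * of_real (sgn \<xi>) * (\<integral>r. \<phi> \<xi> r r \<partial>lborel) \<partial>lborel)"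
    by (subst integral_mult_right_zero) simp
  finally show ?thesis .
qed

lemma c_Hc_integrable: "integrable lborel (\<lambda>(u, r). p.c 0 0 u r * cnj (q.Hc u r))"
  unfolding lborel_prod[symmetric]
proof (rule integrable_pair_of_product_bound)
  show "(\<lambda>x. p.c 0 0 (fst x) (snd x) * cnj (q.Hc (fst x) (snd x))) \<in> borel_measurable borel"
    unfolding borel_prod[symmetric] by measurable
  show "integrable lborel (\<lambda>u. p.K 0 0 * wt u)" "integrable lborel (\<lambda>r. q.A * integral\<^sup>L lborel wt * wt r)"
    by auto
  show "norm (p.c 0 0 u r * cnj (q.Hc u r)) \<le> p.K 0 0 * wt u * (q.A * integral\<^sup>L lborel wt * wt r)" for u r
    unfolding norm_mult complex_mod_cnj
    by (intro mult_mono p.norm_c_le_u q.norm_Hc_le mult_nonneg_nonneg p.K_nonneg) auto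
qed

text \<open>The symbol \<open>\<i> * sgn \<xi>\<close> is the conjugate of the symbol of the Hilbert
  transform and is therefore moved onto the second factor. For each \<open>r\<close>,
  \<open>fourier_multiplication\<close> returns from \<xi> to \<open>u\<close>.\<close>

lemma integral_h_eq_hilbert:
  "(\<integral>X. h X \<partial>lborel) = 2 * of_real pi * (\<integral>u. \<integral>r. p.c 0 0 u r * cnj (q.Hc u r) \<partial>lborel \<partial>lborel)"
proof -
  define m where "m \<xi> = - \<i> * complex_of_real (sgn \<xi>)" for \<xi>
  have [measurable]: "m \<in> borel_measurable borel" unfolding m_def by measurable
  have m: "norm (m \<xi>) \<le> 1" for \<xi> by (simp add: m_def norm_mult sgn_if)
  have cm: "\<i> * complex_of_real (sgn \<xi>) = cnj (m \<xi>)" for \<xi> by (simp add: m_def)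
  have "(\<integral>X. h X \<partial>lborel) = (\<integral>\<xi>. \<integral>r. p.ch 0 0 \<xi> r * cnj (m \<xi> * q.ch 0 0 \<xi> r) \<partial>lborel \<partial>lborel)"
    unfolding integral_h_eq_\<phi> cm
  proof (rule Bochner_Integration.integral_cong[OF refl])
    fix \<xi>
    have "p.ch 0 0 \<xi> r * cnj (m \<xi> * q.ch 0 0 \<xi> r) = cnj (m \<xi>) * \<phi> \<xi> r r" for r
      by (simp add: \<phi>_def)
    then show "cnj (m \<xi>) * (\<integral>r. \<phi> \<xi> r r \<partial>lborel) = (\<integral>r. p.ch 0 0 \<xi> r * cnj (m \<xi> * q.ch 0 0 \<xi> r) \<partial>lborel)"
      by (simp only: integral_mult_right_zero)
  qed
  also have "\<dots> = (\<integral>r. \<integral>\<xi>. p.ch 0 0 \<xi> r * cnj (m \<xi> * q.ch 0 0 \<xi> r) \<partial>lborel \<partial>lborel)"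
  proof (rule integral_swap_of_product_bound)
    show "(\<lambda>x. p.ch 0 0 (fst x) (snd x) * cnj (m (fst x) * q.ch 0 0 (fst x) (snd x))) \<in> borel_measurable borel"
      unfolding borel_prod[symmetric] by measurable
    show "integrable lborel (\<lambda>\<xi>. p.A * q.A * wt \<xi>)" "integrable lborel wt" by auto
    show "norm (p.ch 0 0 \<xi> r * cnj (m \<xi> * q.ch 0 0 \<xi> r)) \<le> p.A * q.A * wt \<xi> * wt r" for \<xi> r
    proof -
      have "norm (p.ch 0 0 \<xi> r) * (norm (m \<xi>) * norm (q.ch 0 0 \<xi> r)) \<le> (p.A * (wt \<xi> * wt r)) * (1 * (q.A * 1))"
      proof (intro mult_mono p.norm_ch_le_wt' m mult_nonneg_nonneg p.A_nonneg q.A_nonneg)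
        have "q.A * (wt \<xi> * wt r) \<le> q.A * 1"
          by (intro mult_left_mono q.A_nonneg mult_le_one) auto
        then show "norm (q.ch 0 0 \<xi> r) \<le> q.A * 1" using q.norm_ch_le_wt'[of \<xi> r] by linarith
      qed (auto simp: q.A_nonneg)
      then show ?thesis by (simp add: norm_mult ac_simps)
    qed
  qed
  also have "\<dots> = (\<integral>r. 2 * of_real pi * (\<integral>u. p.c 0 0 u r * cnj (q.Hc u r) \<partial>lborel) \<partial>lborel)"
  proof (rule Bochner_Integration.integral_cong[OF refl])
    fix r
    have mi: "integrable lborel (\<lambda>\<xi>. m \<xi> * q.ch 0 0 \<xi> r)"
      using integrable_norm[OF q.ch_integrable[of r]]
      by (rule integrable_le) (auto simp: norm_mult intro!: mult_left_le_one_le m)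
    have Hc: "2 * of_real pi * q.Hc u r = (\<integral>\<xi>. exp (\<i> * of_real u * of_real \<xi>) * (m \<xi> * q.ch 0 0 \<xi> r) \<partial>lborel)" for u
      unfolding q.Hc_eq m_def by simp
    have "(\<integral>\<xi>. p.ch 0 0 \<xi> r * cnj (m \<xi> * q.ch 0 0 \<xi> r) \<partial>lborel)
        = (\<integral>u. p.c 0 0 u r * cnj (2 * of_real pi * q.Hc u r) \<partial>lborel)"
      unfolding Hc p.ch_def by (rule fourier_multiplication[OF p.c_integrable_u mi, symmetric])
    also have "\<dots> = (\<integral>u. 2 * of_real pi * (p.c 0 0 u r * cnj (q.Hc u r)) \<partial>lborel)"
      by (rule Bochner_Integration.integral_cong) auto
    finally show "(\<integral>\<xi>. p.ch 0 0 \<xi> r * cnj (m \<xi> * q.ch 0 0 \<xi> r) \<partial>lborel)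
        = 2 * of_real pi * (\<integral>u. p.c 0 0 u r * cnj (q.Hc u r) \<partial>lborel)"
      by (simp only: integral_mult_right_zero)
  qed
  also have "\<dots> = 2 * of_real pi * (\<integral>r. \<integral>u. p.c 0 0 u r * cnj (q.Hc u r) \<partial>lborel \<partial>lborel)"
    by (simp only: integral_mult_right_zero)
  also have "(\<integral>r. \<integral>u. p.c 0 0 u r * cnj (q.Hc u r) \<partial>lborel \<partial>lborel) = (\<integral>u. \<integral>r. p.c 0 0 u r * cnj (q.Hc u r) \<partial>lborel \<partial>lborel)"
    by (rule integral_pair_swap[symmetric]) (use c_Hc_integrable in \<open>simp add: lborel_prod\<close>)
  finally show ?thesis .
qed

end

section \<open>Null diagonal, exhausting limits and majorants for the principal values\<close>

lemma AE_lborel_off_diagonal: "AE x in lborel. fst x \<noteq> (snd x :: real)"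
proof -
  have "AE x in lborel \<Otimes>\<^sub>M lborel. fst x \<noteq> (snd x :: real)"
  proof (rule lborel_pair.AE_pair_measure)
    show "{x \<in> space (lborel \<Otimes>\<^sub>M lborel). fst x \<noteq> (snd x :: real)} \<in> sets (lborel \<Otimes>\<^sub>M lborel)"
      by measurable
    show "AE x in lborel. AE y in lborel. fst (x, y) \<noteq> (snd (x, y) :: real)"
    proof (rule AE_I2)
      show "AE y in lborel. fst (x, y) \<noteq> (snd (x, y) :: real)" for x :: real
        using AE_lborel_singleton[of x] by eventually_elim auto
    qed
  qed
  then show ?thesis by (simp only: lborel_prod)
qed

lemma tendsto_set_integral_at_top:
  fixes f :: "real \<Rightarrow> 'a::{banach, second_countable_topology}"
  assumes f: "integrable lborel f" and A: "\<And>Y. A Y \<in> sets borel" and B: "B \<in> sets borel"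
    and ev: "\<And>x. \<forall>\<^sub>F Y in at_top. x \<in> A Y \<longleftrightarrow> x \<in> B"
  shows "((\<lambda>Y::real. LBINT X:A Y. f X) \<longlongrightarrow> (LBINT X:B. f X)) at_top"
  unfolding set_lebesgue_integral_def
proof (rule integral_dominated_convergence_at_top[where w = "\<lambda>X. norm (f X)"])
  have [measurable]: "f \<in> borel_measurable borel" using f by auto
  show "(\<lambda>x. indicator B x *\<^sub>R f x) \<in> borel_measurable lborel"
    "(\<lambda>x. indicator (A Y) x *\<^sub>R f x) \<in> borel_measurable lborel" for Y
    using A B by (auto intro!: borel_measurable_scaleR borel_measurable_indicator)
  show "AE x in lborel. ((\<lambda>Y. indicator (A Y) x *\<^sub>R f x) \<longlongrightarrow> indicator B x *\<^sub>R f x) at_top"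
  proof (intro AE_I2 tendsto_eventually)
    show "\<forall>\<^sub>F Y in at_top. indicator (A Y) x *\<^sub>R f x = indicator B x *\<^sub>R f x" for x
      using ev[of x] by eventually_elim (auto simp: indicator_def)
  qed
qed (use f in \<open>auto simp: indicator_def\<close>)

lemma wt_integrable_pair:
  assumes "integrable lborel f"
  shows "integrable lborel (\<lambda>x. f (fst x) * wt (snd x))"
proof -
  have [measurable]: "f \<in> borel_measurable borel" using assms by auto
  have "integrable (lborel \<Otimes>\<^sub>M lborel) (\<lambda>(r, s). f r * wt s)"
  proof (rule integrable_pair_of_product_bound[where g = "\<lambda>r. norm (f r)" and k = wt])
    show "(\<lambda>x. f (fst x) * wt (snd x)) \<in> borel_measurable borel"
      unfolding borel_prod[symmetric] by measurable
  qed (use assms in \<open>auto simp: abs_mult\<close>)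
  then show ?thesis by (simp add: lborel_prod case_prod_beta')
qed

lemma wt_integrable_triple':
  assumes "integrable lborel f"
  shows "integrable (lborel \<Otimes>\<^sub>M lborel) (\<lambda>(u, x). f u * (wt (fst x) * wt (snd x)))"
proof (rule integrable_pair_of_product_bound[where g = "\<lambda>r. norm (f r)" and k = "\<lambda>x. wt (fst x) * wt (snd x)"])
  have [measurable]: "f \<in> borel_measurable borel" using assms by auto
  show "(\<lambda>x. f (fst x) * (wt (fst (snd x)) * wt (snd (snd x)))) \<in> borel_measurable borel"
    unfolding borel_prod[symmetric] by measurable
qed (use assms wt_integrable_pair[OF wt_integrable] in \<open>auto simp: abs_mult\<close>)

lemma (in half_plane_decay) c_lipschitz:
  assumes "rp \<le> r" "rp \<le> s"
  shows "norm (c j k u r - c j k u s) \<le> K j (Suc k) * wt u * \<bar>r - s\<bar>"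
proof -
  have "norm (D j k u r - D j k u s) \<le> K j (Suc k) * wt u * \<bar>r - s\<bar>"
  proof (rule has_vector_derivative_bound[of "{rp..}"])
    show "((\<lambda>s. D j k u s) has_vector_derivative D j (Suc k) u x) (at x within {rp..})" if "x \<in> {rp..}" for x
      using that by (intro dr) simp
    show "norm (D j (Suc k) u x) \<le> K j (Suc k) * wt u" if "x \<in> {rp..}" for x
      using that norm_c_le_u[of j "Suc k" u x] by (simp add: c_eq)
  qed (use assms in auto)
  then show ?thesis using assms by (simp add: c_eq)
qed

context half_plane_pair
begin

section \<open>Principal values\<close>

text \<open>
  Integrating the truncated integrand of the principal value in \<open>u\<close> first leaves
  \<open>C r s (b * (s - r)) / (r - s)\<close>.
\<close>

definition C :: "real \<Rightarrow> real \<Rightarrow> real \<Rightarrow> complex" where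
  "C r s t = (\<integral>u. p.c 0 0 u r * cnj (q.c 0 0 (u + t) s) \<partial>lborel)"

lemma C_measurable [measurable (raw)]:
  assumes [measurable]: "a \<in> borel_measurable M" "b \<in> borel_measurable M" "d \<in> borel_measurable M"
  shows "(\<lambda>x. C (a x) (b x) (d x)) \<in> borel_measurable M"
  unfolding C_def by measurable

lemma C_integrand_integrable: "integrable lborel (\<lambda>u. p.c 0 0 u r * cnj (q.c 0 0 (u + t) s))"
proof (rule integrable_le)
  show "integrable lborel (\<lambda>u. (p.K 0 0 * wt u) * q.K 0 0)" by simp
  show "norm (p.c 0 0 u r * cnj (q.c 0 0 (u + t) s)) \<le> (p.K 0 0 * wt u) * q.K 0 0" for u
  proof -
    have "q.K 0 0 * wt (u + t) \<le> q.K 0 0" by (intro mult_left_le q.K_nonneg) auto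
    then have "norm (q.c 0 0 (u + t) s) \<le> q.K 0 0" using q.norm_c_le_u[of 0 0 "u + t" s] by linarith
    then show ?thesis unfolding norm_mult complex_mod_cnj
      by (intro mult_mono p.norm_c_le_u mult_nonneg_nonneg p.K_nonneg) auto
  qed
qed measurable

lemma norm_C_le: "norm (C r s t) \<le> p.K 0 0 * q.K 0 0 * integral\<^sup>L lborel wt * (wt r * wt s)"
proof -
  have "norm (C r s t) \<le> (\<integral>u. (p.K 0 0 * (wt u * wt r)) * (q.K 0 0 * wt s) \<partial>lborel)"
    unfolding C_def
  proof (rule norm_integral_le)
    show "norm (p.c 0 0 u r * cnj (q.c 0 0 (u + t) s)) \<le> (p.K 0 0 * (wt u * wt r)) * (q.K 0 0 * wt s)" for u
      unfolding norm_mult complex_mod_cnj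
      by (intro mult_mono p.norm_c_le' q.norm_c_le_r mult_nonneg_nonneg p.K_nonneg) auto
  qed simp
  then show ?thesis by (simp add: ac_simps)
qed

text \<open>Parseval in \<open>u\<close>; the shift by \<open>t\<close> becomes a phase. This links
  the principal values to the kernel formula.\<close>

lemma C_eq_\<phi>: "C r s t = 1 / (2 * of_real pi) * (\<integral>\<xi>. \<phi> \<xi> r s * exp (- (\<i> * of_real t * of_real \<xi>)) \<partial>lborel)"
proof -
  have F: "fourier (\<lambda>u. q.c 0 0 (u + t) s) \<xi> = exp (\<i> * of_real t * of_real \<xi>) * q.ch 0 0 \<xi> s" for \<xi>
    unfolding q.ch_def by (rule fourier_translate)
  have "C r s t = 1 / (2 * of_real pi) *
      (\<integral>\<xi>. fourier (\<lambda>u. p.c 0 0 u r) \<xi> * cnj (fourier (\<lambda>u. q.c 0 0 (u + t) s) \<xi>) \<partial>lborel)"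
    unfolding C_def
  proof (rule fourier_parseval[OF p.c_integrable_u integrable_translate(1)[OF q.c_integrable_u]])
    show "norm (q.c 0 0 (x + t) s) \<le> q.K 0 0 * wt s" for x by (rule q.norm_c_le_r)
    show "continuous_on UNIV (\<lambda>u. q.c 0 0 (u + t) s)"
      by (intro continuous_on_compose2[OF q.c_continuous_u] continuous_intros) auto
    show "integrable lborel (fourier (\<lambda>u. q.c 0 0 (u + t) s))"
      unfolding F[abs_def] using integrable_norm[OF q.ch_integrable[of s]]
      by (rule integrable_le) (auto simp: norm_mult)
  qed
  then show ?thesis
    unfolding F by (simp add: \<phi>_def p.ch_def exp_cnj ac_simps)
qed

definition pv_integrand :: "real \<Rightarrow> real \<Rightarrow> real \<times> real \<Rightarrow> complex" where
  "pv_integrand \<epsilon> b x = indicator {x. \<epsilon> < \<bar>fst x - snd x\<bar>} x *\<^sub>R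
     (C (fst x) (snd x) (b * (snd x - fst x)) / of_real (fst x - snd x))"

definition Pv :: "real \<Rightarrow> real \<Rightarrow> complex" where
  "Pv \<epsilon> b = (\<integral>x. pv_integrand \<epsilon> b x \<partial>lborel)"

lemma pv_integrand_measurable [measurable]: "pv_integrand \<epsilon> b \<in> borel_measurable borel"
  unfolding pv_integrand_def[abs_def] borel_prod[symmetric] by measurable

lemma norm_div_le:
  assumes "\<epsilon> > 0" "\<epsilon> < \<bar>d\<bar>" "norm (z :: complex) \<le> k"
  shows "norm (z / of_real d) \<le> inverse \<epsilon> * k"
proof -
  have "inverse \<bar>d\<bar> \<le> inverse \<epsilon>" using assms by (intro le_imp_inverse_le) auto
  then have "inverse \<bar>d\<bar> * norm z \<le> inverse \<epsilon> * k" using assms by (intro mult_mono) auto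
  then show ?thesis unfolding norm_divide norm_of_real by (simp add: divide_inverse mult.commute)
qed

lemma pv_integrand_integrable:
  assumes \<epsilon>: "0 < \<epsilon>"
  shows "integrable lborel (pv_integrand \<epsilon> b)"
proof (rule integrable_le)
  let ?k = "\<lambda>x. inverse \<epsilon> * (p.K 0 0 * q.K 0 0 * integral\<^sup>L lborel wt * (wt (fst x) * wt (snd x)))"
  show "integrable lborel ?k" using wt_integrable_pair[OF wt_integrable] by simp
  show "norm (pv_integrand \<epsilon> b x) \<le> ?k x" for x
  proof (cases "\<epsilon> < \<bar>fst x - snd x\<bar>")
    case True
    then show ?thesis unfolding pv_integrand_def using norm_div_le[OF \<epsilon> True norm_C_le] by simp
  next
    case False
    then show ?thesis using \<epsilon> p.K_nonneg q.K_nonneg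
      by (auto simp: pv_integrand_def intro!: mult_nonneg_nonneg integral_nonneg_AE)
  qed
qed measurable

text \<open>The truncated integrand of the principal value, extended by 0. Keeping \<open>R\<close>
  general covers both forms of shift that occur, \<open>b * r\<close> and
  \<open>b * (r - R)\<close>.\<close>

definition pv_triple :: "real \<Rightarrow> real \<Rightarrow> real \<Rightarrow> real \<Rightarrow> real \<times> real \<Rightarrow> complex" where
  "pv_triple \<epsilon> b R u x = indicator {x. \<epsilon> < \<bar>fst x - snd x\<bar>} x *\<^sub>R
     (p.c 0 0 (u + b * (fst x - R)) (fst x) * cnj (q.c 0 0 (u + b * (snd x - R)) (snd x)) / of_real (fst x - snd x))"

lemma pv_triple_measurable: "(\<lambda>y. pv_triple \<epsilon> b R (fst y) (snd y)) \<in> borel_measurable borel"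
  unfolding pv_triple_def borel_prod[symmetric] by measurable

text \<open>The cut-off bounds the singular factor by \<open>inverse \<epsilon>\<close>. By
  \<open>wt_shear\<close> one of the two factors \<open>wt (fst x)\<close> is traded for a weight in
  \<open>u\<close> that no longer depends on \<open>r\<close>.\<close>

lemma pv_triple_integrable:
  assumes \<epsilon>: "0 < \<epsilon>"
  shows "integrable (lborel \<Otimes>\<^sub>M lborel) (\<lambda>(u, x). pv_triple \<epsilon> b R u x)"
proof (rule integrable_le)
  let ?f = "\<lambda>u. inverse \<epsilon> * (p.K 0 0 * q.K 0 0 * (2 * (1 + b\<^sup>2))) * wt (u - b * R)"
  show "integrable (lborel \<Otimes>\<^sub>M lborel) (\<lambda>(u, x). ?f u * (wt (fst x) * wt (snd x)))"
    using integrable_translate(2)[OF wt_integrable] by (intro wt_integrable_triple') auto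
  show "(\<lambda>(u, x). pv_triple \<epsilon> b R u x) \<in> borel_measurable (lborel \<Otimes>\<^sub>M lborel)"
    using pv_triple_measurable by (simp add: lborel_prod case_prod_beta')
  have "norm (pv_triple \<epsilon> b R u x) \<le> ?f u * (wt (fst x) * wt (snd x))" for u x
  proof (cases "\<epsilon> < \<bar>fst x - snd x\<bar>")
    case True
    have "wt (u + b * (fst x - R)) * (wt (fst x))\<^sup>2 \<le> (2 * (1 + b\<^sup>2) * wt (u - b * R) * inverse (wt (fst x))) * (wt (fst x))\<^sup>2"
      using wt_shear[of "u - b * R" b "fst x"] by (intro mult_right_mono) (auto simp: algebra_simps)
    also have "\<dots> = 2 * (1 + b\<^sup>2) * wt (u - b * R) * wt (fst x)"
      by (simp add: power2_eq_square less_imp_neq[OF wt_pos, symmetric])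
    finally have w: "wt (u + b * (fst x - R)) * (wt (fst x))\<^sup>2 \<le> 2 * (1 + b\<^sup>2) * wt (u - b * R) * wt (fst x)" .
    have "norm (p.c 0 0 (u + b * (fst x - R)) (fst x)) \<le> p.K 0 0 * (2 * (1 + b\<^sup>2) * wt (u - b * R) * wt (fst x))"
      using p.norm_c_le mult_left_mono[OF w p.K_nonneg] by (rule order_trans)
    then have "norm (p.c 0 0 (u + b * (fst x - R)) (fst x)) * norm (q.c 0 0 (u + b * (snd x - R)) (snd x))
        \<le> (p.K 0 0 * (2 * (1 + b\<^sup>2) * wt (u - b * R) * wt (fst x))) * (q.K 0 0 * wt (snd x))"
      by (intro mult_mono q.norm_c_le_r mult_nonneg_nonneg p.K_nonneg) auto
    then have "norm (p.c 0 0 (u + b * (fst x - R)) (fst x) * cnj (q.c 0 0 (u + b * (snd x - R)) (snd x)))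
        \<le> (p.K 0 0 * (2 * (1 + b\<^sup>2) * wt (u - b * R) * wt (fst x))) * (q.K 0 0 * wt (snd x))"
      by (simp only: norm_mult complex_mod_cnj)
    from norm_div_le[OF \<epsilon> True this] True show ?thesis by (simp add: pv_triple_def ac_simps)
  next
    case False
    then show ?thesis using \<epsilon> p.K_nonneg q.K_nonneg
      by (auto simp: pv_triple_def intro!: mult_nonneg_nonneg add_nonneg_nonneg)
  qed
  then show "norm (case y of (u, x) \<Rightarrow> pv_triple \<epsilon> b R u x) \<le> (case y of (u, x) \<Rightarrow> ?f u * (wt (fst x) * wt (snd x)))" for y
    by (auto split: prod.split)
qed

text \<open>Integrating in \<open>u\<close> first, a translation makes \<open>R\<close> disappear
  and leaves only the relative shift \<open>b * (s - r)\<close>; this is the argument of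
  \<open>C\<close> in \<open>pv_integrand\<close>.\<close>

lemma integral_pv_triple:
  assumes \<epsilon>: "0 < \<epsilon>"
  shows "(\<integral>u. \<integral>r. \<integral>s. pv_triple \<epsilon> b R u (r, s) \<partial>lborel \<partial>lborel \<partial>lborel) = Pv \<epsilon> b"
proof -
  have i: "integrable (lborel \<Otimes>\<^sub>M lborel) (\<lambda>(r, s). pv_triple \<epsilon> b R u (r, s))" for u
  proof -
    let ?k = "\<lambda>x. inverse \<epsilon> * (p.K 0 0 * q.K 0 0 * (wt (fst x) * wt (snd x)))"
    have "integrable lborel (pv_triple \<epsilon> b R u)"
    proof (rule integrable_le)
      show "integrable lborel ?k" using wt_integrable_pair[OF wt_integrable] by simp
      show "pv_triple \<epsilon> b R u \<in> borel_measurable lborel"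
        unfolding pv_triple_def[abs_def] lborel_prod[symmetric] by measurable
      show "norm (pv_triple \<epsilon> b R u x) \<le> ?k x" for x
      proof (cases "\<epsilon> < \<bar>fst x - snd x\<bar>")
        case True
        have "norm (p.c 0 0 (u + b * (fst x - R)) (fst x) * cnj (q.c 0 0 (u + b * (snd x - R)) (snd x)))
            \<le> (p.K 0 0 * wt (fst x)) * (q.K 0 0 * wt (snd x))"
          unfolding norm_mult complex_mod_cnj
          by (intro mult_mono p.norm_c_le_r q.norm_c_le_r mult_nonneg_nonneg p.K_nonneg) auto
        also have "\<dots> = p.K 0 0 * q.K 0 0 * (wt (fst x) * wt (snd x))" by simp
        finally have "norm (p.c 0 0 (u + b * (fst x - R)) (fst x) * cnj (q.c 0 0 (u + b * (snd x - R)) (snd x)))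
            \<le> p.K 0 0 * q.K 0 0 * (wt (fst x) * wt (snd x))" .
        from norm_div_le[OF \<epsilon> True this] True show ?thesis by (simp add: pv_triple_def)
      next
        case False
        then show ?thesis using \<epsilon> p.K_nonneg q.K_nonneg
          by (auto simp: pv_triple_def intro!: mult_nonneg_nonneg)
      qed
    qed
    then show ?thesis by (simp add: lborel_prod)
  qed
  have "(\<integral>u. \<integral>r. \<integral>s. pv_triple \<epsilon> b R u (r, s) \<partial>lborel \<partial>lborel \<partial>lborel) = (\<integral>u. \<integral>x. pv_triple \<epsilon> b R u x \<partial>lborel \<partial>lborel)"
    using lborel_pair.integral_fst[OF i] by (simp add: lborel_prod)
  also have "\<dots> = (\<integral>x. \<integral>u. pv_triple \<epsilon> b R u x \<partial>lborel \<partial>lborel)"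
    by (rule integral_pair_swap[OF pv_triple_integrable[OF \<epsilon>]])
  also have "\<dots> = Pv \<epsilon> b"
    unfolding Pv_def
  proof (rule Bochner_Integration.integral_cong[OF refl])
    fix x :: "real \<times> real"
    have "(\<integral>u. p.c 0 0 (u + b * (fst x - R)) (fst x) * cnj (q.c 0 0 (u + b * (snd x - R)) (snd x)) \<partial>lborel)
        = C (fst x) (snd x) (b * (snd x - fst x))"
      using integral_translate(1)[of "\<lambda>u. p.c 0 0 u (fst x) * cnj (q.c 0 0 (u + b * (snd x - fst x)) (snd x))" "b * (fst x - R)"]
      by (simp add: C_def algebra_simps)
    then show "(\<integral>u. pv_triple \<epsilon> b R u x \<partial>lborel) = pv_integrand \<epsilon> b x"
      unfolding pv_triple_def pv_integrand_def by (simp only: integral_scaleR_right integral_divide_zero)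
  qed
  finally show ?thesis .
qed

text \<open>A primitive in \<open>X\<close> is the exponential divided by \<open>r - s\<close>:
  integration consumes the factor \<open>\<i> * of_real \<xi>\<close> and creates the singular
  kernel of the principal values.\<close>

lemma X_kernel_eq:
  assumes "a < b" "r \<noteq> s"
  shows "X_kernel {a<..<b} \<xi> r s =
    (exp (- (\<i> * of_real (b * (s - r)) * of_real \<xi>)) - exp (- (\<i> * of_real (a * (s - r)) * of_real \<xi>))) / of_real (r - s)"
proof -
  let ?F = "\<lambda>X. exp (\<i> * of_real \<xi> * of_real X * of_real (r - s)) / of_real (r - s)"
  let ?f = "\<lambda>X. \<i> * of_real \<xi> * exp (\<i> * of_real \<xi> * of_real X * of_real (r - s))"
  have "(LBINT X=ereal a..ereal b. ?f X) = ?F b - ?F a"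
  proof (rule interval_integral_FTC_finite)
    show "continuous_on {min a b..max a b} ?f" by (intro continuous_intros)
    show "(?F has_vector_derivative ?f x) (at x within {min a b..max a b})" for x
      by (rule has_vector_derivative_real_field[where f = "\<lambda>z. exp (\<i> * of_real \<xi> * z * of_real (r - s)) / of_real (r - s)"])
        (use assms in \<open>auto intro!: derivative_eq_intros\<close>)
  qed
  then have "X_kernel {a<..<b} \<xi> r s = ?F b - ?F a"
    using assms by (simp add: X_kernel_def interval_lebesgue_integral_def)
  then show ?thesis by (simp add: diff_divide_distrib algebra_simps)
qed

text \<open>In the difference of the two truncated integrands the singularity cancels: it is the
  cut-off of a function integrable across the diagonal, so the cut-off can be removed by dominated
  convergence.\<close>

lemma Pv_diff_tendsto:
  assumes ab: "a < b"
  shows "((\<lambda>\<epsilon>. Pv \<epsilon> b - Pv \<epsilon> a) \<longlongrightarrow> (LBINT X:{a<..<b}. h X)) (at_right 0)"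
proof -
  let ?I = "{a<..<b}" and ?M = "max \<bar>a\<bar> \<bar>b\<bar>"
  have I: "?I \<in> sets borel" "?I \<subseteq> {- ?M..?M}" by auto
  note ker = X_kernel_measurable[OF I] norm_\<phi>_X_kernel_le[OF I] \<phi>_X_kernel_integrable[OF I]
  define k where "k = p.A * q.A * (\<integral>X. indicator ?I X \<partial>lborel)"
  note [measurable (raw)] = ker(1)
  define \<Xi> where "\<Xi> x = (\<integral>\<xi>. \<phi> \<xi> (fst x) (snd x) * X_kernel ?I \<xi> (fst x) (snd x) \<partial>lborel)" for x
  have \<Xi>m: "\<Xi> \<in> borel_measurable lborel"
    unfolding \<Xi>_def lborel_prod[symmetric] by measurable
  have \<Xi>le: "norm (\<Xi> x) \<le> k * integral\<^sup>L lborel wt * (wt (fst x) * wt (snd x))" for x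
  proof -
    have "norm (\<Xi> x) \<le> (\<integral>\<xi>. k * (wt \<xi> * (wt (fst x) * wt (snd x))) \<partial>lborel)"
      unfolding \<Xi>_def k_def by (rule norm_integral_le[OF _ ker(2)]) simp
    then show ?thesis by (simp add: ac_simps)
  qed
  have \<Xi>int: "(\<integral>x. \<Xi> x \<partial>lborel) = 2 * of_real pi * (LBINT X:?I. h X)"
  proof -
    have \<phi>i: "integrable (lborel \<Otimes>\<^sub>M lborel) (\<lambda>(r, s). \<phi> \<xi> r s * X_kernel ?I \<xi> r s)" for \<xi>
    proof (rule integrable_pair_of_product_bound[where g = "\<lambda>r. k * (wt \<xi> * wt r)" and k = wt])
      show "(\<lambda>x. \<phi> \<xi> (fst x) (snd x) * X_kernel ?I \<xi> (fst x) (snd x)) \<in> borel_measurable borel"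
        unfolding borel_prod[symmetric] by measurable
      show "norm (\<phi> \<xi> r s * X_kernel ?I \<xi> r s) \<le> k * (wt \<xi> * wt r) * wt s" for r s
        using ker(2)[of \<xi> r s] by (simp add: k_def mult.assoc)
    qed auto
    have "(\<integral>x. \<Xi> x \<partial>lborel) = (\<integral>\<xi>. \<integral>x. \<phi> \<xi> (fst x) (snd x) * X_kernel ?I \<xi> (fst x) (snd x) \<partial>lborel \<partial>lborel)"
      unfolding \<Xi>_def
      by (rule integral_pair_swap[symmetric]) (use ker(3) in \<open>simp add: lborel_prod case_prod_beta'\<close>)
    also have "\<dots> = (\<integral>\<xi>. \<integral>r. \<integral>s. \<phi> \<xi> r s * X_kernel ?I \<xi> r s \<partial>lborel \<partial>lborel \<partial>lborel)"
      using lborel_pair.integral_fst[OF \<phi>i] by (simp add: lborel_prod case_prod_beta')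
    also have "\<dots> = 2 * of_real pi * (LBINT X:?I. h X)"
      by (rule triple_integral_\<phi>_X_kernel[OF I])
    finally show ?thesis .
  qed
  \<comment> \<open>Off the diagonal, \<open>X_kernel_eq\<close> under the \<xi>-integral identifies
    the difference quotient in \<open>C\<close> with \<open>\<Xi>\<close> up to the factor 1/(2
    \<pi>).\<close>
  let ?T = "\<lambda>\<epsilon>::real. {x::real\<times>real. \<epsilon> < \<bar>fst x - snd x\<bar>}"
  have eq: "Pv \<epsilon> b - Pv \<epsilon> a = (\<integral>x. indicator (?T \<epsilon>) x *\<^sub>R (1 / (2 * of_real pi) * \<Xi> x) \<partial>lborel)" if "\<epsilon> \<in> {0<..}" for \<epsilon>
  proof -
    have "pv_integrand \<epsilon> b x - pv_integrand \<epsilon> a x = indicator (?T \<epsilon>) x *\<^sub>R (1 / (2 * of_real pi) * \<Xi> x)" for x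
    proof (cases "\<epsilon> < \<bar>fst x - snd x\<bar>")
      case True
      then have rs: "fst x \<noteq> snd x" using that by auto
      have \<phi>i: "integrable lborel (\<lambda>\<xi>. \<phi> \<xi> (fst x) (snd x) * exp (- (\<i> * of_real t * of_real \<xi>)))" for t
      proof (rule integrable_le)
        show "integrable lborel (\<lambda>\<xi>. p.A * q.A * wt \<xi>)" by simp
        show "norm (\<phi> \<xi> (fst x) (snd x) * exp (- (\<i> * of_real t * of_real \<xi>))) \<le> p.A * q.A * wt \<xi>" for \<xi>
        proof -
          have "p.A * q.A * (wt \<xi>)\<^sup>2 * (wt (fst x) * wt (snd x)) \<le> p.A * q.A * wt \<xi> * 1"
            using p.A_nonneg q.A_nonneg
            by (intro mult_mono mult_left_mono mult_le_one mult_nonneg_nonneg) (auto simp: power2_eq_square mult_left_le)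
          then show ?thesis using norm_\<phi>_le[of \<xi> "fst x" "snd x"] by (simp add: norm_mult)
        qed
      qed measurable
      have "C (fst x) (snd x) (b * (snd x - fst x)) / of_real (fst x - snd x) - C (fst x) (snd x) (a * (snd x - fst x)) / of_real (fst x - snd x)
          = 1 / (2 * of_real pi) * (((\<integral>\<xi>. \<phi> \<xi> (fst x) (snd x) * exp (- (\<i> * of_real (b * (snd x - fst x)) * of_real \<xi>)) \<partial>lborel)
           - (\<integral>\<xi>. \<phi> \<xi> (fst x) (snd x) * exp (- (\<i> * of_real (a * (snd x - fst x)) * of_real \<xi>)) \<partial>lborel)) / of_real (fst x - snd x))"
      proof -
        have "k * x / d - k * y / d = k * ((x - y) / d)" for k x y d :: complex
          by (simp add: diff_divide_distrib right_diff_distrib)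
        then show ?thesis unfolding C_eq_\<phi> .
      qed
      also have "\<dots> = 1 / (2 * of_real pi) * \<Xi> x"
      proof -
        have "\<phi> \<xi> r s * (exp z - exp w) = \<phi> \<xi> r s * exp z - \<phi> \<xi> r s * exp w" for \<xi> r s z w
          by (rule right_diff_distrib)
        then show ?thesis
          unfolding \<Xi>_def X_kernel_eq[OF ab rs] times_divide_eq_right
          by (simp only: integral_divide_zero Bochner_Integration.integral_diff[OF \<phi>i \<phi>i] times_divide_eq_right)
      qed
      finally show ?thesis using True by (simp add: pv_integrand_def)
    qed (simp add: pv_integrand_def)
    then show ?thesis
      unfolding Pv_def using that by (subst Bochner_Integration.integral_diff[symmetric]) (auto intro: pv_integrand_integrable)
  qed
  have "((\<lambda>\<epsilon>. \<integral>x. indicator (?T \<epsilon>) x *\<^sub>R (1 / (2 * of_real pi) * \<Xi> x) \<partial>lborel) \<longlongrightarrow> (\<integral>x. 1 / (2 * of_real pi) * \<Xi> x \<partial>lborel)) (at_right 0)"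
  proof (rule tendsto_integral_at_within)
    show "integrable lborel (\<lambda>x. norm (1 / (2 * of_real pi) :: complex) * (k * integral\<^sup>L lborel wt * (wt (fst x) * wt (snd x))))"
      using wt_integrable_pair[OF wt_integrable] by simp
    have T: "?T \<epsilon> \<in> sets borel" for \<epsilon>
      by (intro borel_open open_Collect_less continuous_intros)
    show "(\<lambda>x. indicator (?T \<epsilon>) x *\<^sub>R (1 / (2 * of_real pi) * \<Xi> x)) \<in> borel_measurable lborel" for \<epsilon>
      using \<Xi>m T by (intro borel_measurable_scaleR borel_measurable_indicator borel_measurable_times) auto
    show "(\<lambda>x. 1 / (2 * of_real pi) * \<Xi> x) \<in> borel_measurable lborel"
      using \<Xi>m by simp
    show "AE x in lborel. ((\<lambda>\<epsilon>. indicator (?T \<epsilon>) x *\<^sub>R (1 / (2 * of_real pi) * \<Xi> x)) \<longlongrightarrow> 1 / (2 * of_real pi) * \<Xi> x) (at_right 0)"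
      using AE_lborel_off_diagonal
    proof eventually_elim
      case (elim x)
      then have "\<forall>\<^sub>F \<epsilon> in at_right 0. \<epsilon> < \<bar>fst x - snd x\<bar>"
        by (auto simp: eventually_at_right_field intro!: exI[of _ "\<bar>fst x - snd x\<bar>"])
      then show ?case
        by (intro tendsto_eventually) (auto elim!: eventually_mono)
    qed
    show "norm (indicator (?T \<epsilon>) x *\<^sub>R (1 / (2 * of_real pi) * \<Xi> x))
        \<le> norm (1 / (2 * of_real pi) :: complex) * (k * integral\<^sup>L lborel wt * (wt (fst x) * wt (snd x)))" for \<epsilon> x
    proof -
      have "norm (indicator (?T \<epsilon>) x *\<^sub>R (1 / (2 * of_real pi) * \<Xi> x)) \<le> norm (1 / (2 * of_real pi) * \<Xi> x)"
        by (simp add: indicator_def)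
      also have "\<dots> \<le> norm (1 / (2 * of_real pi) :: complex) * (k * integral\<^sup>L lborel wt * (wt (fst x) * wt (snd x)))"
        unfolding norm_mult by (intro mult_left_mono \<Xi>le) auto
      finally show ?thesis .
    qed
  qed
  moreover have "(\<integral>x. 1 / (2 * of_real pi) * \<Xi> x \<partial>lborel) = (LBINT X:?I. h X)"
    unfolding integral_mult_right_zero \<Xi>int by simp
  ultimately have "((\<lambda>\<epsilon>. \<integral>x. indicator (?T \<epsilon>) x *\<^sub>R (1 / (2 * of_real pi) * \<Xi> x) \<partial>lborel) \<longlongrightarrow> (LBINT X:?I. h X)) (at_right 0)"
    by simp
  then show ?thesis
    by (rule Lim_transform_eventually) (use eq in \<open>auto simp: eventually_at_filter\<close>)
qed

section \<open>The symmetrised principal value\<close>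

definition E :: "real \<Rightarrow> complex" where
  "E X = (\<integral>x. (C (fst x) (snd x) (X * (snd x - fst x)) - C (snd x) (fst x) (X * (snd x - fst x))) / of_real (fst x - snd x) \<partial>lborel)"

text \<open>The first summand serves away from the diagonal, where the two values of
  \<open>C\<close> are estimated separately; the second serves within distance 1 of it, where a
  Lipschitz bound holds and \<open>wt (r - s)\<close> is at least 1/2, which the factor 2
  compensates.\<close>

definition E_bound :: "real \<times> real \<Rightarrow> real" where
  "E_bound x = 2 * (p.K 0 0 * q.K 0 0 * integral\<^sup>L lborel wt) * (wt (fst x) * wt (snd x))
    + 2 * ((p.K 0 0 * q.K 0 1 + p.K 0 1 * q.K 0 0) * integral\<^sup>L lborel wt) * (wt (fst x) * wt (fst x - snd x))"

lemma E_bound_integrable: "integrable lborel E_bound"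
proof -
  have "integrable (lborel \<Otimes>\<^sub>M lborel) (\<lambda>(r, s). wt r * wt (r - s))"
  proof (rule integrable_pair_of_integral_bound)
    show "(\<lambda>x. wt (fst x) * wt (fst x - snd x)) \<in> borel_measurable borel"
      unfolding borel_prod[symmetric] by measurable
    show "integrable lborel (\<lambda>r. wt r * integral\<^sup>L lborel wt)" by simp
    show "integrable lborel (\<lambda>s. wt r * wt (r - s))" for r
      using integrable_translate(3)[OF wt_integrable] by simp
    show "(\<integral>s. norm (wt r * wt (r - s)) \<partial>lborel) \<le> wt r * integral\<^sup>L lborel wt" for r
      using integral_translate(3)[of wt r] by (simp add: abs_mult)
  qed
  then show ?thesis
    using wt_integrable_pair[OF wt_integrable]
    unfolding E_bound_def[abs_def] by (simp add: lborel_prod case_prod_beta')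
qed

lemma C_eq_0: "r < rp \<or> s < rp \<Longrightarrow> C r s t = 0"
  by (auto simp: C_def p.c_eq_0 q.c_eq_0)

text \<open>One radius is changed at a time, passing through \<open>C r r t\<close>. Each step uses
  the Lipschitz bound in one factor and decay in the other, with the factor \<open>wt r\<close>
  coming from the factor held at \<open>r\<close>.\<close>

lemma norm_C_diff_le:
  assumes "rp \<le> r" "rp \<le> s"
  shows "norm (C r s t - C s r t) \<le> (p.K 0 0 * q.K 0 1 + p.K 0 1 * q.K 0 0) * integral\<^sup>L lborel wt * wt r * \<bar>r - s\<bar>"
proof -
  have "norm (C r s t - C r r t) \<le> p.K 0 0 * q.K 0 1 * integral\<^sup>L lborel wt * wt r * \<bar>r - s\<bar>"
  proof -
    define k where "k = p.K 0 0 * q.K 0 1 * wt r * \<bar>r - s\<bar>"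
    have eq: "C r s t - C r r t = (\<integral>u. p.c 0 0 u r * cnj (q.c 0 0 (u + t) s) - p.c 0 0 u r * cnj (q.c 0 0 (u + t) r) \<partial>lborel)"
      unfolding C_def by (rule Bochner_Integration.integral_diff[OF C_integrand_integrable C_integrand_integrable, symmetric])
    have "norm (C r s t - C r r t) \<le> (\<integral>u. k * wt u \<partial>lborel)"
      unfolding eq
    proof (rule norm_integral_le)
      fix u
      have "q.K 0 1 * wt (u + t) * \<bar>s - r\<bar> \<le> q.K 0 1 * 1 * \<bar>s - r\<bar>"
        by (intro mult_right_mono mult_left_mono q.K_nonneg) auto
      then have "norm (q.c 0 0 (u + t) s - q.c 0 0 (u + t) r) \<le> q.K 0 1 * 1 * \<bar>s - r\<bar>"
        using q.c_lipschitz[OF assms(2,1), of 0 0 "u + t", folded One_nat_def] by (rule order_trans[rotated])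
      then have "norm (p.c 0 0 u r) * norm (q.c 0 0 (u + t) s - q.c 0 0 (u + t) r) \<le> (p.K 0 0 * (wt u * wt r)) * (q.K 0 1 * 1 * \<bar>s - r\<bar>)"
        by (intro mult_mono p.norm_c_le' mult_nonneg_nonneg p.K_nonneg wt_nonneg norm_ge_zero)
      also have "\<dots> = k * wt u" by (simp add: k_def abs_minus_commute)
      finally show "norm (p.c 0 0 u r * cnj (q.c 0 0 (u + t) s) - p.c 0 0 u r * cnj (q.c 0 0 (u + t) r)) \<le> k * wt u"
        unfolding right_diff_distrib[symmetric] complex_cnj_diff[symmetric] norm_mult complex_mod_cnj .
    qed simp
    also have "\<dots> = p.K 0 0 * q.K 0 1 * integral\<^sup>L lborel wt * wt r * \<bar>r - s\<bar>" by (simp add: k_def)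
    finally show ?thesis .
  qed
  moreover have "norm (C r r t - C s r t) \<le> p.K 0 1 * q.K 0 0 * integral\<^sup>L lborel wt * wt r * \<bar>r - s\<bar>"
  proof -
    define k where "k = p.K 0 1 * q.K 0 0 * wt r * \<bar>r - s\<bar>"
    have eq: "C r r t - C s r t = (\<integral>u. p.c 0 0 u r * cnj (q.c 0 0 (u + t) r) - p.c 0 0 u s * cnj (q.c 0 0 (u + t) r) \<partial>lborel)"
      unfolding C_def by (rule Bochner_Integration.integral_diff[OF C_integrand_integrable C_integrand_integrable, symmetric])
    have "norm (C r r t - C s r t) \<le> (\<integral>u. k * wt u \<partial>lborel)"
      unfolding eq
    proof (rule norm_integral_le)
      fix u
      have "norm (p.c 0 0 u r - p.c 0 0 u s) * norm (q.c 0 0 (u + t) r) \<le> (p.K 0 1 * wt u * \<bar>r - s\<bar>) * (q.K 0 0 * wt r)"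
        using p.c_lipschitz[OF assms, of 0 0 u, folded One_nat_def]
        by (intro mult_mono q.norm_c_le_r mult_nonneg_nonneg p.K_nonneg wt_nonneg norm_ge_zero abs_ge_zero)
      also have "\<dots> = k * wt u" by (simp add: k_def)
      finally show "norm (p.c 0 0 u r * cnj (q.c 0 0 (u + t) r) - p.c 0 0 u s * cnj (q.c 0 0 (u + t) r)) \<le> k * wt u"
        unfolding left_diff_distrib[symmetric] norm_mult complex_mod_cnj .
    qed simp
    also have "\<dots> = p.K 0 1 * q.K 0 0 * integral\<^sup>L lborel wt * wt r * \<bar>r - s\<bar>" by (simp add: k_def)
    finally show ?thesis .
  qed
  moreover have "norm (C r s t - C s r t) \<le> norm (C r s t - C r r t) + norm (C r r t - C s r t)"
    using norm_triangle_ineq[of "C r s t - C r r t" "C r r t - C s r t"] by simp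
  ultimately show ?thesis unfolding distrib_right by linarith
qed

text \<open>The bound does not depend on \<open>t\<close>, hence it dominates the integrand of
  \<open>E X\<close> for all \<open>X\<close> at once. The Lipschitz estimate holds inside the
  half-plane; outside it both values of \<open>C\<close> vanish.\<close>

lemma norm_C_quotient_le: "norm ((C r s t - C s r t) / of_real (r - s)) \<le> E_bound (r, s)"
proof -
  let ?a = "p.K 0 0 * q.K 0 0 * integral\<^sup>L lborel wt"
  let ?b = "(p.K 0 0 * q.K 0 1 + p.K 0 1 * q.K 0 0) * integral\<^sup>L lborel wt"
  have a: "0 \<le> ?a * (wt r * wt s)" and b: "0 \<le> ?b * (wt r * wt (r - s))"
    using p.K_nonneg q.K_nonneg by (auto intro!: mult_nonneg_nonneg add_nonneg_nonneg integral_nonneg_AE)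
  have E: "E_bound (r, s) = 2 * (?a * (wt r * wt s)) + 2 * (?b * (wt r * wt (r - s)))"
    by (simp add: E_bound_def)
  consider "r < rp \<or> s < rp" | "r = s" | "rp \<le> r" "rp \<le> s" "r \<noteq> s" "\<bar>r - s\<bar> \<le> 1" | "1 < \<bar>r - s\<bar>"
    by linarith
  then show ?thesis
  proof cases
    case 1
    then show ?thesis using a b E by (auto simp: C_eq_0)
  next
    \<comment> \<open>On the diagonal division by 0 gives 0.\<close>
    case 2
    then show ?thesis using a b E by simp
  next
    case 3
    have "norm ((C r s t - C s r t) / of_real (r - s)) = norm (C r s t - C s r t) / \<bar>r - s\<bar>"
      by (simp add: norm_divide flip: of_real_diff)
    also have "\<dots> \<le> ?b * wt r"
      using norm_C_diff_le[OF 3(1,2), of t] 3(3) by (simp add: pos_divide_le_eq)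
    also have "\<dots> = 2 * (?b * (wt r * (1 / 2)))" by simp
    also have "\<dots> \<le> 2 * (?b * (wt r * wt (r - s)))"
    proof -
      have "(r - s)\<^sup>2 \<le> 1" using 3(4) by (simp add: abs_square_le_1)
      then have "1 / 2 \<le> wt (r - s)" by (simp add: wt_def field_simps add_pos_nonneg)
      then show ?thesis using p.K_nonneg q.K_nonneg
        by (intro mult_left_mono) (auto intro!: mult_nonneg_nonneg add_nonneg_nonneg integral_nonneg_AE)
    qed
    finally show ?thesis using a E by linarith
  next
    case 4
    have "norm (C r s t - C s r t) \<le> ?a * (wt r * wt s) + ?a * (wt s * wt r)"
      by (rule order_trans[OF norm_triangle_ineq4 add_mono[OF norm_C_le norm_C_le]])
    then have "norm (C r s t - C s r t) \<le> 2 * (?a * (wt r * wt s))"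
      by (simp only: mult.commute[of "wt s" "wt r"] mult_2)
    from norm_div_le[OF zero_less_one 4 this] show ?thesis
      unfolding E inverse_1 mult_1 using b by linarith
  qed
qed

text \<open>
  Exchanging \<open>r\<close> and \<open>s\<close> in \<open>Pv \<epsilon> (- X)\<close> turns the singular integrand of the sum into a difference
  quotient, which has an integrable majorant.
\<close>

lemma Pv_add_tendsto: "((\<lambda>\<epsilon>. Pv \<epsilon> X + Pv \<epsilon> (- X)) \<longlongrightarrow> E X) (at_right 0)"
proof -
  let ?T = "\<lambda>\<epsilon>::real. {x::real\<times>real. \<epsilon> < \<bar>fst x - snd x\<bar>}"
  let ?q = "\<lambda>x. (C (fst x) (snd x) (X * (snd x - fst x)) - C (snd x) (fst x) (X * (snd x - fst x))) / of_real (fst x - snd x)"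
  have eq: "Pv \<epsilon> X + Pv \<epsilon> (- X) = (\<integral>x. indicator (?T \<epsilon>) x *\<^sub>R ?q x \<partial>lborel)" if "\<epsilon> \<in> {0<..}" for \<epsilon>
  proof -
    have i: "integrable (lborel \<Otimes>\<^sub>M lborel) (pv_integrand \<epsilon> (- X))"
      unfolding lborel_prod using that by (intro pv_integrand_integrable) auto
    have "Pv \<epsilon> (- X) = (\<integral>(r, s). pv_integrand \<epsilon> (- X) (s, r) \<partial>(lborel \<Otimes>\<^sub>M lborel))"
      unfolding Pv_def lborel_prod[symmetric]
      using lborel_pair.integral_product_swap[OF borel_measurable_integrable[OF i]] by simp
    also have "\<dots> = (\<integral>x. pv_integrand \<epsilon> (- X) (snd x, fst x) \<partial>lborel)"
      by (simp add: lborel_prod case_prod_beta')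
    finally have 1: "Pv \<epsilon> (- X) = (\<integral>x. pv_integrand \<epsilon> (- X) (snd x, fst x) \<partial>lborel)" .
    have 2: "integrable lborel (\<lambda>x. pv_integrand \<epsilon> (- X) (snd x, fst x))"
      using lborel_pair.integrable_product_swap[OF i] by (simp add: lborel_prod case_prod_beta')
    have "pv_integrand \<epsilon> X x + pv_integrand \<epsilon> (- X) (snd x, fst x) = indicator (?T \<epsilon>) x *\<^sub>R ?q x" for x
    proof -
      \<comment> \<open>Reversing the sign of \<open>X\<close> and exchanging the radii leave the
        shift unchanged, so both terms contain \<open>C\<close> at the same third argument.\<close>
      have 3: "- X * (fst x - snd x) = X * (snd x - fst x)" by (simp add: algebra_simps)
      have "z / complex_of_real (snd x - fst x) = - (z / of_real (fst x - snd x))" for z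
        by (metis minus_diff_eq of_real_minus divide_minus_right)
      then show ?thesis
        unfolding pv_integrand_def fst_conv snd_conv 3
        by (simp add: indicator_def abs_minus_commute diff_divide_distrib del: of_real_diff)
    qed
    then show ?thesis
      unfolding 1 unfolding Pv_def using that 2
      by (subst Bochner_Integration.integral_add[symmetric]) (auto intro: pv_integrand_integrable)
  qed
  have "((\<lambda>\<epsilon>. \<integral>x. indicator (?T \<epsilon>) x *\<^sub>R ?q x \<partial>lborel) \<longlongrightarrow> E X) (at_right 0)"
    unfolding E_def
  proof (rule tendsto_integral_at_within[OF E_bound_integrable])
    have qm: "?q \<in> borel_measurable lborel"
      unfolding lborel_prod[symmetric] by measurable
    then show "?q \<in> borel_measurable lborel" .
    have T: "?T \<epsilon> \<in> sets borel" for \<epsilon>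
      by (intro borel_open open_Collect_less continuous_intros)
    show "(\<lambda>x. indicator (?T \<epsilon>) x *\<^sub>R ?q x) \<in> borel_measurable lborel" for \<epsilon>
      using qm T by (intro borel_measurable_scaleR borel_measurable_indicator) auto
    show "AE x in lborel. ((\<lambda>\<epsilon>. indicator (?T \<epsilon>) x *\<^sub>R ?q x) \<longlongrightarrow> ?q x) (at_right 0)"
      using AE_lborel_off_diagonal
    proof eventually_elim
      case (elim x)
      then have "\<forall>\<^sub>F \<epsilon> in at_right 0. \<epsilon> < \<bar>fst x - snd x\<bar>"
        by (auto simp: eventually_at_right_field intro!: exI[of _ "\<bar>fst x - snd x\<bar>"])
      then show ?case
        by (intro tendsto_eventually) (auto elim!: eventually_mono)
    qed
    show "norm (indicator (?T \<epsilon>) x *\<^sub>R ?q x) \<le> E_bound x" for \<epsilon> x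
    proof -
      have "norm (indicator (?T \<epsilon>) x *\<^sub>R ?q x) \<le> norm (?q x)" by (simp add: indicator_def)
      also have "\<dots> \<le> E_bound (fst x, snd x)" by (rule norm_C_quotient_le)
      finally show ?thesis by simp
    qed
  qed
  then show ?thesis
    by (rule Lim_transform_eventually) (use eq in \<open>auto simp: eventually_at_filter\<close>)
qed

text \<open>The shift carries the second factor off to infinity, to the right or to the left
  according to the sign of \<open>d\<close>, while the product stays below a multiple of
  \<open>wt u\<close>.\<close>

lemma C_tendsto_0:
  assumes "d \<noteq> 0"
  shows "((\<lambda>X. C r s (X * d)) \<longlongrightarrow> 0) at_top"
proof -
  have "((\<lambda>X. \<integral>u. p.c 0 0 u r * cnj (q.c 0 0 (u + X * d) s) \<partial>lborel) \<longlongrightarrow> integral\<^sup>L lborel (\<lambda>_::real. 0 :: complex)) at_top"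
  proof (rule integral_dominated_convergence_at_top[where w = "\<lambda>u. (p.K 0 0 * wt u) * q.K 0 0"])
    have "((\<lambda>X. q.c 0 0 (u + X * d) s) \<longlongrightarrow> 0) at_top" for u
    proof (cases "0 < d")
      case True
      have "filterlim (\<lambda>X. u + X * d) at_top at_top"
        by (intro filterlim_tendsto_add_at_top[OF tendsto_const]
            filterlim_at_top_mult_tendsto_pos[OF tendsto_const True] filterlim_ident)
      then show ?thesis by (rule filterlim_compose[OF q.c_tendsto_0(1)])
    next
      case False
      then have "0 < - d" using assms by simp
      then have "filterlim (\<lambda>X. - u + X * (- d)) at_top at_top"
        by (intro filterlim_tendsto_add_at_top[OF tendsto_const]
            filterlim_at_top_mult_tendsto_pos[OF tendsto_const] filterlim_ident)
      then have "filterlim (\<lambda>X. u + X * d) at_bot at_top"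
        unfolding filterlim_uminus_at_top by (simp add: add.commute)
      then show ?thesis by (rule filterlim_compose[OF q.c_tendsto_0(2)])
    qed
    then have "((\<lambda>X. p.c 0 0 u r * cnj (q.c 0 0 (u + X * d) s)) \<longlongrightarrow> p.c 0 0 u r * cnj 0) at_top" for u
      by (intro tendsto_intros)
    then show "AE u in lborel. ((\<lambda>X. p.c 0 0 u r * cnj (q.c 0 0 (u + X * d) s)) \<longlongrightarrow> 0) at_top" by simp
    show "\<forall>\<^sub>F X in at_top. AE u in lborel. norm (p.c 0 0 u r * cnj (q.c 0 0 (u + X * d) s)) \<le> (p.K 0 0 * wt u) * q.K 0 0"
    proof (intro always_eventually allI AE_I2)
      fix X u
      have "q.K 0 0 * wt (u + X * d) \<le> q.K 0 0" by (intro mult_left_le q.K_nonneg) auto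
      then have "norm (q.c 0 0 (u + X * d) s) \<le> q.K 0 0" using q.norm_c_le_u[of 0 0 "u + X * d" s] by linarith
      then show "norm (p.c 0 0 u r * cnj (q.c 0 0 (u + X * d) s)) \<le> (p.K 0 0 * wt u) * q.K 0 0"
        unfolding norm_mult complex_mod_cnj
        by (intro mult_mono p.norm_c_le_u mult_nonneg_nonneg p.K_nonneg) auto
    qed
  qed auto
  then show ?thesis by (simp add: C_def)
qed

text \<open>Dominated convergence with the majorant \<open>E_bound\<close>, which does not depend on
  \<open>X\<close>. Off the diagonal both terms tend to 0, and on it the quotient is 0 by
  convention.\<close>

lemma E_tendsto_0: "(E \<longlongrightarrow> 0) at_top"
proof -
  have "(E \<longlongrightarrow> integral\<^sup>L lborel (\<lambda>_::real\<times>real. 0 :: complex)) at_top"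
    unfolding E_def[abs_def]
  proof (rule integral_dominated_convergence_at_top[where w = E_bound])
    let ?q = "\<lambda>X x. (C (fst x) (snd x) (X * (snd x - fst x)) - C (snd x) (fst x) (X * (snd x - fst x))) / of_real (fst x - snd x)"
    show "?q X \<in> borel_measurable lborel" for X
      unfolding lborel_prod[symmetric] by measurable
    show "AE x in lborel. ((\<lambda>X. ?q X x) \<longlongrightarrow> 0) at_top"
    proof (rule AE_I2)
      fix x :: "real \<times> real"
      show "((\<lambda>X. ?q X x) \<longlongrightarrow> 0) at_top"
      proof (cases "fst x = snd x")
        case False
        then have "((\<lambda>X. ?q X x) \<longlongrightarrow> (0 - 0) / of_real (fst x - snd x)) at_top"
          by (intro tendsto_divide tendsto_diff C_tendsto_0 tendsto_const) auto
        then show ?thesis by simp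
      qed simp
    qed
    show "\<forall>\<^sub>F X in at_top. AE x in lborel. norm (?q X x) \<le> E_bound x"
    proof (intro always_eventually allI AE_I2)
      show "norm (?q X x) \<le> E_bound x" for X x
        using norm_C_quotient_le[of "fst x" "snd x"] by simp
    qed
  qed (use E_bound_integrable in auto)
  then show ?thesis by simp
qed

section \<open>Existence of the principal values and their relation to the flux\<close>

lemma Pv_convergent: "\<exists>l. ((\<lambda>\<epsilon>. Pv \<epsilon> b) \<longlongrightarrow> l) (at_right 0)"
proof -
  \<comment> \<open>At 0 the symmetrised sum is twice the truncated principal value; every other
    level is reached from here by \<open>Pv_diff_tendsto\<close>.\<close>
  have 0: "((\<lambda>\<epsilon>. Pv \<epsilon> 0) \<longlongrightarrow> E 0 / 2) (at_right 0)"
    using tendsto_divide[OF Pv_add_tendsto[of 0] tendsto_const, of 2] by simp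
  consider "b < 0" | "b = 0" | "0 < b" by linarith
  then show ?thesis
  proof cases
    case 1
    from tendsto_diff[OF 0 Pv_diff_tendsto[OF 1]] show ?thesis by auto
  next
    case 3
    from tendsto_add[OF 0 Pv_diff_tendsto[OF 3]] show ?thesis by auto
  qed (use 0 in auto)
qed

definition PV :: "real \<Rightarrow> complex" where
  "PV b = (SOME l. ((\<lambda>\<epsilon>. Pv \<epsilon> b) \<longlongrightarrow> l) (at_right 0))"

lemma Pv_tendsto: "((\<lambda>\<epsilon>. Pv \<epsilon> b) \<longlongrightarrow> PV b) (at_right 0)"
  unfolding PV_def using Pv_convergent by (rule someI_ex)

lemma PV_diff: "a < b \<Longrightarrow> (LBINT X:{a<..<b}. h X) = PV b - PV a"
  using tendsto_unique[OF _ Pv_diff_tendsto tendsto_diff[OF Pv_tendsto Pv_tendsto]] by simp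

lemma PV_add: "PV X + PV (- X) = E X"
  using tendsto_unique[OF _ tendsto_add[OF Pv_tendsto Pv_tendsto] Pv_add_tendsto] by simp

lemma PV_left_half_line: "(LBINT X:{..<b}. h X) = (\<integral>X. h X \<partial>lborel) / 2 + PV b"
proof -
  have 1: "((\<lambda>Y. LBINT X:{- Y<..<b}. h X) \<longlongrightarrow> (LBINT X:{..<b}. h X)) at_top"
  proof (rule tendsto_set_integral_at_top[OF h_integrable])
    show "\<forall>\<^sub>F Y in at_top. x \<in> {- Y<..<b} \<longleftrightarrow> x \<in> {..<b}" for x
      using eventually_gt_at_top[of "- x"] by eventually_elim auto
  qed auto
  have 2: "((\<lambda>Y. LBINT X:{- Y<..<Y}. h X) \<longlongrightarrow> (LBINT X:UNIV. h X)) at_top"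
  proof (rule tendsto_set_integral_at_top[OF h_integrable])
    show "\<forall>\<^sub>F Y in at_top. x \<in> {- Y<..<Y} \<longleftrightarrow> x \<in> UNIV" for x :: real
      using eventually_gt_at_top[of "\<bar>x\<bar>"] by eventually_elim auto
  qed auto
  \<comment> \<open>\<open>PV_diff\<close> gives \<open>PV Y - PV (- Y)\<close> as the integral of
    \<open>h\<close> over the symmetric interval and \<open>PV_add\<close> gives the sum as
    \<open>E Y\<close>. Solving for \<open>PV (- Y)\<close> produces the expression whose limit is
    taken.\<close>
  have "((\<lambda>Y. PV b + ((LBINT X:{- Y<..<Y}. h X) - E Y) / 2) \<longlongrightarrow> PV b + ((LBINT X:UNIV. h X) - 0) / 2) at_top"
    by (intro tendsto_intros 2 E_tendsto_0) simp
  moreover have "\<forall>\<^sub>F Y in at_top. PV b + ((LBINT X:{- Y<..<Y}. h X) - E Y) / 2 = (LBINT X:{- Y<..<b}. h X)"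
    using eventually_gt_at_top[of "max 0 (- b)"]
    by eventually_elim (simp add: PV_diff flip: PV_add)
  ultimately have "((\<lambda>Y. LBINT X:{- Y<..<b}. h X) \<longlongrightarrow> PV b + ((LBINT X:UNIV. h X) - 0) / 2) at_top"
    by (rule Lim_transform_eventually)
  from tendsto_unique[OF _ 1 this] show ?thesis by (simp add: set_lebesgue_integral_def add.commute)
qed

end

section \<open>Return to the original functions\<close>

context half_plane_pair
begin

context
  fixes \<psi>1 \<psi>2 :: "real \<Rightarrow> real \<Rightarrow> complex"
  assumes \<psi>1: "\<And>u r. rp \<le> r \<Longrightarrow> P 0 0 u r = \<psi>1 u r"
    and \<psi>2: "\<And>u r. rp \<le> r \<Longrightarrow> Q 0 0 u r = \<psi>2 u r"
begin

text \<open>Zero extension turns the integrals over the truncated half-lines into the integral of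
  \<open>pv_triple\<close>, whose value does not see \<open>R\<close>; the limit is therefore the
  same \<open>PV b\<close> for every base point.\<close>

lemma has_pv_PV:
  "has_pv rp (\<lambda>u r s. \<psi>1 (u + b * (r - R)) r * cnj (\<psi>2 (u + b * (s - R)) s) / of_real (r - s)) (PV b)"
proof -
  let ?g = "\<lambda>u r s. \<psi>1 (u + b * (r - R)) r * cnj (\<psi>2 (u + b * (s - R)) s) / complex_of_real (r - s)"
  have set: "indicator {(u, r, s). rp \<le> r \<and> rp \<le> s \<and> \<epsilon> < \<bar>r - s\<bar>} (u, r, s) *\<^sub>R ?g u r s = pv_triple \<epsilon> b R u (r, s)"
    for \<epsilon> u r s
    by (auto simp: pv_triple_def indicator_def p.c_eq q.c_eq p.c_eq_0 q.c_eq_0 \<psi>1 \<psi>2 not_le)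
  have nest: "indicator {rp..} r *\<^sub>R (indicator {s. rp \<le> s \<and> \<epsilon> < \<bar>r - s\<bar>} s *\<^sub>R ?g u r s) = pv_triple \<epsilon> b R u (r, s)"
    for \<epsilon> u r s
    unfolding set[symmetric] by (auto simp: indicator_def)
  have int: "(LBINT u. LBINT r:{rp..}. LBINT s:{s. rp \<le> s \<and> \<epsilon> < \<bar>r - s\<bar>}. ?g u r s) = Pv \<epsilon> b" if "0 < \<epsilon>" for \<epsilon>
    unfolding integral_pv_triple[OF that, of b R, symmetric] nest[symmetric] integral_scaleR_right
      set_lebesgue_integral_def ..
  show ?thesis
    unfolding has_pv_def
  proof (intro conjI allI impI)
    fix \<epsilon> :: real assume \<epsilon>: "0 < \<epsilon>"
    have "(\<lambda>x. indicator {(u, r, s). rp \<le> r \<and> rp \<le> s \<and> \<epsilon> < \<bar>r - s\<bar>} x *\<^sub>R (case x of (u, r, s) \<Rightarrow> ?g u r s))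
        = (\<lambda>(u, x). pv_triple \<epsilon> b R u x)"
      using set by (auto simp: fun_eq_iff)
    then show "set_integrable lborel {(u, r, s). rp \<le> r \<and> rp \<le> s \<and> \<epsilon> < \<bar>r - s\<bar>} (\<lambda>(u, r, s). ?g u r s)"
      unfolding set_integrable_def using pv_triple_integrable[OF \<epsilon>, of b R] by (simp only: lborel_prod)
  next
    show "((\<lambda>\<epsilon>. LBINT u. LBINT r:{rp..}. LBINT s:{s. rp \<le> s \<and> \<epsilon> < \<bar>r - s\<bar>}. ?g u r s) \<longlongrightarrow> PV b) (at_right 0)"
      using Pv_tendsto[of b] by (rule Lim_transform_eventually) (auto simp: eventually_at_filter int simp del: of_real_diff)
  qed
qed

lemma fourier_eq_ch:
  assumes "rp \<le> r"
  shows "fourier (\<lambda>u. \<psi>1 u r) = (\<lambda>\<xi>. p.ch 0 0 \<xi> r)" "fourier (\<lambda>u. \<psi>2 u r) = (\<lambda>\<xi>. q.ch 0 0 \<xi> r)"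
  using assms by (auto simp: p.ch_def q.ch_def p.c_eq q.c_eq \<psi>1 \<psi>2)

lemma fourier_integrable: "rp \<le> r \<Longrightarrow> integrable lborel (fourier (\<lambda>u. \<psi>2 u r))"
  by (simp add: fourier_eq_ch q.ch_integrable)

lemma indicator_kernel:
  "indicator {rp..} r *\<^sub>R (indicator {rp..} s *\<^sub>R (fourier (\<lambda>u. \<psi>1 u r) \<xi> * cnj (fourier (\<lambda>u. \<psi>2 u s) \<xi>) * z)) = \<phi> \<xi> r s * z"
  by (auto simp: indicator_def \<phi>_def fourier_eq_ch p.ch_eq_0 q.ch_eq_0)

lemma kernel_integrable:
  assumes "I \<in> sets borel" "I \<subseteq> {- M..M}"
  shows "set_integrable lborel (UNIV \<times> {rp..} \<times> {rp..})
    (\<lambda>(\<xi>, r, s). fourier (\<lambda>u. \<psi>1 u r) \<xi> * cnj (fourier (\<lambda>u. \<psi>2 u s) \<xi>) * X_kernel I \<xi> r s)"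
proof -
  have "(\<lambda>x. indicator (UNIV \<times> {rp..} \<times> {rp..}) x *\<^sub>R
      (case x of (\<xi>, r, s) \<Rightarrow> fourier (\<lambda>u. \<psi>1 u r) \<xi> * cnj (fourier (\<lambda>u. \<psi>2 u s) \<xi>) * X_kernel I \<xi> r s))
    = (\<lambda>(\<xi>, r, s). \<phi> \<xi> r s * X_kernel I \<xi> r s)"
    unfolding indicator_kernel[symmetric] by (auto simp: fun_eq_iff indicator_def)
  then show ?thesis
    unfolding set_integrable_def using \<phi>_X_kernel_integrable[OF assms] by simp
qed

lemma kernel_pairing_eq:
  assumes "I \<in> sets borel" "I \<subseteq> {- M..M}"
  shows "kernel_pairing rp I (\<lambda>\<xi> r s. fourier (\<lambda>u. \<psi>1 u r) \<xi> * cnj (fourier (\<lambda>u. \<psi>2 u s) \<xi>))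
    = 2 * of_real pi * (LBINT X:I. h X)"
  unfolding triple_integral_\<phi>_X_kernel[OF assms, symmetric]
  unfolding indicator_kernel[symmetric] integral_scaleR_right kernel_pairing_def set_lebesgue_integral_def ..

text \<open>Each truncation of \<open>I\<close> is bounded, so the kernel formula applies to it;
  since \<open>h\<close> is integrable, the truncated integrals converge.\<close>

lemma distributional_pairing:
  assumes I: "I \<in> sets borel"
  shows "has_distributional_pairing rp I (\<lambda>\<xi> r s. fourier (\<lambda>u. \<psi>1 u r) \<xi> * cnj (fourier (\<lambda>u. \<psi>2 u s) \<xi>))
    (2 * of_real pi * (LBINT X:I. h X))"
proof -
  have 1: "I \<inter> {a..b} \<in> sets borel" "I \<inter> {a..b} \<subseteq> {- max \<bar>a\<bar> \<bar>b\<bar>..max \<bar>a\<bar> \<bar>b\<bar>}" for a b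
    using I by auto
  have "((\<lambda>z. 2 * of_real pi * (case z of (a, b) \<Rightarrow> LBINT X:I \<inter> {a..b}. h X)) \<longlongrightarrow> 2 * of_real pi * (LBINT X:I. h X)) (at_bot \<times>\<^sub>F at_top)"
    by (intro tendsto_mult tendsto_const tendsto_integral_truncations h_integrable I)
  then show ?thesis
    unfolding has_distributional_pairing_def kernel_pairing_eq[OF 1]
    using kernel_integrable[OF 1] by (simp add: case_prod_beta')
qed

lemma c_hilbert:
  "indicator {rp..} r *\<^sub>R (\<psi>1 u r * cnj (hilbert (\<lambda>v. \<psi>2 v r) u)) = p.c 0 0 u r * cnj (q.Hc u r)"
  by (auto simp: indicator_def q.Hc_def p.c_eq q.c_eq p.c_eq_0 \<psi>1 \<psi>2)

lemma hilbert_integrable: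
  "set_integrable lborel (UNIV \<times> {rp..}) (\<lambda>(u, r). \<psi>1 u r * cnj (hilbert (\<lambda>v. \<psi>2 v r) u))"
proof -
  have "(\<lambda>x. indicator (UNIV \<times> {rp..}) x *\<^sub>R (case x of (u, r) \<Rightarrow> \<psi>1 u r * cnj (hilbert (\<lambda>v. \<psi>2 v r) u)))
      = (\<lambda>(u, r). p.c 0 0 u r * cnj (q.Hc u r))"
    unfolding c_hilbert[symmetric] by (auto simp: fun_eq_iff indicator_def)
  then show ?thesis unfolding set_integrable_def using c_Hc_integrable by simp
qed

lemma hilbert_pairing:
  "2 * of_real pi * (LBINT u. LBINT r:{rp..}. \<psi>1 u r * cnj (hilbert (\<lambda>v. \<psi>2 v r) u)) = (\<integral>X. h X \<partial>lborel)"
  unfolding integral_h_eq_hilbert set_lebesgue_integral_def c_hilbert ..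

end

end

section \<open>From rapid decay to weighted bounds, and the final assembly\<close>

lemma half_plane_decay_of_schwartz:
  assumes "schwartz_half_plane rp \<psi>"
  obtains D where "half_plane_decay rp D" "\<And>u r. rp \<le> r \<Longrightarrow> D 0 0 u r = \<psi> u r"
proof -
  obtain D where D: "half_plane_derivs rp \<psi> D"
    and dec: "\<And>j k N. \<exists>C. \<forall>u. \<forall>r\<ge>rp. (1 + \<bar>u\<bar> + \<bar>r\<bar>) ^ N * norm (D j k u r) \<le> C"
    using assms unfolding schwartz_half_plane_def by blast
  have "half_plane_decay rp D"
  proof
    fix j k
    \<comment> \<open>Six powers suffice: two dominate \<open>1 + u\<^sup>2\<close> and four
      dominate \<open>(1 + r\<^sup>2)\<^sup>2\<close>.\<close>
    obtain C where C: "\<And>u r. rp \<le> r \<Longrightarrow> (1 + \<bar>u\<bar> + \<bar>r\<bar>) ^ 6 * norm (D j k u r) \<le> C"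
      using dec[of 6 j k] by blast
    have "norm (D j k u r) \<le> C * (wt u * (wt r)\<^sup>2)" if r: "rp \<le> r" for u r
    proof -
      have "1 + u\<^sup>2 \<le> (1 + \<bar>u\<bar> + \<bar>r\<bar>)\<^sup>2" "1 + r\<^sup>2 \<le> (1 + \<bar>u\<bar> + \<bar>r\<bar>)\<^sup>2"
        by (auto simp: power2_eq_square algebra_simps abs_mult_self_eq)
      then have "(1 + u\<^sup>2) * (1 + r\<^sup>2)\<^sup>2 \<le> (1 + \<bar>u\<bar> + \<bar>r\<bar>)\<^sup>2 * ((1 + \<bar>u\<bar> + \<bar>r\<bar>)\<^sup>2)\<^sup>2"
        by (intro mult_mono power_mono) auto
      also have "\<dots> = (1 + \<bar>u\<bar> + \<bar>r\<bar>) ^ 6"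
        by (simp flip: power_mult power_add)
      finally have "(1 + u\<^sup>2) * (1 + r\<^sup>2)\<^sup>2 * norm (D j k u r) \<le> (1 + \<bar>u\<bar> + \<bar>r\<bar>) ^ 6 * norm (D j k u r)"
        by (intro mult_right_mono) auto
      also have "\<dots> \<le> C" using r by (rule C)
      finally have *: "(1 + u\<^sup>2) * (1 + r\<^sup>2)\<^sup>2 * norm (D j k u r) \<le> C" .
      have "0 < 1 + u\<^sup>2" "0 < (1 + r\<^sup>2)\<^sup>2" by (intro add_pos_nonneg zero_less_power; simp)+
      then have "norm (D j k u r) \<le> C / ((1 + u\<^sup>2) * (1 + r\<^sup>2)\<^sup>2)"
        using * by (simp add: pos_le_divide_eq mult.commute)
      then show ?thesis by (simp add: wt_def divide_inverse power_inverse)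
    qed
    then show "\<exists>C. \<forall>u. \<forall>r\<ge>rp. norm (D j k u r) \<le> C * (wt u * (wt r)\<^sup>2)" by blast
  qed (use D in \<open>auto simp: half_plane_derivs_def\<close>)
  moreover have "D 0 0 u r = \<psi> u r" if "rp \<le> r" for u r
    using D that by (simp add: half_plane_derivs_def)
  ultimately show thesis by (rule that)
qed

theorem proposition3p20:
  fixes rp S R Rt :: real
    and \<psi>1 \<psi>2 \<Psi>1 \<Psi>2 :: "real \<Rightarrow> real \<Rightarrow> complex"
    and \<phi> :: "real \<Rightarrow> real \<Rightarrow> real \<Rightarrow> complex"
  assumes "rp > 0" and "S < 0"
    and "schwartz_half_plane rp \<psi>1" and "schwartz_half_plane rp \<psi>2"
    and "\<Psi>1 = tilde rp S R Rt \<psi>1" and "\<Psi>2 = tilde rp S R Rt \<psi>2"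
    and "\<phi> = (\<lambda>\<xi> r s. fourier (\<lambda>u. \<psi>1 u r) \<xi> * cnj (fourier (\<lambda>u. \<psi>2 u s) \<xi>))"
  shows
    "(\<forall>I f. is_interval I \<and> regular_time_function (X_region S Rt I) f \<longrightarrow>
       (\<forall>rt\<in>X_region S Rt I. \<forall>\<tau>. (\<lambda>t. in_time_coords f \<Psi>1 t rt) differentiable at \<tau>) \<and>
       set_integrable lborel (X_region S Rt I \<times> UNIV) (\<lambda>(rt, \<tau>). flux_density f \<Psi>1 \<Psi>2 \<tau> rt) \<and>
       (bounded I \<longrightarrow>
          set_integrable lborel (UNIV \<times> {rp..} \<times> {rp..}) (\<lambda>(\<xi>, r, s). \<phi> \<xi> r s * X_kernel I \<xi> r s) \<and>
          flux S Rt I f \<Psi>1 \<Psi>2 = 1 / (2 * of_real pi) * kernel_pairing rp I \<phi>) \<and>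
       (\<exists>z. has_distributional_pairing rp I \<phi> z \<and>
          flux S Rt I f \<Psi>1 \<Psi>2 = 1 / (2 * of_real pi) * z)) \<and>
     (\<forall>\<alpha> \<beta> f. \<alpha> < \<beta> \<and> regular_time_function (X_region S Rt {\<alpha><..<\<beta>}) f \<longrightarrow>
       (\<exists>P Q.
          has_pv rp (\<lambda>u r s. \<psi>1 (u + \<beta> * r) r * cnj (\<psi>2 (u + \<beta> * s) s) / of_real (r - s)) P \<and>
          has_pv rp (\<lambda>u r s. \<psi>1 (u + \<alpha> * r) r * cnj (\<psi>2 (u + \<alpha> * s) s) / of_real (r - s)) Q \<and>
          flux S Rt {\<alpha><..<\<beta>} f \<Psi>1 \<Psi>2 = P - Q)) \<and>
     (\<forall>r\<ge>rp. integrable lborel (fourier (\<lambda>u. \<psi>2 u r))) \<and>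
     set_integrable lborel (UNIV \<times> {rp..}) (\<lambda>(u, r). \<psi>1 u r * cnj (hilbert (\<lambda>v. \<psi>2 v r) u)) \<and>
     (\<forall>f. regular_time_function (X_region S Rt {..<-2}) f \<longrightarrow>
       (\<exists>P.
          has_pv rp (\<lambda>u r s. \<psi>1 (u - 2 * (r - R)) r * cnj (\<psi>2 (u - 2 * (s - R)) s) / of_real (r - s)) P \<and>
          flux S Rt {..<-2} f \<Psi>1 \<Psi>2 =
            of_real pi * (LBINT u. LBINT r:{rp..}. \<psi>1 u r * cnj (hilbert (\<lambda>v. \<psi>2 v r) u)) + P)) \<and>
     (\<forall>f. regular_time_function (X_region S Rt UNIV) f \<longrightarrow>
       flux S Rt UNIV f \<Psi>1 \<Psi>2 =
         2 * of_real pi * (LBINT u. LBINT r:{rp..}. \<psi>1 u r * cnj (hilbert (\<lambda>v. \<psi>2 v r) u)))"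
proof -
  obtain P where P: "half_plane_decay rp P" and \<psi>1: "\<And>u r. rp \<le> r \<Longrightarrow> P 0 0 u r = \<psi>1 u r"
    using half_plane_decay_of_schwartz[OF assms(3)] by metis
  obtain Q where Q: "half_plane_decay rp Q" and \<psi>2: "\<And>u r. rp \<le> r \<Longrightarrow> Q 0 0 u r = \<psi>2 u r"
    using half_plane_decay_of_schwartz[OF assms(4)] by metis
  interpret half_plane_pair rp P Q
    using P Q by (intro half_plane_pair.intro)
  have S: "S \<noteq> 0" using assms(2) by simp
  have flux: "flux S Rt I f \<Psi>1 \<Psi>2 = (LBINT X:I. h X)" for I f
    unfolding assms(5,6) by (intro flux_eq \<psi>1 \<psi>2 S)
  have hilb: "2 * of_real pi * (LBINT u. LBINT r:{rp..}. \<psi>1 u r * cnj (hilbert (\<lambda>v. \<psi>2 v r) u)) = (\<integral>X. h X \<partial>lborel)"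
    by (rule hilbert_pairing[OF \<psi>1 \<psi>2])
  show ?thesis
  proof (intro conjI allI impI ballI; (elim conjE)?)
    fix I f rt \<tau>
    show "(\<lambda>t. in_time_coords f \<Psi>1 t rt) differentiable at \<tau>"
      unfolding assms(5)
      using in_time_coords_has_vector_derivative[OF \<psi>1 \<psi>2] by (rule differentiableI_vector)
  next
    fix I f assume "is_interval I" "regular_time_function (X_region S Rt I) f"
    then show "set_integrable lborel (X_region S Rt I \<times> UNIV) (\<lambda>(rt, \<tau>). flux_density f \<Psi>1 \<Psi>2 \<tau> rt)"
      unfolding assms(5,6) by (intro flux_density_integrable \<psi>1 \<psi>2 S)
  next
    fix I :: "real set" and f assume I: "is_interval I" and "bounded I"
    then obtain M where M: "I \<subseteq> {- M..M}" by (force simp: bounded_real abs_le_iff)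
    have I': "I \<in> sets borel" using I by (rule real_interval_borel_measurable)
    show "set_integrable lborel (UNIV \<times> {rp..} \<times> {rp..}) (\<lambda>(\<xi>, r, s). \<phi> \<xi> r s * X_kernel I \<xi> r s)"
      unfolding assms(7) by (rule kernel_integrable[OF \<psi>1 \<psi>2 I' M])
    have "kernel_pairing rp I \<phi> = 2 * of_real pi * (LBINT X:I. h X)"
      unfolding assms(7) by (rule kernel_pairing_eq[OF \<psi>1 \<psi>2 I' M])
    then show "flux S Rt I f \<Psi>1 \<Psi>2 = 1 / (2 * of_real pi) * kernel_pairing rp I \<phi>"
      by (simp add: flux)
  next
    fix I :: "real set" and f assume I: "is_interval I"
    show "\<exists>z. has_distributional_pairing rp I \<phi> z \<and> flux S Rt I f \<Psi>1 \<Psi>2 = 1 / (2 * of_real pi) * z"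
      unfolding assms(7) flux
      using distributional_pairing[OF \<psi>1 \<psi>2 real_interval_borel_measurable[OF I]] by (intro exI conjI) auto
  next
    fix \<alpha> \<beta> :: real and f assume "\<alpha> < \<beta>"
    then show "\<exists>P Q.
        has_pv rp (\<lambda>u r s. \<psi>1 (u + \<beta> * r) r * cnj (\<psi>2 (u + \<beta> * s) s) / of_real (r - s)) P \<and>
        has_pv rp (\<lambda>u r s. \<psi>1 (u + \<alpha> * r) r * cnj (\<psi>2 (u + \<alpha> * s) s) / of_real (r - s)) Q \<and>
        flux S Rt {\<alpha><..<\<beta>} f \<Psi>1 \<Psi>2 = P - Q"
      unfolding flux
      \<comment> \<open>Base point 0 gives the shifts \<open>\<beta> * r\<close> and
        \<open>\<alpha> * r\<close>.\<close>
      using has_pv_PV[OF \<psi>1 \<psi>2, of \<beta> 0] has_pv_PV[OF \<psi>1 \<psi>2, of \<alpha> 0] PV_diff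
      by (intro exI[of _ "PV \<beta>"] exI[of _ "PV \<alpha>"]) simp
  next
    fix r assume "rp \<le> r"
    then show "integrable lborel (fourier (\<lambda>u. \<psi>2 u r))" by (intro fourier_integrable[where ?\<psi>1.0 = \<psi>1] \<psi>1 \<psi>2)
  next
    show "set_integrable lborel (UNIV \<times> {rp..}) (\<lambda>(u, r). \<psi>1 u r * cnj (hilbert (\<lambda>v. \<psi>2 v r) u))"
      by (rule hilbert_integrable[OF \<psi>1 \<psi>2])
  next
    fix f
    have "u + - 2 * (r - R) = u - 2 * (r - R)" for u r by simp
    then have "has_pv rp (\<lambda>u r s. \<psi>1 (u - 2 * (r - R)) r * cnj (\<psi>2 (u - 2 * (s - R)) s) / of_real (r - s)) (PV (- 2))"
      using has_pv_PV[OF \<psi>1 \<psi>2, of "- 2" R] by (simp only:)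
    then show "\<exists>P.
        has_pv rp (\<lambda>u r s. \<psi>1 (u - 2 * (r - R)) r * cnj (\<psi>2 (u - 2 * (s - R)) s) / of_real (r - s)) P \<and>
        flux S Rt {..<-2} f \<Psi>1 \<Psi>2 =
          of_real pi * (LBINT u. LBINT r:{rp..}. \<psi>1 u r * cnj (hilbert (\<lambda>v. \<psi>2 v r) u)) + P"
      \<comment> \<open>The half-line carries half of the total integral of \<open>h\<close> plus
        \<open>PV (- 2)\<close>; halving the factor 2 \<pi> of the total leaves \<pi>.\<close>
      unfolding flux PV_left_half_line hilb[symmetric]
      by (intro exI[of _ "PV (- 2)"]) simp
  next
    fix f
    show "flux S Rt UNIV f \<Psi>1 \<Psi>2 =
        2 * of_real pi * (LBINT u. LBINT r:{rp..}. \<psi>1 u r * cnj (hilbert (\<lambda>v. \<psi>2 v r) u))"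
      unfolding flux hilb by (simp add: set_lebesgue_integral_def)
  qed
qed

end
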